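(* Let $0<\rho<1$ and let $0\le\delta\le\sqrt{\tfrac{1-\rho}{1+\rho}}$ be arbitrary. Set $\varphi=\rho+\delta\sqrt{1-\rho^2}$. Then there exist explicit one-way common randomness schemes for $\mathsf{DSBS}(\rho)$ and for $\mathsf{BGS}(\rho)$ using $\mathsf{poly}(k)$ samples such that: (1) the min-entropy of Alice's output key is at least $k-o(k)$; (2) the agreement probability is at least $2^{-\delta^2 k}$, up to factors polynomial in $k$; and (3) the communication is $O((1-\varphi^2)\cdot k)$ bits.
   Context: For $-1\le\rho\le 1$, $(X,Y)\sim\mathsf{DSBS}(\rho)$ means $X,Y$ are each uniform on $\{\pm1\}$ with $\mathbb{E}[XY]=\rho$; $(X,Y)\sim\mathsf{BGS}(\rho)$ means $X,Y$ are each standard normal, jointly Gaussian, with correlation $\rho$. A one-way common randomness scheme for a source $\mu$ generating $k$-bit keys: Alice receives $X^n$ and Bob receives $Y^n$, where $(X_i,Y_i)$, $i=1,\dots,n$, are i.i.d. samples from $\mu$; Alice sends one message to Bob and outputs $K_A\in\{0,1\}^k$ (a function of $X^n$); Bob outputs $K_B\in\{0,1\}^k$ (a function of $Y^n$ and the message). The agreement probability is $\Pr[K_A=K_B]$; the number of samples is $n$. *)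

theory Defs
  imports "HOL-Probability.Probability" "HOL-Library.Landau_Symbols"
begin

text \<open>Sources are probability measures on the Borel sets of the plane, so that both sources are
  treated by the same notion of scheme.\<close>

definition DSBS :: "real \<Rightarrow> (real \<times> real) measure" where
  "DSBS \<rho> = distr (measure_pmf (map_pmf (\<lambda>(x, b). (x, if b then x else - x))
     (pair_pmf (pmf_of_set {-1, 1}) (bernoulli_pmf ((1 + \<rho>) / 2))))) borel id"

definition BGS :: "real \<Rightarrow> (real \<times> real) measure" where
  "BGS \<rho> = distr (std_normal_distribution \<Otimes>\<^sub>M std_normal_distribution) borel
     (\<lambda>(u, v). (u, \<rho> * u + sqrt (1 - \<rho>\<^sup>2) * v))"

lemma DSBS_source:
  assumes "-1 \<le> \<rho>" "\<rho> \<le> 1"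
  shows "prob_space (DSBS \<rho>)" and "sets (DSBS \<rho>) = sets borel"
    and "distr (DSBS \<rho>) borel fst = distr (measure_pmf (pmf_of_set {-1, 1})) borel id"
    and "distr (DSBS \<rho>) borel snd = distr (measure_pmf (pmf_of_set {-1, 1})) borel id"
    and "(\<integral>p. fst p * snd p \<partial>DSBS \<rho>) = \<rho>"
proof -
  define p where "p = (1 + \<rho>) / 2"
  have p: "0 \<le> p" "p \<le> 1" using assms by (auto simp: p_def)
  define U :: "real pmf" where "U = pmf_of_set {-1, 1}"
  define Q where "Q = map_pmf (\<lambda>(x, b). (x, if b then x else - x)) (pair_pmf U (bernoulli_pmf p))"
  have D: "DSBS \<rho> = distr (measure_pmf Q) borel id"
    by (simp add: DSBS_def Q_def U_def p_def)
  show "prob_space (DSBS \<rho>)"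
    unfolding D by (rule measure_pmf.prob_space_distr) simp
  show "sets (DSBS \<rho>) = sets borel"
    by (simp add: D)
  have "map_pmf fst Q = map_pmf fst (pair_pmf U (bernoulli_pmf p))"
    unfolding Q_def map_pmf_comp by (rule map_pmf_cong) auto
  then have fst_Q: "map_pmf fst Q = U"
    by (simp add: map_fst_pair_pmf)
  have neg: "map_pmf uminus U = U"
    unfolding U_def by (subst map_pmf_of_set_inj) (auto simp: insert_commute)
  have "map_pmf snd Q = bind_pmf (bernoulli_pmf p) (\<lambda>b. map_pmf (\<lambda>x. if b then x else - x) U)"
    unfolding Q_def pair_pmf_def map_pmf_def
    by (subst bind_commute_pmf) (simp add: bind_assoc_pmf bind_return_pmf)
  also have "\<dots> = bind_pmf (bernoulli_pmf p) (\<lambda>_. U)"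
    by (rule bind_pmf_cong[OF refl]) (case_tac x, simp_all add: neg map_pmf_ident)
  finally have snd_Q: "map_pmf snd Q = U"
    by simp
  have marg: "distr (DSBS \<rho>) borel f = distr (measure_pmf (map_pmf f Q)) borel id"
    if [measurable]: "f \<in> borel_measurable borel" for f :: "real \<times> real \<Rightarrow> real"
    unfolding D by (simp add: distr_distr map_pmf_rep_eq comp_def id_def)
  show "distr (DSBS \<rho>) borel fst = distr (measure_pmf (pmf_of_set {-1, 1})) borel id"
    by (subst marg) (simp_all add: fst_Q U_def borel_measurable_continuous_onI continuous_on_fst)
  show "distr (DSBS \<rho>) borel snd = distr (measure_pmf (pmf_of_set {-1, 1})) borel id"
    by (subst marg) (simp_all add: snd_Q U_def borel_measurable_continuous_onI continuous_on_snd)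
  have "(\<integral>z. fst z * snd z \<partial>DSBS \<rho>) = measure_pmf.expectation Q (\<lambda>z. fst z * snd z)"
    unfolding D by (subst integral_distr)
      (auto intro!: borel_measurable_continuous_onI continuous_intros)
  also have "\<dots> = measure_pmf.expectation (pair_pmf U (bernoulli_pmf p))
      (\<lambda>z. fst z * (if snd z then fst z else - fst z))"
    unfolding Q_def by (simp add: case_prod_beta)
  also have "\<dots> = (\<Sum>z\<in>{-1, 1} \<times> UNIV. pmf (pair_pmf U (bernoulli_pmf p)) z *
      (fst z * (if snd z then fst z else - fst z)))"
    by (subst integral_measure_pmf[of "{-1, 1} \<times> UNIV"]) (auto simp: U_def)
  also have "\<dots> = 2 * p - 1"
    using p by (simp add: sum.cartesian_product[symmetric] UNIV_bool pmf_pair U_def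
        algebra_simps add_divide_distrib flip: sum.cartesian_product')
  also have "\<dots> = \<rho>"
    by (simp add: p_def field_simps)
  finally show "(\<integral>p. fst p * snd p \<partial>DSBS \<rho>) = \<rho>" .
qed

lemma BGS_source:
  assumes "-1 \<le> \<rho>" "\<rho> \<le> 1"
  shows "prob_space (BGS \<rho>)" and "sets (BGS \<rho>) = sets borel"
    and "distributed (BGS \<rho>) lborel fst std_normal_density"
    and "distributed (BGS \<rho>) lborel snd std_normal_density"
    and "\<And>a b. 0 < a\<^sup>2 + 2 * \<rho> * a * b + b\<^sup>2 \<Longrightarrow>
      distributed (BGS \<rho>) lborel (\<lambda>p. a * fst p + b * snd p)
        (normal_density 0 (sqrt (a\<^sup>2 + 2 * \<rho> * a * b + b\<^sup>2)))"
    and "(\<integral>p. fst p * snd p \<partial>BGS \<rho>) = \<rho>"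
proof -
  define N where "N = density lborel (\<lambda>x. ennreal (std_normal_density x))"
  define r where "r = sqrt (1 - \<rho>\<^sup>2)"
  have r: "\<rho>\<^sup>2 + r\<^sup>2 = 1"
    using assms by (simp add: r_def abs_square_le_1 abs_le_iff)
  interpret N: prob_space N
    unfolding N_def by (rule prob_space_normal_density) simp
  interpret NN: pair_prob_space N N ..
  have sN [measurable_cong]: "sets N = sets borel"
    by (simp add: N_def)
  have dN: "distr N lborel (\<lambda>x. x) = density lborel (\<lambda>x. ennreal (std_normal_density x))"
    unfolding N_def by (rule distr_id2) simp
  define g where "g = (\<lambda>z. (fst z, \<rho> * fst z + r * snd z :: real))"
  have B: "BGS \<rho> = distr (N \<Otimes>\<^sub>M N) borel g"
    by (simp add: BGS_def N_def g_def r_def case_prod_beta')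
  have g [measurable]: "g \<in> N \<Otimes>\<^sub>M N \<rightarrow>\<^sub>M borel"
    unfolding g_def by measurable
  show P: "prob_space (BGS \<rho>)"
    unfolding B by (rule NN.prob_space_distr) simp
  show "sets (BGS \<rho>) = sets borel"
    by (simp add: B)
  have d1: "distributed (N \<Otimes>\<^sub>M N) lborel fst std_normal_density"
  proof -
    have "distr (N \<Otimes>\<^sub>M N) lborel fst = distr (distr (N \<Otimes>\<^sub>M N) N fst) lborel (\<lambda>x. x)"
      by (subst distr_distr) (auto simp: comp_def)
    also have "distr (N \<Otimes>\<^sub>M N) N fst = N"
      by (simp add: N.distr_pair_fst)
    finally show ?thesis
      by (simp add: distributed_def dN)
  qed
  have d2: "distributed (N \<Otimes>\<^sub>M N) lborel snd std_normal_density"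
  proof -
    have "distr (N \<Otimes>\<^sub>M N) lborel snd = distr (distr (N \<Otimes>\<^sub>M N) N snd) lborel (\<lambda>x. x)"
      by (subst distr_distr) (auto simp: comp_def)
    also have "distr (N \<Otimes>\<^sub>M N) N snd = distr (distr (N \<Otimes>\<^sub>M N) (N \<Otimes>\<^sub>M N) (\<lambda>(x, y). (y, x))) N fst"
      by (subst distr_distr) (auto simp: comp_def case_prod_beta)
    also have "\<dots> = N"
      by (subst NN.distr_pair_swap[symmetric]) (simp add: N.distr_pair_fst)
    finally show ?thesis
      by (simp add: distributed_def dN)
  qed
  have ind: "NN.indep_var borel fst borel snd"
  proof -
    have "distr (N \<Otimes>\<^sub>M N) borel fst = N" "distr (N \<Otimes>\<^sub>M N) borel snd = N"
      using d1 d2 by (simp_all add: distributed_def N_def cong: distr_cong)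
    moreover have "distr (N \<Otimes>\<^sub>M N) (borel \<Otimes>\<^sub>M borel) (\<lambda>z. (fst z, snd z)) = N \<Otimes>\<^sub>M N"
      by (simp add: distr_id2 sN cong: sets_pair_measure_cong)
    ultimately show ?thesis
      by (simp add: NN.indep_var_distribution_eq)
  qed
  have lin: "distributed (N \<Otimes>\<^sub>M N) lborel (\<lambda>z. c * fst z + d * snd z) (normal_density 0 (sqrt (c\<^sup>2 + d\<^sup>2)))"
    if "0 < c\<^sup>2 + d\<^sup>2" for c d
  proof -
    have c: "distributed (N \<Otimes>\<^sub>M N) lborel (\<lambda>z. c * fst z) (normal_density 0 \<bar>c\<bar>)" if "c \<noteq> 0" for c
      using NN.normal_density_affine[OF d1, of c 0] that by simp
    have d: "distributed (N \<Otimes>\<^sub>M N) lborel (\<lambda>z. d * snd z) (normal_density 0 \<bar>d\<bar>)" if "d \<noteq> 0" for d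
      using NN.normal_density_affine[OF d2, of d 0] that by simp
    have "NN.indep_var borel ((\<lambda>x. c * x) \<circ> fst) borel ((\<lambda>x. d * x) \<circ> snd)"
      by (rule NN.indep_var_compose[OF ind]) auto
    then have i: "NN.indep_var borel (\<lambda>z. c * fst z) borel (\<lambda>z. d * snd z)"
      by (simp add: comp_def)
    show ?thesis
    proof (cases "c = 0 \<or> d = 0")
      case True
      then show ?thesis using that c d by auto
    next
      case False
      then show ?thesis
        using NN.add_indep_normal[OF i _ _ c d] by simp
    qed
  qed
  have push: "distributed (BGS \<rho>) lborel f h"
    if "distributed (N \<Otimes>\<^sub>M N) lborel (\<lambda>z. f (g z)) h" and [measurable]: "f \<in> borel_measurable borel" for f h
    using that unfolding distributed_def B by (simp add: distr_distr comp_def)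
  show comb: "distributed (BGS \<rho>) lborel (\<lambda>p. a * fst p + b * snd p)
        (normal_density 0 (sqrt (a\<^sup>2 + 2 * \<rho> * a * b + b\<^sup>2)))"
    if "0 < a\<^sup>2 + 2 * \<rho> * a * b + b\<^sup>2" for a b
  proof (rule push)
    have e: "(a + b * \<rho>)\<^sup>2 + (b * r)\<^sup>2 = a\<^sup>2 + 2 * \<rho> * a * b + b\<^sup>2"
    proof -
      have "(a + b * \<rho>)\<^sup>2 + (b * r)\<^sup>2 = a\<^sup>2 + 2 * \<rho> * a * b + b\<^sup>2 * (\<rho>\<^sup>2 + r\<^sup>2)"
        by (simp add: power2_eq_square algebra_simps)
      then show ?thesis by (simp add: r)
    qed
    show "distributed (N \<Otimes>\<^sub>M N) lborel (\<lambda>z. a * fst (g z) + b * snd (g z))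
        (normal_density 0 (sqrt (a\<^sup>2 + 2 * \<rho> * a * b + b\<^sup>2)))"
      using lin[of "a + b * \<rho>" "b * r"] that unfolding e by (simp add: g_def algebra_simps)
  qed (intro borel_measurable_continuous_onI continuous_intros)
  show F: "distributed (BGS \<rho>) lborel fst std_normal_density"
    using comb[of 1 0] by simp
  show S: "distributed (BGS \<rho>) lborel snd std_normal_density"
    using comb[of 0 1] by simp
  interpret G: prob_space "BGS \<rho>" by (rule P)
  have mom: "integrable (BGS \<rho>) (\<lambda>p. (X p)\<^sup>2) \<and> (\<integral>p. (X p)\<^sup>2 \<partial>BGS \<rho>) = \<sigma>\<^sup>2"
    if X: "distributed (BGS \<rho>) lborel X (normal_density 0 \<sigma>)" and "0 < \<sigma>" for X \<sigma>
  proof -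
    have "has_bochner_integral lborel (\<lambda>x. normal_density 0 \<sigma> x * x\<^sup>2) (\<sigma>\<^sup>2)"
      using normal_moment_even[OF \<open>0 < \<sigma>\<close>, of 0 1] by (simp add: power2_eq_square)
    then show ?thesis
      using distributed_integrable[OF X, of "\<lambda>x. x\<^sup>2"] distributed_integral[OF X, of "\<lambda>x. x\<^sup>2"]
      by (simp add: has_bochner_integral_iff)
  qed
  define s :: real where "s = (if \<rho> > -1 then 1 else -1)"
  have s: "s * s = 1" "0 < 2 + 2 * \<rho> * s"
    using assms by (auto simp: s_def)
  have c: "distributed (BGS \<rho>) lborel (\<lambda>p. fst p + s * snd p) (normal_density 0 (sqrt (2 + 2 * \<rho> * s)))"
    using comb[of 1 s] s by (simp add: power2_eq_square)
  note m = mom[OF c] mom[OF F] mom[OF S]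
  have "(\<integral>p. fst p * snd p \<partial>BGS \<rho>) =
      (\<integral>p. s / 2 * ((fst p + s * snd p)\<^sup>2 - (fst p)\<^sup>2 - (snd p)\<^sup>2) \<partial>BGS \<rho>)"
  proof (rule Bochner_Integration.integral_cong[OF refl])
    fix p :: "real \<times> real"
    have "s / 2 * ((fst p + s * snd p)\<^sup>2 - (fst p)\<^sup>2 - (snd p)\<^sup>2) =
        (s * s) * (fst p * snd p) + s / 2 * ((s * s) - 1) * (snd p)\<^sup>2"
      by (simp add: power2_eq_square field_simps)
    then show "fst p * snd p = s / 2 * ((fst p + s * snd p)\<^sup>2 - (fst p)\<^sup>2 - (snd p)\<^sup>2)"
      by (simp add: s)
  qed
  also have "\<dots> = s / 2 * ((2 + 2 * \<rho> * s) - 1 - 1)"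
    using m s by (simp add: Bochner_Integration.integral_diff)
  also have "\<dots> = (s * s) * \<rho>"
    by simp
  finally show "(\<integral>p. fst p * snd p \<partial>BGS \<rho>) = \<rho>"
    by (simp add: s)
qed

record cr_scheme =
  num_samples :: nat
  msg_len :: nat
  alice_msg :: "(nat \<Rightarrow> real) \<Rightarrow> bool list"
  alice_key :: "(nat \<Rightarrow> real) \<Rightarrow> bool list"
  bob_key :: "(nat \<Rightarrow> real) \<Rightarrow> bool list \<Rightarrow> bool list"

definition one_way_scheme :: "nat \<Rightarrow> cr_scheme \<Rightarrow> bool" where
  "one_way_scheme k S \<longleftrightarrow>
     alice_msg S \<in> Pi\<^sub>M {..<num_samples S} (\<lambda>_. borel) \<rightarrow>\<^sub>M count_space {m. length m = msg_len S} \<and>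
     alice_key S \<in> Pi\<^sub>M {..<num_samples S} (\<lambda>_. borel) \<rightarrow>\<^sub>M count_space {K. length K = k} \<and>
     (\<forall>m. length m = msg_len S \<longrightarrow>
       (\<lambda>y. bob_key S y m) \<in> Pi\<^sub>M {..<num_samples S} (\<lambda>_. borel) \<rightarrow>\<^sub>M count_space {K. length K = k})"

definition iid_samples :: "(real \<times> real) measure \<Rightarrow> nat \<Rightarrow> (nat \<Rightarrow> real \<times> real) measure" where
  "iid_samples \<mu> n = Pi\<^sub>M {..<n} (\<lambda>_. \<mu>)"

definition alice_input :: "nat \<Rightarrow> (nat \<Rightarrow> real \<times> real) \<Rightarrow> nat \<Rightarrow> real" where
  "alice_input n \<omega> = (\<lambda>i\<in>{..<n}. fst (\<omega> i))"

definition bob_input :: "nat \<Rightarrow> (nat \<Rightarrow> real \<times> real) \<Rightarrow> nat \<Rightarrow> real" where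
  "bob_input n \<omega> = (\<lambda>i\<in>{..<n}. snd (\<omega> i))"

definition min_entropy :: "'w measure \<Rightarrow> ('w \<Rightarrow> 'v) \<Rightarrow> real" where
  "min_entropy M V = - log 2 (SUP v. measure M {\<omega> \<in> space M. V \<omega> = v})"

definition key_min_entropy :: "(real \<times> real) measure \<Rightarrow> cr_scheme \<Rightarrow> real" where
  "key_min_entropy \<mu> S =
     min_entropy (iid_samples \<mu> (num_samples S)) (\<lambda>\<omega>. alice_key S (alice_input (num_samples S) \<omega>))"

definition agreement_prob :: "(real \<times> real) measure \<Rightarrow> cr_scheme \<Rightarrow> real" where
  "agreement_prob \<mu> S = (let n = num_samples S; P = iid_samples \<mu> n in
     measure P {\<omega> \<in> space P. alice_key S (alice_input n \<omega>) =
       bob_key S (bob_input n \<omega>) (alice_msg S (alice_input n \<omega>))})"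

text \<open>A family of schemes is explicit if it is given by formulas: all its components are
  elementary recursive functions over the reals, i.e. they arise from the key length, the received
  data and the fixed parameters (here the numbers in \<open>A\<close>) by arithmetic operations, rounding, the
  functions sqrt, exp and ln, case distinctions, and bounded sums and products. The same formulas
  must serve for all key lengths. Except for the numbers in \<open>A\<close> there are no real constants, as a
  single real constant could encode the tables of arbitrary schemes for all key lengths.\<close>

inductive elementary :: "real set \<Rightarrow> (real list \<Rightarrow> real) \<Rightarrow> bool" for A :: "real set" where
  param: "a \<in> A \<Longrightarrow> elementary A (\<lambda>xs. a)"
| nat_const: "elementary A (\<lambda>xs. real n)"
| num_args: "elementary A (\<lambda>xs. real (length xs))"
| arg: "elementary A f \<Longrightarrow>
    elementary A (\<lambda>xs. if nat \<lfloor>f xs\<rfloor> < length xs then xs ! nat \<lfloor>f xs\<rfloor> else 0)"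
| add: "elementary A f \<Longrightarrow> elementary A g \<Longrightarrow> elementary A (\<lambda>xs. f xs + g xs)"
| diff: "elementary A f \<Longrightarrow> elementary A g \<Longrightarrow> elementary A (\<lambda>xs. f xs - g xs)"
| mult: "elementary A f \<Longrightarrow> elementary A g \<Longrightarrow> elementary A (\<lambda>xs. f xs * g xs)"
| divide: "elementary A f \<Longrightarrow> elementary A g \<Longrightarrow> elementary A (\<lambda>xs. f xs / g xs)"
| floor: "elementary A f \<Longrightarrow> elementary A (\<lambda>xs. of_int \<lfloor>f xs\<rfloor>)"
| sqrt: "elementary A f \<Longrightarrow> elementary A (\<lambda>xs. sqrt (f xs))"
| exp: "elementary A f \<Longrightarrow> elementary A (\<lambda>xs. exp (f xs))"
| ln: "elementary A f \<Longrightarrow> elementary A (\<lambda>xs. ln (f xs))"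
| cond: "elementary A f \<Longrightarrow> elementary A g \<Longrightarrow> elementary A h \<Longrightarrow>
    elementary A (\<lambda>xs. if 0 \<le> f xs then g xs else h xs)"
| sum: "elementary A f \<Longrightarrow> elementary A g \<Longrightarrow>
    elementary A (\<lambda>xs. \<Sum>i<nat \<lfloor>f xs\<rfloor>. g (real i # xs))"
| prod: "elementary A f \<Longrightarrow> elementary A g \<Longrightarrow>
    elementary A (\<lambda>xs. \<Prod>i<nat \<lfloor>f xs\<rfloor>. g (real i # xs))"

text \<open>Bit strings are computed bitwise: the index of the bit is the first argument, followed by
  the key length and the data known to the party.\<close>

definition explicit_family :: "real set \<Rightarrow> (nat \<Rightarrow> cr_scheme) \<Rightarrow> bool" where
  "explicit_family A S \<longleftrightarrow>
     (\<exists>f. elementary A f \<and> (\<forall>k. real (num_samples (S k)) = f [real k])) \<and>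
     (\<exists>f. elementary A f \<and> (\<forall>k. real (msg_len (S k)) = f [real k])) \<and>
     (\<exists>f. elementary A f \<and> (\<forall>k x. \<forall>i<msg_len (S k).
        of_bool (alice_msg (S k) x ! i) = f (real i # real k # map x [0..<num_samples (S k)]))) \<and>
     (\<exists>f. elementary A f \<and> (\<forall>k x. \<forall>i<k.
        of_bool (alice_key (S k) x ! i) = f (real i # real k # map x [0..<num_samples (S k)]))) \<and>
     (\<exists>f. elementary A f \<and> (\<forall>k y m. length m = msg_len (S k) \<longrightarrow> (\<forall>i<k.
        of_bool (bob_key (S k) y m ! i) =
          f (real i # real k # map y [0..<num_samples (S k)] @ map of_bool m))))"

end

theory Submission
  imports Defs "HOL-Computational_Algebra.Primes" "HOL-Computational_Algebra.Polynomial"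
    "HOL-Library.Log_Nat" "HOL-Probability.Hoeffding"
begin

text \<open>Every codeword \<open>c < 2 ^ k\<close> owns a set of \<open>p\<close> sample positions, with \<open>p\<close> a prime of
  polynomial size; reading the bits of \<open>c\<close> as a polynomial over the field with \<open>p\<close> elements makes
  any two of these sets overlap in at most \<open>k\<close> positions. Alice outputs the unique codeword on whose
  positions her samples sum to at least \<open>s\<close>, where \<open>s\<close> is chosen such that a fixed codeword does so
  with probability about \<open>2 powr (- k)\<close>, and sends a prefix of it (if there is no unique codeword,
  she falls back on the signs of \<open>k\<close> fresh samples). Bob looks for a codeword with this prefix on whose
  positions his samples sum to at least \<open>\<phi> s\<close>. As \<open>\<phi> - \<rho>\<close> is \<open>\<delta>\<close> conditional standard deviations
  of Bob's sample, both thresholds are passed for the same codeword with probability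
  \<open>2 powr (- (1 + \<delta>\<^sup>2) k)\<close> up to polynomial factors: for the Gaussian source by independence of the
  two components, for the binary source by the method of types. Since the samples on a small overlap
  contribute little to the sums, the other codewords behave independently, and Chernoff bounds show
  that with probability at least one half none of them interferes. Summing over the \<open>2 ^ k\<close>
  codewords gives agreement probability \<open>2 powr (- \<delta>\<^sup>2 k)\<close> up to polynomial factors.\<close>

section \<open>Primes of polynomial size\<close>

text \<open>That both parties pass their thresholds at a fixed codeword is exponentially rare, so
  interference has to be bounded relative to this event: given it, the sum of another codeword must
  still look fresh. Hence the cut-off \<open>M\<close> = p^(1/4) for the samples inside the event.
  An overlap of \<open>k\<close> positions then moves a sum by at most \<open>k * M\<close> and the
  Chernoff exponent by \<open>s / p * (k * M)\<close>, of order k^(3/2) / p^(1/4), which stays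
  bounded once \<open>p\<close> is of order k^6. The prefix has about (1 - \<phi>^2) k bits because
  it leaves 2^(\<phi>^2 k) candidates, and a wrong one passes Bob's threshold with probability about
  2^(-\<phi>^2 k). All exponents are computed with k + c0 in place of k; the constant c0 brings both
  union bounds below 1/4 and costs a constant factor of the agreement probability. The fallback
  protects the min-entropy: a key value arises in only two ways, each of probability at most 2^(-k),
  so one bit is lost.\<close>

lemma mult_binomial_dvd:
  fixes D :: nat
  assumes "\<And>j. 1 \<le> j \<Longrightarrow> j \<le> n \<Longrightarrow> j dvd D" "1 \<le> m" "m \<le> n"
  shows "m * (n choose m) dvd D"
proof -
  \<comment> \<open>The numbers 1 / (m * (n choose m)) form the Leibniz harmonic triangle;
    integrality of their multiples by \<open>D\<close> passes from the first column 1 / n to the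
    next columns.\<close>
  have "real D / real (m * (n choose m)) \<in> \<int>"
    using assms(2,3,1)
  proof (induction m arbitrary: n rule: dec_induct)
    case base
    then obtain z where "D = n * z" by (metis dvdE le_refl)
    then show ?case using base by simp
  next
    case (step m)
    have m: "0 < real m" "real m < real n" using step by simp_all
    have c: "real n * real ((n - 1) choose m) = (real n - real m) * real (n choose m)"
      using binomial_absorb_comp[of n m] step.prems
      by (metis of_nat_diff of_nat_mult le_add2 le_trans plus_1_eq_Suc)
    have d: "real (Suc m) * real (n choose Suc m) = (real n - real m) * real (n choose m)"
    proof -
      obtain n' where n': "n = Suc n'" using step.prems by (cases n) auto
      have "real (Suc n' * (n' choose m)) = real ((Suc n' choose Suc m) * Suc m)"
        by (simp only: Suc_times_binomial_eq)
      then show ?thesis using c unfolding n' of_nat_mult by (simp add: mult.commute)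
    qed
    have pos: "0 < real (n choose m)" using step.prems by simp
    have cc: "real ((n - 1) choose m) = (real n - real m) * real (n choose m) / real n"
      using c m by (simp add: field_simps)
    \<comment> \<open>The recurrence of that triangle: an entry is the difference of two entries of
      the preceding column.\<close>
    have "real D / real (m * ((n - 1) choose m)) - real D / real (m * (n choose m))
        = real D / real (Suc m * (n choose Suc m))"
      unfolding of_nat_mult d cc using m pos by (simp add: field_simps)
    moreover have "real D / real (m * ((n - 1) choose m)) \<in> \<int>"
      by (rule step.IH) (use step.prems in auto)
    moreover have "real D / real (m * (n choose m)) \<in> \<int>"
      by (rule step.IH) (use step.prems in auto)
    ultimately show ?case by (metis Ints_diff)
  qed
  then obtain z where "real D / real (m * (n choose m)) = of_int z" by (auto elim: Ints_cases)
  moreover have "m * (n choose m) \<noteq> 0" using assms by simp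
  ultimately have "real_of_int (int D) = of_int (z * int (m * (n choose m)))"
    by (simp add: field_simps)
  then have "int D = z * int (m * (n choose m))" by linarith
  then show ?thesis by (metis dvd_triv_right of_nat_dvd_iff)
qed

text \<open>A Chebyshev-type bound: the least common multiple of 1, ..., n is a multiple of m * (n
  choose m), and it is a product of prime powers, each of them at most n.\<close>

lemma binomial_le_prime_product:
  assumes "1 \<le> m" "m \<le> n"
  shows "n choose m \<le> n ^ card {q. prime q \<and> q \<le> n}"
proof -
  define Q where "Q = {q. prime q \<and> q \<le> n}"
  \<comment> \<open>\<open>floorlog q n - 1\<close> is the exponent of the largest power of
    \<open>q\<close> not exceeding \<open>n\<close>, so \<open>D\<close> is the least common
    multiple of 1, ..., n.\<close>
  define D where "D = (\<Prod>q\<in>Q. q ^ (floorlog q n - 1))"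
  have fin: "finite Q" by (simp add: Q_def)
  have n: "n > 0" using assms by simp
  have q1: "q > 1" if "q \<in> Q" for q using that prime_gt_1_nat[of q] by (auto simp: Q_def)
  have Dle: "D \<le> n ^ card Q"
  proof -
    have "D \<le> (\<Prod>q\<in>Q. n)" unfolding D_def
      by (rule prod_mono) (use floorlog_bounds[OF n] q1 in auto)
    then show ?thesis by simp
  qed
  have D0: "D \<noteq> 0" unfolding D_def using fin q1 by (auto simp: prod_zero_iff)
  have dv: "j dvd D" if j: "1 \<le> j" "j \<le> n" for j
  proof (rule multiplicity_le_imp_dvd)
    show "j \<noteq> 0" using j by simp
    fix q :: nat assume q: "prime q"
    have le: "q ^ multiplicity q j \<le> n"
      using j multiplicity_dvd[of q j] by (meson dvd_imp_le le_trans zero_less_one order_less_le_trans)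
    show "multiplicity q j \<le> multiplicity q D"
    proof (cases "q \<in> Q")
      case False
      then have "\<not> q dvd j" using q j by (auto simp: Q_def dest: dvd_imp_le)
      then show ?thesis by (simp add: not_dvd_imp_multiplicity_0)
    next
      case True
      have "q ^ multiplicity q j < q ^ floorlog q n"
        using floorlog_bounds[OF n q1[OF True]] le by simp
      then have "multiplicity q j \<le> floorlog q n - 1"
        using q1[OF True] by simp
      moreover have "q ^ (floorlog q n - 1) dvd D"
        unfolding D_def using True fin by (rule dvd_prodI[rotated])
      ultimately have "q ^ multiplicity q j dvd D" by (meson dvd_trans le_imp_power_dvd)
      then show ?thesis using D0 q by (intro multiplicity_geI) (auto simp: not_prime_unit)
    qed
  qed
  have "m * (n choose m) \<le> D"
    by (rule dvd_imp_le) (use mult_binomial_dvd[OF dv assms] D0 in auto)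
  then have "n choose m \<le> D" using assms
    by (cases m) auto
  then show ?thesis using Dle by (simp add: Q_def)
qed

text \<open>With n = N^3 and no prime in the range there are at most N primes up to 2 n, so the
  central binomial coefficient of 2 n would be at most (2 n)^N, while it is at least 4^n / (2 n).
  Any polynomial bound on the next prime serves the construction.\<close>

lemma prime_between_cube:
  fixes N :: nat
  assumes "4 \<le> N"
  shows "\<exists>p. prime p \<and> N < p \<and> p \<le> 2 * N ^ 3"
proof (rule ccontr)
  assume A: "\<not> ?thesis"
  define n where "n = N ^ 3"
  have n: "0 < n" using assms by (simp add: n_def)
  have sub: "{q. prime q \<and> q \<le> 2 * n} \<subseteq> {1..N}"
    using A by (auto simp: n_def prime_gt_0_nat Suc_le_eq) (meson not_le)
  have "card {q. prime q \<and> q \<le> 2 * n} \<le> N" using card_mono[OF _ sub] by simp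
  then have "(2 * n) ^ card {q. prime q \<and> q \<le> 2 * n} \<le> (2 * n) ^ N"
    using n by (intro power_increasing) auto
  then have "(2 * n) choose n \<le> (2 * n) ^ N"
    using binomial_le_prime_product[of n "2 * n"] n by linarith
  then have "real ((2 * n) choose n) \<le> real (2 * n) ^ N"
    by (metis of_nat_le_iff of_nat_power)
  then have "4 ^ n / (2 * real n) \<le> real (2 * n) ^ N"
    using central_binomial_lower_bound[OF n] by linarith
  then have "4 ^ n \<le> real (2 * n) ^ Suc N" using n by (simp add: field_simps)
  also have "\<dots> \<le> (2 ^ (3 * N + 1)) ^ Suc N"
  proof (rule power_mono)
    have "real N ^ 3 \<le> (2 ^ N) ^ 3" using of_nat_less_two_power[of N]
      by (intro power_mono) (auto intro: less_imp_le)
    then show "real (2 * n) \<le> 2 ^ (3 * N + 1)" by (simp add: n_def power_mult[symmetric] mult.commute)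
  qed simp
  also have "\<dots> = 2 ^ ((3 * N + 1) * Suc N)" by (simp only: power_mult[symmetric])
  finally have "(2::real) ^ (2 * n) \<le> 2 ^ ((3 * N + 1) * Suc N)"
    by (simp only: power_mult[of 2 2 n]) simp
  then have "2 * n \<le> (3 * N + 1) * Suc N"
    by (rule power_le_imp_le_exp[rotated]) simp
  moreover have "4 * (4 * N) \<le> N * (N * N)" using assms
    by (intro mult_le_mono) auto
  moreover have "4 * (N * N) \<le> N * (N * N)" using assms by simp
  moreover have "4 * N \<le> N * N" using assms by simp
  ultimately show False using assms by (simp add: n_def power3_eq_cube algebra_simps)
qed

section \<open>Supports with small overlaps\<close>

text \<open>Lagrange's bound on the roots over the field with \<open>p\<close> elements, phrased by
  divisibility because \<open>p\<close> varies with the key length. Synthetic division at a root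
  \<open>a\<close> leaves a remainder divisible by \<open>p\<close>; so the quotient is again
  nonzero modulo \<open>p\<close>, and it has every other root of \<open>P\<close> as a root. The
  degree is that of the integer polynomial, whose leading coefficient may vanish modulo
  \<open>p\<close>.\<close>

lemma card_roots_mod_prime:
  fixes P :: "int poly" and p :: nat
  assumes p: "prime p" and "\<exists>i. \<not> int p dvd coeff P i"
  shows "card {a. a < p \<and> int p dvd poly P (int a)} \<le> degree P"
  using assms(2)
proof (induction "degree P" arbitrary: P)
  case 0
  then obtain c where c: "P = [:c:]" by (metis degree_eq_zeroE)
  obtain i where "\<not> int p dvd coeff P i" using 0 by blast
  then have "\<not> int p dvd c" by (cases i) (auto simp: c)
  then show ?case by (simp add: c)
next
  case (Suc n)
  show ?case
  proof (cases "\<exists>a<p. int p dvd poly P (int a)")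
    case False
    then have "{a. a < p \<and> int p dvd poly P (int a)} = {}" by blast
    then show ?thesis by (simp only: card.empty)
  next
    case True
    then obtain a where a: "a < p" "int p dvd poly P (int a)" by blast
    define Q where "Q = synthetic_div P (int a)"
    have dQ: "degree Q = n" using Suc by (simp add: Q_def degree_synthetic_div)
    have P: "P = [:- int a, 1:] * Q + [:poly P (int a):]"
      using synthetic_div_correct'[of "int a" P] by (simp add: Q_def)
    have "\<exists>i. \<not> int p dvd coeff Q i"
    proof (rule ccontr)
      assume "\<not> ?thesis"
      then have d: "int p dvd coeff Q i" for i by blast
      have "int p dvd coeff P i" for i
        by (subst P, cases i) (use d a in auto)
      then show False using Suc by blast
    qed
    then have IH: "card {b. b < p \<and> int p dvd poly Q (int b)} \<le> n"
      using Suc.hyps(1)[of Q] dQ by simp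
    have "{b. b < p \<and> int p dvd poly P (int b)} \<subseteq> insert a {b. b < p \<and> int p dvd poly Q (int b)}"
    proof -
      have "b = a" if b: "b < p" "int p dvd poly P (int b)" "\<not> int p dvd poly Q (int b)" for b
      proof -
      have "poly P (int b) = (int b - int a) * poly Q (int b) + poly P (int a)"
        by (subst P) (simp add: algebra_simps)
      then have "int p dvd (int b - int a) * poly Q (int b)"
        using a b by (metis dvd_add_left_iff)
      then have "int p dvd int b - int a"
        using b p prime_dvd_mult_iff[of "int p"] by simp
      then show "b = a" using a b
        by (simp flip: mod_eq_dvd_iff)
      qed
      then show ?thesis by blast
    qed
    then have "card {b. b < p \<and> int p dvd poly P (int b)} \<le> card (insert a {b. b < p \<and> int p dvd poly Q (int b)})"
      by (intro card_mono) auto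
    also have "\<dots> \<le> Suc n" using IH by (simp add: card_insert_if)
    finally show ?thesis using Suc by simp
  qed
qed

text \<open>The codeword \<open>c\<close>, read as a polynomial whose coefficients are its bits, picks one point in
  each of the \<open>p\<close> blocks of length \<open>p\<close>.\<close>

definition codeval :: "nat \<Rightarrow> nat \<Rightarrow> nat \<Rightarrow> nat \<Rightarrow> nat" where
  "codeval k p c a = a * p + (\<Sum>t<k. (c div 2 ^ t mod 2) * a ^ t) mod p"

definition codesupp :: "nat \<Rightarrow> nat \<Rightarrow> nat \<Rightarrow> nat set" where
  "codesupp k p c = codeval k p c ` {..<p}"

lemma codeval_div_mod:
  assumes "0 < p"
  shows "codeval k p c a div p = a" and "codeval k p c a mod p = (\<Sum>t<k. (c div 2 ^ t mod 2) * a ^ t) mod p"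
  using assms by (simp_all add: codeval_def)

lemma inj_codeval: "0 < p \<Longrightarrow> inj_on (codeval k p c) A"
  by (rule inj_onI) (metis codeval_div_mod(1))

lemma codeval_less: "a < p \<Longrightarrow> codeval k p c a < p\<^sup>2"
proof -
  assume a: "a < p"
  then have "codeval k p c a < a * p + p" by (simp add: codeval_def)
  also have "\<dots> = Suc a * p" by simp
  also have "\<dots> \<le> p * p" using a by (intro mult_le_mono) auto
  finally show ?thesis by (simp add: power2_eq_square)
qed

lemma codesupp_subset: "codesupp k p c \<subseteq> {..<p\<^sup>2}"
  by (auto simp: codesupp_def codeval_less)

lemma finite_codesupp [simp]: "finite (codesupp k p c)"
  by (simp add: codesupp_def)

lemma card_codesupp: "0 < p \<Longrightarrow> card (codesupp k p c) = p"
  by (simp add: codesupp_def card_image inj_codeval)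

lemma nat_bits_eqI:
  fixes c d :: nat
  assumes "c < 2 ^ k" "d < 2 ^ k" "\<And>t. t < k \<Longrightarrow> c div 2 ^ t mod 2 = d div 2 ^ t mod 2"
  shows "c = d"
proof (rule bit_eqI)
  fix t
  show "bit c t = bit d t"
  proof (cases "t < k")
    case True
    then show ?thesis using assms(3)[OF True] by (simp add: bit_iff_odd odd_iff_mod_2_eq_one)
  next
    case False
    then have "(2::nat) ^ k \<le> 2 ^ t" by simp
    then have "c < 2 ^ t" "d < 2 ^ t" using assms(1,2) by linarith+
    then have "c div 2 ^ t = 0" "d div 2 ^ t = 0" by (simp_all only: div_less)
    then show ?thesis by (simp add: bit_iff_odd)
  qed
qed

text \<open>A common point determines its block \<open>a\<close>, and there the two polynomials
  agree modulo \<open>p\<close>. Their difference has coefficients -1, 0, 1, not all zero, hence is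
  nonzero modulo every prime.\<close>

lemma card_codesupp_Int:
  assumes p: "prime p" and c: "c < 2 ^ k" "d < 2 ^ k" "c \<noteq> d"
  shows "card (codesupp k p c \<inter> codesupp k p d) \<le> k"
proof -
  define b where "b = (\<lambda>t. int (c div 2 ^ t mod 2) - int (d div 2 ^ t mod 2))"
  define P where "P = (\<Sum>t<k. monom (b t) t)"
  have p1: "1 < p" using p by (rule prime_gt_1_nat)
  have coef: "coeff P i = (if i < k then b i else 0)" for i
    unfolding P_def coeff_sum by (simp add: sum.delta)
  have ev: "poly P (int a) = int (\<Sum>t<k. (c div 2 ^ t mod 2) * a ^ t) - int (\<Sum>t<k. (d div 2 ^ t mod 2) * a ^ t)" for a
    by (simp add: P_def poly_sum poly_monom b_def left_diff_distrib sum_subtractf)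
  obtain t where t: "t < k" "c div 2 ^ t mod 2 \<noteq> d div 2 ^ t mod 2"
    using nat_bits_eqI[OF c(1,2)] c(3) by blast
  have "\<bar>b t\<bar> = 1" using t(2) unfolding b_def
    by (cases "c div 2 ^ t mod 2 = 0"; cases "d div 2 ^ t mod 2 = 0") auto
  then have "\<not> int p dvd \<bar>b t\<bar>" using p1 by simp
  then have "\<not> int p dvd b t" by simp
  then have "\<exists>i. \<not> int p dvd coeff P i" using t coef by metis
  then have "card {a. a < p \<and> int p dvd poly P (int a)} \<le> degree P"
    by (rule card_roots_mod_prime[OF p])
  also have "degree P \<le> k" by (rule degree_le) (simp add: coef)
  finally have le: "card {a. a < p \<and> int p dvd poly P (int a)} \<le> k" .
  have "codesupp k p c \<inter> codesupp k p d \<subseteq> codeval k p c ` {a. a < p \<and> int p dvd poly P (int a)}"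
  proof
    fix x assume "x \<in> codesupp k p c \<inter> codesupp k p d"
    then obtain a a' where a: "a < p" "x = codeval k p c a" and a': "x = codeval k p d a'"
      by (auto simp: codesupp_def)
    have p0: "0 < p" using p1 by simp
    have "a' = a" using a a' codeval_div_mod(1)[OF p0] by metis
    then have "(\<Sum>t<k. (c div 2 ^ t mod 2) * a ^ t) mod p = (\<Sum>t<k. (d div 2 ^ t mod 2) * a ^ t) mod p"
      using codeval_div_mod(2)[OF p0] a a' by metis
    then have "int p dvd poly P (int a)"
      unfolding ev mod_eq_dvd_iff[symmetric] of_nat_mod[symmetric] by (simp only:)
    then show "x \<in> codeval k p c ` {a. a < p \<and> int p dvd poly P (int a)}" using a by auto
  qed
  then have "card (codesupp k p c \<inter> codesupp k p d) \<le> card {a. a < p \<and> int p dvd poly P (int a)}"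
    by (rule surj_card_le[rotated]) simp
  then show ?thesis using le by simp
qed

section \<open>Closure properties of elementary functions\<close>

text \<open>The list access of rule \<open>elementary.arg\<close>, with its default 0, as a
  function.\<close>

definition nth0 :: "real list \<Rightarrow> nat \<Rightarrow> real" where
  "nth0 xs j = (if j < length xs then xs ! j else 0)"

text \<open>Bounded sums and products put their index in front of the list; this recovers it as a
  natural number.\<close>

definition hdnat :: "real list \<Rightarrow> nat" where
  "hdnat xs = nat \<lfloor>nth0 xs 0\<rfloor>"

lemma nth0_Cons_0 [simp]: "nth0 (x # xs) 0 = x"
  by (simp add: nth0_def)

lemma hdnat_Cons [simp]: "hdnat (real i # xs) = i"
  by (simp add: hdnat_def)

lemma nth0_drop: "nth0 (drop d xs) j = nth0 xs (d + j)"
  by (auto simp: nth0_def)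

lemma elementary_nth0_floor: "elementary A f \<Longrightarrow> elementary A (\<lambda>xs. nth0 xs (nat \<lfloor>f xs\<rfloor>))"
  unfolding nth0_def by (rule elementary.arg)

lemma elementary_one: "elementary A (\<lambda>xs. 1)"
  using elementary.nat_const[of A 1] by simp

lemma elementary_zero: "elementary A (\<lambda>xs. 0)"
  using elementary.nat_const[of A 0] by simp

text \<open>Weakening: the formula may be used below a binder that inserts a variable at position \<open>d\<close>.\<close>

lemma elementary_insert_var:
  assumes "elementary A f"
  shows "elementary A (\<lambda>xs. f (take d xs @ drop (Suc d) xs))"
  using assms
proof (induction arbitrary: d rule: elementary.induct)
  case num_args
  \<comment> \<open>Deleting position \<open>d\<close> shortens only those lists that have more than
    \<open>d\<close> entries.\<close>
  have "(\<lambda>xs. real (length (take d xs @ drop (Suc d) xs))) =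
      (\<lambda>xs. if 0 \<le> real (length (xs :: real list)) - real (Suc d) then real (length xs) - real 1 else real (length xs))"
    by (auto simp: fun_eq_iff)
  then show ?case
    by (simp only:) (intro elementary.intros)
next
  case (arg f)
  define F where "F = (\<lambda>xs. f (take d xs @ drop (Suc d) xs))"
  \<comment> \<open>\<open>nat\<close> reads a negative index as 0. \<open>H\<close> does this
    beforehand, so that \<open>G\<close>, which moves the indices from \<open>d\<close> on up by
    one, is also right for negative values when \<open>d\<close> = 0.\<close>
  define H where "H = (\<lambda>xs. if 0 \<le> F xs then F xs else real 0)"
  define G where "G = (\<lambda>xs. if 0 \<le> H xs - real d then H xs + real 1 else H xs)"
  have "elementary A F" using arg by (simp add: F_def)
  then have "elementary A H" unfolding H_def by (intro elementary.intros)
  then have "elementary A G" unfolding G_def by (intro elementary.intros)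
  then have "elementary A (\<lambda>xs. nth0 xs (nat \<lfloor>G xs\<rfloor>))" by (rule elementary_nth0_floor)
  moreover have "nth0 (take d xs @ drop (Suc d) xs) (nat \<lfloor>F xs\<rfloor>) = nth0 xs (nat \<lfloor>G xs\<rfloor>)" for xs
  proof -
    have H: "nat \<lfloor>H xs\<rfloor> = nat \<lfloor>F xs\<rfloor>" "0 \<le> H xs" by (auto simp: H_def)
    have le: "d \<le> nat \<lfloor>H xs\<rfloor> \<longleftrightarrow> real d \<le> H xs" using H(2) by (simp add: le_nat_floor le_nat_iff le_floor_iff)
    have "nat \<lfloor>G xs\<rfloor> = (if d \<le> nat \<lfloor>F xs\<rfloor> then Suc (nat \<lfloor>F xs\<rfloor>) else nat \<lfloor>F xs\<rfloor>)"
      unfolding G_def H(1)[symmetric] le using H(2) by (auto simp: nat_add_distrib)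
    then show ?thesis
      by (auto simp: nth0_def nth_append)
  qed
  ultimately show ?case unfolding F_def nth0_def by simp
next
  case (sum f g)
  \<comment> \<open>In the body the summation index comes first, so the inserted variable stands at
    \<open>Suc d\<close>; this is why \<open>d\<close> is generalized in the induction.\<close>
  have "elementary A (\<lambda>xs. \<Sum>i<nat \<lfloor>f (take d xs @ drop (Suc d) xs)\<rfloor>.
      (\<lambda>ys. g (take (Suc d) ys @ drop (Suc (Suc d)) ys)) (real i # xs))"
    by (rule elementary.sum[OF sum.IH])
  then show ?case by simp
next
  case (prod f g)
  have "elementary A (\<lambda>xs. \<Prod>i<nat \<lfloor>f (take d xs @ drop (Suc d) xs)\<rfloor>.
      (\<lambda>ys. g (take (Suc d) ys @ drop (Suc (Suc d)) ys)) (real i # xs))"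
    by (rule elementary.prod[OF prod.IH])
  then show ?case by simp
qed (auto intro: elementary.intros)

lemma elementary_tl: "elementary A f \<Longrightarrow> elementary A (\<lambda>xs. f (tl xs))"
  using elementary_insert_var[of A f 0] by (simp add: drop_Suc)

abbreviation elem_nat :: "real set \<Rightarrow> (real list \<Rightarrow> nat) \<Rightarrow> bool" where
  "elem_nat A f \<equiv> elementary A (\<lambda>xs. real (f xs))"

abbreviation elem_bool :: "real set \<Rightarrow> (real list \<Rightarrow> bool) \<Rightarrow> bool" where
  "elem_bool A P \<equiv> elementary A (\<lambda>xs. of_bool (P xs))"

lemma elementary_hdnat: "elem_nat A hdnat"
proof -
  have "elementary A (\<lambda>xs. if 0 \<le> nth0 xs (nat \<lfloor>real 0\<rfloor>) then of_int \<lfloor>nth0 xs (nat \<lfloor>real 0\<rfloor>)\<rfloor> else real 0)"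
    by (intro elementary.intros elementary_nth0_floor)
  moreover have "(\<lambda>xs. if 0 \<le> nth0 xs (nat \<lfloor>real 0\<rfloor>) then of_int \<lfloor>nth0 xs (nat \<lfloor>real 0\<rfloor>)\<rfloor> else real 0) =
      (\<lambda>xs. real (hdnat xs))"
    by (auto simp: fun_eq_iff hdnat_def)
  ultimately show ?thesis by simp
qed

text \<open>De Bruijn form of the binder: in the premise the index is the head of the list and the
  former arguments are the tail. This allows formulas written with ordinary bound variables to be
  decomposed by introduction rules.\<close>

lemma elementary_sum:
  assumes "elem_nat A n" "elementary A (\<lambda>ys. G (hdnat ys) (tl ys))"
  shows "elementary A (\<lambda>xs. \<Sum>i<n xs. G i xs)"
  using elementary.sum[OF assms] by simp

lemma elementary_prod:
  assumes "elem_nat A n" "elementary A (\<lambda>ys. G (hdnat ys) (tl ys))"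
  shows "elementary A (\<lambda>xs. \<Prod>i<n xs. G i xs)"
  using elementary.prod[OF assms] by simp

lemma elem_nat_add: "elem_nat A f \<Longrightarrow> elem_nat A g \<Longrightarrow> elem_nat A (\<lambda>xs. f xs + g xs)"
  using elementary.add[of A "\<lambda>xs. real (f xs)"] by simp

lemma elem_nat_mult: "elem_nat A f \<Longrightarrow> elem_nat A g \<Longrightarrow> elem_nat A (\<lambda>xs. f xs * g xs)"
  using elementary.mult[of A "\<lambda>xs. real (f xs)"] by simp

lemma elem_nat_div: "elem_nat A f \<Longrightarrow> elem_nat A g \<Longrightarrow> elem_nat A (\<lambda>xs. f xs div g xs)"
  using elementary.floor[OF elementary.divide[of A "\<lambda>xs. real (f xs)" "\<lambda>xs. real (g xs)"]]
  by (simp add: floor_divide_of_nat_eq)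

lemma elem_nat_mod:
  assumes "elem_nat A f" "elem_nat A g"
  shows "elem_nat A (\<lambda>xs. f xs mod g xs)"
proof -
  have "elementary A (\<lambda>xs. real (f xs) - real (f xs div g xs * g xs))"
    by (intro elementary.diff elem_nat_mult elem_nat_div assms)
  moreover have "real (f xs) - real (f xs div g xs * g xs) = real (f xs mod g xs)" for xs
    by (metis add_diff_cancel_left' div_mult_mod_eq of_nat_add)
  ultimately show ?thesis by simp
qed

lemma elem_nat_power:
  assumes "elem_nat A f" "elem_nat A g"
  shows "elem_nat A (\<lambda>xs. f xs ^ g xs)"
  using elementary_prod[OF assms(2), of "\<lambda>i xs. real (f xs)"] elementary_tl[OF assms(1)] by simp

lemma elem_nat_sum:
  assumes "elem_nat A n" "elem_nat A (\<lambda>ys. G (hdnat ys) (tl ys))"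
  shows "elem_nat A (\<lambda>xs. \<Sum>i<n xs. G i xs)"
  using elementary_sum[of A n "\<lambda>i xs. real (G i xs)"] assms by simp

lemma elem_nat_of_bool: "elem_bool A P \<Longrightarrow> elem_nat A (\<lambda>xs. of_bool (P xs))"
  by simp

lemma elem_bool_le: "elementary A f \<Longrightarrow> elementary A g \<Longrightarrow> elem_bool A (\<lambda>xs. f xs \<le> g xs)"
  using elementary.cond[OF elementary.diff[of A g f] elementary_one elementary_zero]
  by (simp add: of_bool_def)

lemma elem_bool_not: "elem_bool A P \<Longrightarrow> elem_bool A (\<lambda>xs. \<not> P xs)"
  using elementary.diff[OF elementary_one, of A "\<lambda>xs. of_bool (P xs)"]
  by (simp add: of_bool_not_iff)

lemma elem_bool_conj: "elem_bool A P \<Longrightarrow> elem_bool A Q \<Longrightarrow> elem_bool A (\<lambda>xs. P xs \<and> Q xs)"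
  using elementary.mult[of A "\<lambda>xs. of_bool (P xs)"] by (simp add: of_bool_conj)

lemma elem_bool_disj: "elem_bool A P \<Longrightarrow> elem_bool A Q \<Longrightarrow> elem_bool A (\<lambda>xs. P xs \<or> Q xs)"
  using elem_bool_not[OF elem_bool_conj[OF elem_bool_not[of A P] elem_bool_not[of A Q]]] by simp

lemma elem_bool_imp: "elem_bool A P \<Longrightarrow> elem_bool A Q \<Longrightarrow> elem_bool A (\<lambda>xs. P xs \<longrightarrow> Q xs)"
  unfolding imp_conv_disj by (intro elem_bool_disj elem_bool_not)

lemma elem_bool_eq: "elementary A f \<Longrightarrow> elementary A g \<Longrightarrow> elem_bool A (\<lambda>xs. f xs = g xs)"
  unfolding eq_iff by (intro elem_bool_conj elem_bool_le)

lemma elem_bool_nat_eq: "elem_nat A f \<Longrightarrow> elem_nat A g \<Longrightarrow> elem_bool A (\<lambda>xs. f xs = g xs)"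
  using elem_bool_eq[of A "\<lambda>xs. real (f xs)" "\<lambda>xs. real (g xs)"] by simp

lemma elem_bool_nat_less: "elem_nat A f \<Longrightarrow> elem_nat A g \<Longrightarrow> elem_bool A (\<lambda>xs. f xs < g xs)"
  using elem_bool_not[OF elem_bool_le[of A "\<lambda>xs. real (g xs)" "\<lambda>xs. real (f xs)"]] by (simp add: not_le)

lemma elem_bool_all:
  assumes "elem_nat A n" "elem_bool A (\<lambda>ys. P (hdnat ys) (tl ys))"
  shows "elem_bool A (\<lambda>xs. \<forall>i<n xs. P i xs)"
proof -
  have "(\<Prod>i<m. of_bool (P i xs) :: real) = of_bool (\<forall>i<m. P i xs)" for m xs
    by (induction m) (auto simp: less_Suc_eq)
  then show ?thesis
    using elementary_prod[of A n "\<lambda>i xs. of_bool (P i xs)"] assms by simp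
qed

lemma elem_bool_ex:
  assumes "elem_nat A n" "elem_bool A (\<lambda>ys. P (hdnat ys) (tl ys))"
  shows "elem_bool A (\<lambda>xs. \<exists>i<n xs. P i xs)"
  using elem_bool_not[OF elem_bool_all[OF assms(1) elem_bool_not[OF assms(2)]]] by simp

lemmas elem_intros = elementary.nat_const elementary_hdnat elem_nat_add elem_nat_mult elem_nat_div
  elem_nat_mod elem_nat_power elem_nat_sum elem_bool_le elem_bool_not elem_bool_conj elem_bool_disj
  elem_bool_imp elem_bool_nat_eq elem_bool_nat_less elem_bool_all elem_bool_ex

lemma elem_bool_prime:
  assumes "elem_nat A f"
  shows "elem_bool A (\<lambda>xs. prime (f xs))"
proof -
  note f = assms elementary_tl[OF assms]
  have *: "prime n \<longleftrightarrow> 1 < n \<and> (\<forall>i<n. n mod i = 0 \<longrightarrow> \<not> 1 < i)" for n :: nat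
  proof
    assume n: "prime n"
    then show "1 < n \<and> (\<forall>i<n. n mod i = 0 \<longrightarrow> \<not> 1 < i)"
      by (metis mod_0_imp_dvd less_irrefl prime_gt_1_nat prime_nat_iff)
  next
    assume n: "1 < n \<and> (\<forall>i<n. n mod i = 0 \<longrightarrow> \<not> 1 < i)"
    have "i = 1 \<or> i = n" if "i dvd n" for i
    proof -
      have "i \<le> n" "0 < i" using that n by (auto dest: dvd_imp_le intro: dvd_pos_nat)
      then show ?thesis using n that by (cases "i < n") auto
    qed
    then show "prime n" using n by (simp add: prime_nat_iff)
  qed
  show ?thesis unfolding * by (intro elem_intros f)
qed

text \<open>Every binder puts one more entry in front of the samples; this class of offsets is
  closed under passing below a binder, so one rule gives access to the samples at any depth.\<close>

definition data_env :: "(real list \<Rightarrow> real list) \<Rightarrow> bool" where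
  "data_env D \<longleftrightarrow> (\<exists>d. D = drop d)"

lemma data_env_drop: "data_env (drop d)"
  by (auto simp: data_env_def)

lemma data_env_tl: "data_env D \<Longrightarrow> data_env (\<lambda>xs. D (tl xs))"
  by (auto simp: data_env_def fun_eq_iff drop_Suc intro: exI[of _ "Suc _"])

lemma elementary_nth0:
  assumes "data_env D" "elem_nat A f"
  shows "elementary A (\<lambda>xs. nth0 (D xs) (f xs))"
proof -
  obtain d where D: "D = drop d" using assms(1) by (auto simp: data_env_def)
  have "elementary A (\<lambda>xs. nth0 xs (nat \<lfloor>real (d + f xs)\<rfloor>))"
    by (intro elementary_nth0_floor elem_intros assms)
  then show ?thesis unfolding D nth0_drop floor_of_nat nat_int .
qed

section \<open>Independence and Chernoff bounds in finite product spaces\<close>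

abbreviation iid :: "'a measure \<Rightarrow> 'i set \<Rightarrow> ('i \<Rightarrow> 'a) measure" where
  "iid \<mu> I \<equiv> Pi\<^sub>M I (\<lambda>_. \<mu>)"

lemma measure_PiM_restrict:
  assumes "prob_space \<mu>" "finite K" "I \<subseteq> K" "A \<in> sets (iid \<mu> I)"
  shows "\<P>(\<omega> in iid \<mu> K. restrict \<omega> I \<in> A) = measure (iid \<mu> I) A"
proof -
  interpret product_prob_space "\<lambda>_. \<mu>" K
    by (rule product_prob_spaceI) (rule assms)
  have m: "(\<lambda>\<omega>. restrict \<omega> I) \<in> iid \<mu> K \<rightarrow>\<^sub>M iid \<mu> I"
    using assms(3) by (rule measurable_restrict_subset)
  have "measure (iid \<mu> I) A = measure (distr (iid \<mu> K) (iid \<mu> I) (\<lambda>\<omega>. restrict \<omega> I)) A"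
    using distr_restrict[OF assms(3,2)] by simp
  also have "\<dots> = measure (iid \<mu> K) ((\<lambda>\<omega>. restrict \<omega> I) -` A \<inter> space (iid \<mu> K))"
    by (rule measure_distr[OF m assms(4)])
  also have "(\<lambda>\<omega>. restrict \<omega> I) -` A \<inter> space (iid \<mu> K) =
      {\<omega> \<in> space (iid \<mu> K). restrict \<omega> I \<in> A}" by auto
  finally show ?thesis by simp
qed

lemma measure_PiM_restrict_indep:
  fixes K I J :: "'i set"
  assumes \<mu>: "prob_space \<mu>" and K: "finite K" "I \<subseteq> K" "J \<subseteq> K" "I \<inter> J = {}"
    and A: "A \<in> sets (iid \<mu> I)" and B: "B \<in> sets (iid \<mu> J)"
  shows "\<P>(\<omega> in iid \<mu> K. restrict \<omega> I \<in> A \<and> restrict \<omega> J \<in> B) =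
    measure (iid \<mu> I) A * measure (iid \<mu> J) B"
proof -
  interpret product_prob_space "\<lambda>_. \<mu>" K
    by (rule product_prob_spaceI) (rule \<mu>)
  interpret PI: prob_space "iid \<mu> I" by (intro prob_space_PiM \<mu>)
  interpret PJ: prob_space "iid \<mu> J" by (intro prob_space_PiM \<mu>)
  interpret PP: pair_prob_space "iid \<mu> I" "iid \<mu> J" ..
  note [measurable] = A B
  have fin: "finite I" "finite J" using K(1) by (auto intro: finite_subset[OF K(2)] finite_subset[OF K(3)])
  define C where "C = {\<omega> \<in> space (iid \<mu> (I \<union> J)). restrict \<omega> I \<in> A \<and> restrict \<omega> J \<in> B}"
  have mr: "(\<lambda>\<omega>. restrict \<omega> I) \<in> iid \<mu> (I \<union> J) \<rightarrow>\<^sub>M iid \<mu> I"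
    "(\<lambda>\<omega>. restrict \<omega> J) \<in> iid \<mu> (I \<union> J) \<rightarrow>\<^sub>M iid \<mu> J"
    by (auto intro: measurable_restrict_subset)
  have C: "C \<in> sets (iid \<mu> (I \<union> J))"
    unfolding C_def using mr by measurable
  have "{\<omega> \<in> space (iid \<mu> K). restrict \<omega> I \<in> A \<and> restrict \<omega> J \<in> B} =
     {\<omega> \<in> space (iid \<mu> K). restrict \<omega> (I \<union> J) \<in> C}"
  proof -
    have "restrict \<omega> (I \<union> J) \<in> space (iid \<mu> (I \<union> J))" if "\<omega> \<in> space (iid \<mu> K)" for \<omega>
      by (rule measurable_space[OF measurable_restrict_subset that]) (use K in blast)
    moreover have "(I \<union> J) \<inter> I = I" "(I \<union> J) \<inter> J = J" by blast+
    ultimately show ?thesis unfolding C_def by auto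
  qed
  then have "\<P>(\<omega> in iid \<mu> K. restrict \<omega> I \<in> A \<and> restrict \<omega> J \<in> B)
      = measure (iid \<mu> (I \<union> J)) C"
    using measure_PiM_restrict[OF \<mu> K(1) _ C] K by simp
  also have "\<dots> = measure (distr (iid \<mu> I \<Otimes>\<^sub>M iid \<mu> J) (iid \<mu> (I \<union> J)) (merge I J)) C"
    using distr_merge[OF K(4) fin] by simp
  also have "\<dots> = measure (iid \<mu> I \<Otimes>\<^sub>M iid \<mu> J)
      (merge I J -` C \<inter> space (iid \<mu> I \<Otimes>\<^sub>M iid \<mu> J))"
    by (rule measure_distr[OF measurable_merge C])
  also have "merge I J -` C \<inter> space (iid \<mu> I \<Otimes>\<^sub>M iid \<mu> J) = A \<times> B"
  proof -
    have AB: "A \<subseteq> space (iid \<mu> I)" "B \<subseteq> space (iid \<mu> J)"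
      using sets.sets_into_space[OF A] sets.sets_into_space[OF B] .
    have mm: "merge I J z \<in> space (iid \<mu> (I \<union> J))"
      if "z \<in> space (iid \<mu> I \<Otimes>\<^sub>M iid \<mu> J)" for z
      using measurable_space[OF measurable_merge that] .
    have r: "restrict x I = x" if "x \<in> space (iid \<mu> I)" for x and I :: "'i set"
      using that by (auto simp: space_PiM PiE_iff intro: extensional_restrict)
    have mc: "merge I J (x, y) \<in> C \<longleftrightarrow> x \<in> A \<and> y \<in> B"
      if "x \<in> space (iid \<mu> I)" "y \<in> space (iid \<mu> J)" for x y
      using mm[of "(x, y)"] that K(4) r[OF that(1)] r[OF that(2)]
      by (simp add: C_def space_pair_measure)
    show ?thesis
      using AB by (auto simp: space_pair_measure mc subset_eq)
  qed
  also have "measure (iid \<mu> I \<Otimes>\<^sub>M iid \<mu> J) (A \<times> B) =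
      measure (iid \<mu> I) A * measure (iid \<mu> J) B"
    using PJ.emeasure_pair_measure_Times[OF A B]
    by (simp add: measure_def enn2real_mult)
  finally show ?thesis .
qed

text \<open>Markov's inequality for the exponential of the sum, whose moment factors over the
  coordinates. With nonnegative integrals the moment bound includes its own finiteness.\<close>

lemma chernoff_PiM:
  fixes f :: "'a \<Rightarrow> real"
  assumes \<mu>: "prob_space \<mu>" and J: "finite J" and f [measurable]: "f \<in> borel_measurable \<mu>"
    and mgf: "(\<integral>\<^sup>+x. ennreal (exp (t * f x)) \<partial>\<mu>) \<le> ennreal (exp (t\<^sup>2 / 2))" and t: "0 \<le> t"
  shows "\<P>(\<omega> in iid \<mu> J. u \<le> (\<Sum>j\<in>J. f (\<omega> j)))
    \<le> exp (real (card J) * (t\<^sup>2 / 2) - t * u)"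
proof -
  interpret product_prob_space "\<lambda>_. \<mu>" J
    by (rule product_prob_spaceI) (rule \<mu>)
  let ?M = "iid \<mu> J"
  let ?E = "{\<omega> \<in> space ?M. u \<le> (\<Sum>j\<in>J. f (\<omega> j))}"
  have E: "?E \<in> sets ?M" by measurable
  have "emeasure ?M ?E = (\<integral>\<^sup>+\<omega>. indicator ?E \<omega> \<partial>?M)"
    using E by simp
  also have "\<dots> \<le> (\<integral>\<^sup>+\<omega>. ennreal (exp (- (t * u))) * (\<Prod>j\<in>J. ennreal (exp (t * f (\<omega> j)))) \<partial>?M)"
  proof (rule nn_integral_mono)
    fix \<omega>
    have e: "ennreal (exp (- (t * u))) * (\<Prod>j\<in>J. ennreal (exp (t * f (\<omega> j)))) =
        ennreal (exp (t * ((\<Sum>j\<in>J. f (\<omega> j)) - u)))"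
      by (subst prod_ennreal)
        (simp_all add: ennreal_mult[symmetric] exp_sum[OF J, symmetric] sum_distrib_left[symmetric]
          exp_add[symmetric] algebra_simps)
    show "indicator ?E \<omega> \<le> ennreal (exp (- (t * u))) * (\<Prod>j\<in>J. ennreal (exp (t * f (\<omega> j))))"
      unfolding e by (auto simp: indicator_def t ennreal_1[symmetric] simp del: ennreal_1 intro!: ennreal_leI)
  qed
  also have "\<dots> = ennreal (exp (- (t * u))) * (\<Prod>j\<in>J. (\<integral>\<^sup>+x. ennreal (exp (t * f x)) \<partial>\<mu>))"
    by (subst nn_integral_cmult, measurable) (subst product_nn_integral_prod[OF J], simp_all)
  also have "\<dots> \<le> ennreal (exp (- (t * u))) * (\<Prod>j\<in>J. ennreal (exp (t\<^sup>2 / 2)))"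
    using mgf by (intro mult_left_mono) (auto intro: power_mono)
  also have "\<dots> = ennreal (exp (real (card J) * (t\<^sup>2 / 2) - t * u))"
    by (subst prod_ennreal) (simp_all add: ennreal_mult[symmetric] exp_of_nat_mult[symmetric] exp_add[symmetric])
  finally show ?thesis
    by (simp add: measure_def enn2real_leI)
qed

lemma measure_PiM_all:
  assumes \<mu>: "prob_space \<mu>" and "finite J" and "\<And>j. j \<in> J \<Longrightarrow> {x \<in> space \<mu>. P j x} \<in> sets \<mu>"
  shows "\<P>(\<omega> in iid \<mu> J. \<forall>j\<in>J. P j (\<omega> j)) =
    (\<Prod>j\<in>J. \<P>(x in \<mu>. P j x))"
proof -
  interpret finite_product_prob_space "\<lambda>_. \<mu>" J
    by (intro finite_product_prob_space.intro
        finite_product_sigma_finite.intro finite_product_sigma_finite_axioms.intro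
        product_prob_spaceI product_sigma_finite.intro prob_space_imp_sigma_finite \<mu> assms(2))
  have "{\<omega> \<in> space (iid \<mu> J). \<forall>j\<in>J. P j (\<omega> j)} = (\<Pi>\<^sub>E j\<in>J. {x \<in> space \<mu>. P j x})"
    unfolding space_PiM PiE_def Pi_def by blast
  then show ?thesis
    using prob_times[of "\<lambda>j. {x \<in> space \<mu>. P j x}"] assms(3) by simp
qed

section \<open>Lower bounds for multinomial probabilities\<close>

text \<open>The Poisson weights m^j / j! of integer mean \<open>m\<close> are largest at j = m; the
  induction moves away from \<open>m\<close> in both directions.\<close>

lemma fact_mult_power_le: "fact m * m ^ j \<le> (fact j * m ^ m :: nat)"
proof (cases "m \<le> j")
  case True
  then show ?thesis
  proof (induction j rule: dec_induct)
    case (step j)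
    have "fact m * m ^ Suc j = m * (fact m * m ^ j)" by simp
    also have "\<dots> \<le> Suc j * (fact j * m ^ m)" by (rule mult_le_mono) (use step in auto)
    finally show ?case by (simp add: algebra_simps)
  qed simp
next
  case False
  then have "j \<le> m" by simp
  then show ?thesis
  proof (induction j rule: inc_induct)
    case (step j)
    have "m * (fact m * m ^ j) = fact m * m ^ Suc j" by simp
    also have "\<dots> \<le> fact (Suc j) * m ^ m" by (rule step.IH)
    also have "\<dots> = Suc j * (fact j * m ^ m)" by (simp add: algebra_simps)
    also have "\<dots> \<le> m * (fact j * m ^ m)" by (rule mult_le_mono) (use step in auto)
    finally show ?case using step by simp
  qed simp
qed

text \<open>The binomial distribution with mean \<open>m\<close> has its mode at \<open>m\<close>.\<close>

lemma binomial_mode: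
  assumes "m \<le> n"
  shows "n ^ n \<le> Suc n * ((n choose m) * m ^ m * (n - m) ^ (n - m))"
proof -
  have term_le: "(n choose j) * m ^ j * (n - m) ^ (n - j) \<le> (n choose m) * m ^ m * (n - m) ^ (n - m)"
    if j: "j \<le> n" for j
  proof -
    have c: "fact j * fact (n - j) * (n choose j) = (fact n :: nat)" if "j \<le> n" for j
      using binomial_fact_lemma[OF that] .
    define F where "F = (fact j * fact (n - j) :: nat) * (fact m * fact (n - m))"
    \<comment> \<open>\<open>F\<close> clears all factorials; what is left is a product of two
      instances of \<open>fact_mult_power_le\<close>, one for \<open>m\<close> and one for
      \<open>n - m\<close>.\<close>
    have "F * ((n choose j) * m ^ j * (n - m) ^ (n - j)) =
        (fact j * fact (n - j) * (n choose j)) * ((fact m * m ^ j) * (fact (n - m) * (n - m) ^ (n - j)))"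
      unfolding F_def by (simp only: ac_simps)
    also have "\<dots> \<le> fact n * ((fact j * m ^ m) * (fact (n - j) * (n - m) ^ (n - m)))"
      unfolding c[OF j] by (intro mult_le_mono fact_mult_power_le le_refl)
    also have "\<dots> = (fact m * fact (n - m) * (n choose m)) * ((fact j * m ^ m) * (fact (n - j) * (n - m) ^ (n - m)))"
      unfolding c[OF assms] ..
    also have "\<dots> = F * ((n choose m) * m ^ m * (n - m) ^ (n - m))"
      unfolding F_def by (simp only: ac_simps)
    finally show ?thesis
      by (simp add: F_def)
  qed
  \<comment> \<open>The n + 1 terms of the binomial expansion add up to n^n, so the largest of them
    is at least n^n / (n + 1).\<close>
  have "n ^ n = (m + (n - m)) ^ n" using assms by simp
  also have "\<dots> = (\<Sum>j\<le>n. (n choose j) * m ^ j * (n - m) ^ (n - j))"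
    by (subst binomial) simp
  also have "\<dots> \<le> (\<Sum>j\<le>n. (n choose m) * m ^ m * (n - m) ^ (n - m))"
    by (intro sum_mono term_le) simp
  finally show ?thesis by simp
qed

text \<open>The four classes are obtained by splitting n into two groups and then each group into
  two. Each of the three binomial estimates costs at most a factor n + 1.\<close>

lemma multinomial_mode:
  fixes m1 m2 m3 m4 :: nat
  defines "n \<equiv> (m1 + m2) + (m3 + m4)"
  shows "n ^ n \<le> Suc n ^ 3 * ((n choose (m1 + m2)) * ((m1 + m2) choose m1) * ((m3 + m4) choose m3) *
    (m1 ^ m1 * m2 ^ m2 * m3 ^ m3 * m4 ^ m4))"
proof -
  define a d where "a = m1 + m2" and "d = m3 + m4"
  have n: "n = a + d" by (simp add: n_def a_def d_def)
  have A: "a ^ a \<le> Suc n * ((a choose m1) * m1 ^ m1 * m2 ^ m2)"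
  proof -
    have "a ^ a \<le> Suc a * ((a choose m1) * m1 ^ m1 * m2 ^ m2)"
      using binomial_mode[of m1 a] by (simp add: a_def)
    also have "\<dots> \<le> Suc n * ((a choose m1) * m1 ^ m1 * m2 ^ m2)" by (intro mult_le_mono) (auto simp: n)
    finally show ?thesis .
  qed
  have D: "d ^ d \<le> Suc n * ((d choose m3) * m3 ^ m3 * m4 ^ m4)"
  proof -
    have "d ^ d \<le> Suc d * ((d choose m3) * m3 ^ m3 * m4 ^ m4)"
      using binomial_mode[of m3 d] by (simp add: d_def)
    also have "\<dots> \<le> Suc n * ((d choose m3) * m3 ^ m3 * m4 ^ m4)" by (intro mult_le_mono) (auto simp: n)
    finally show ?thesis .
  qed
  have "n ^ n \<le> Suc n * ((n choose a) * a ^ a * d ^ d)"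
    using binomial_mode[of a n] by (simp add: n)
  also have "\<dots> \<le> Suc n * ((n choose a) * (Suc n * ((a choose m1) * m1 ^ m1 * m2 ^ m2)) *
      (Suc n * ((d choose m3) * m3 ^ m3 * m4 ^ m4)))"
    by (intro mult_le_mono A D le_refl)
  also have "\<dots> = Suc n ^ 3 * ((n choose a) * (a choose m1) * (d choose m3) *
    (m1 ^ m1 * m2 ^ m2 * m3 ^ m3 * m4 ^ m4))"
    by (simp only: power3_eq_cube ac_simps)
  finally show ?thesis by (simp add: a_def d_def)
qed

text \<open>The right side minus the left has derivative y^3 / (1 + y), which has the sign of y, so
  it is minimal at 0, where it vanishes.\<close>

lemma ln_add_one_le_cubic:
  fixes x :: real
  assumes "-1 < x"
  shows "ln (1 + x) \<le> x - x\<^sup>2 / 2 + x ^ 3 / 3"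
proof -
  define f where "f = (\<lambda>x::real. x - x\<^sup>2 / 2 + x ^ 3 / 3 - ln (1 + x))"
  have d: "(f has_real_derivative (y ^ 3 / (1 + y))) (at y)" if "-1 < y" for y
    unfolding f_def using that
    by (auto intro!: derivative_eq_intros simp: field_simps power2_eq_square power3_eq_cube)
  have "f 0 \<le> f x"
  proof (cases "0 \<le> x")
    case True
    show ?thesis
    proof (rule DERIV_nonneg_imp_nondecreasing[OF True])
      fix y assume "0 \<le> y" "y \<le> x"
      then show "\<exists>D. (f has_real_derivative D) (at y) \<and> 0 \<le> D"
        using d[of y] by (intro exI[of _ "y ^ 3 / (1 + y)"]) auto
    qed
  next
    case False
    show ?thesis
    proof (rule DERIV_nonpos_imp_nonincreasing[of x 0 f])
      fix y assume "x \<le> y" "y \<le> 0"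
      then show "\<exists>D. (f has_real_derivative D) (at y) \<and> D \<le> 0"
        using d[of y] assms
        by (intro exI[of _ "y ^ 3 / (1 + y)"]) (auto intro!: divide_nonpos_pos simp: power_le_zero_eq)
    qed (use False in simp)
  qed
  then show ?thesis by (simp add: f_def)
qed

lemma xlnx_le_cubic:
  fixes x :: real
  assumes "-1 < x" "x \<le> 1"
  shows "(1 + x) * ln (1 + x) \<le> x + x\<^sup>2 / 2 + \<bar>x\<bar> ^ 3"
proof -
  have "(1 + x) * ln (1 + x) \<le> (1 + x) * (x - x\<^sup>2 / 2 + x ^ 3 / 3)"
    using assms by (intro mult_left_mono ln_add_one_le_cubic) auto
  also have "\<dots> = x + x\<^sup>2 / 2 + (- (x ^ 3) / 6 + x * x ^ 3 / 3)"
    by (simp add: field_simps power2_eq_square power3_eq_cube)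
  also have "- (x ^ 3) / 6 + x * x ^ 3 / 3 \<le> \<bar>x\<bar> ^ 3"
  proof -
    have 1: "- (x ^ 3) \<le> \<bar>x\<bar> ^ 3" by (metis abs_ge_minus_self power_abs)
    have "x * x ^ 3 \<le> \<bar>x\<bar> * \<bar>x\<bar> ^ 3" by (metis abs_ge_self abs_mult power_abs)
    also have "\<dots> \<le> 1 * \<bar>x\<bar> ^ 3" by (rule mult_right_mono) (use assms in auto)
    finally have 2: "x * x ^ 3 \<le> \<bar>x\<bar> ^ 3" by simp
    have "0 \<le> \<bar>x\<bar> ^ 3" by simp
    then show ?thesis using 1 2 by linarith
  qed
  finally show ?thesis by simp
qed

text \<open>Relative entropy of the type with \<open>m = nq(1 + x)\<close>, to second order in \<open>x\<close>.\<close>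

lemma type_weight_ge:
  fixes q \<nu> x :: real and m :: nat
  assumes "0 < q" "0 < \<nu>" "real m = \<nu> * q * (1 + x)" "\<bar>x\<bar> < 1"
  shows "exp (- (\<nu> * q * (x + x\<^sup>2 / 2 + \<bar>x\<bar> ^ 3))) * real m ^ m \<le> \<nu> ^ m * q ^ m"
proof -
  have x: "0 < 1 + x" using assms(4) by simp
  have nq: "0 < \<nu> * q" using assms by simp
  have "(1 + x) ^ m = exp (real m * ln (1 + x))" using x by (simp add: exp_of_nat_mult)
  also have "real m * ln (1 + x) = \<nu> * q * ((1 + x) * ln (1 + x))" using assms(3) by simp
  also have "exp \<dots> \<le> exp (\<nu> * q * (x + x\<^sup>2 / 2 + \<bar>x\<bar> ^ 3))"
    using nq assms(4) by (intro iffD2[OF exp_le_cancel_iff] mult_left_mono xlnx_le_cubic) auto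
  finally have le: "(1 + x) ^ m \<le> exp (\<nu> * q * (x + x\<^sup>2 / 2 + \<bar>x\<bar> ^ 3))" .
  have "real m ^ m = (\<nu> * q) ^ m * (1 + x) ^ m" using assms(3) by (simp add: power_mult_distrib)
  also have "\<dots> \<le> (\<nu> * q) ^ m * exp (\<nu> * q * (x + x\<^sup>2 / 2 + \<bar>x\<bar> ^ 3))"
    using nq le by (intro mult_left_mono) auto
  finally show ?thesis by (simp add: exp_minus field_simps power_mult_distrib)
qed

section \<open>The joint tail of the binary source\<close>

text \<open>The bound \<open>M\<close> on the single samples controls what the overlap with another
  codeword can contribute to the sum of that codeword. It holds for binary samples as soon as M is
  at least 1 and costs the Gaussian source a negligible probability.\<close>

definition joint_tail_event :: "real \<Rightarrow> real \<Rightarrow> real \<Rightarrow> nat set \<Rightarrow> (nat \<Rightarrow> real \<times> real) \<Rightarrow> bool" where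
  "joint_tail_event s u M I \<omega> \<longleftrightarrow> s \<le> (\<Sum>i\<in>I. fst (\<omega> i)) \<and> u \<le> (\<Sum>i\<in>I. snd (\<omega> i)) \<and>
     (\<forall>i\<in>I. \<bar>fst (\<omega> i)\<bar> \<le> M \<and> \<bar>snd (\<omega> i)\<bar> \<le> M)"

lemma borel_measurable_plane_fst_snd:
  assumes "sets \<mu> = sets (borel :: (real \<times> real) measure)"
  shows "fst \<in> borel_measurable \<mu>" "snd \<in> borel_measurable \<mu>"
proof -
  have "fst \<in> borel_measurable (borel :: (real \<times> real) measure)"
    "snd \<in> borel_measurable (borel :: (real \<times> real) measure)"
    by (auto intro!: borel_measurable_continuous_onI continuous_on_fst continuous_on_snd continuous_on_id)
  then show "fst \<in> borel_measurable \<mu>" "snd \<in> borel_measurable \<mu>"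
    by (simp_all add: measurable_cong_sets[OF assms refl])
qed

lemma borel_measurable_PiM_fst_snd:
  assumes "sets \<mu> = sets (borel :: (real \<times> real) measure)" "i \<in> I"
  shows "(\<lambda>\<omega>. fst (\<omega> i)) \<in> borel_measurable (iid \<mu> I)"
    and "(\<lambda>\<omega>. snd (\<omega> i)) \<in> borel_measurable (iid \<mu> I)"
  by (rule measurable_compose[OF measurable_component_singleton[OF assms(2)]],
      rule borel_measurable_plane_fst_snd[OF assms(1)])+

lemma sets_joint_tail_event:
  assumes "sets \<mu> = sets (borel :: (real \<times> real) measure)" "finite J" "J \<subseteq> I"
  shows "{\<omega> \<in> space (iid \<mu> I). joint_tail_event s u M J \<omega>} \<in> sets (iid \<mu> I)"
proof -
  note [measurable] = borel_measurable_PiM_fst_snd[OF assms(1) subsetD[OF assms(3)]]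
  show ?thesis
    unfolding joint_tail_event_def using assms(2) by measurable
qed

lemma measure_DSBS_point:
  assumes \<rho>: "-1 \<le> \<rho>" "\<rho> \<le> 1" and xy: "x = -1 \<or> x = 1" "y = -1 \<or> y = 1"
  shows "measure (DSBS \<rho>) {(x, y)} = (if x = y then (1 + \<rho>) / 4 else (1 - \<rho>) / 4)"
proof -
  define h where "h = (\<lambda>(x::real, b). (x, if b then x else - x))"
  define PP where "PP = pair_pmf (pmf_of_set {-1, 1 :: real}) (bernoulli_pmf ((1 + \<rho>) / 2))"
  have "measure (DSBS \<rho>) {(x, y)} = measure (measure_pmf (map_pmf h PP)) {(x, y)}"
    unfolding DSBS_def PP_def h_def by (subst measure_distr) auto
  also have "\<dots> = measure (measure_pmf PP) (h -` {(x, y)})"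
    by simp
  also have "h -` {(x, y)} = {(x, y = x)}"
    using xy by (auto simp: h_def split: if_splits)
  also have "measure (measure_pmf PP) {(x, y = x)} = pmf PP (x, y = x)"
    by (rule measure_pmf_single)
  also have "\<dots> = (if x = y then (1 + \<rho>) / 4 else (1 - \<rho>) / 4)"
    using xy \<rho> by (auto simp: PP_def pmf_pair field_simps)
  finally show ?thesis .
qed

lemma sum_if4:
  fixes w x y z :: real
  assumes "finite I" "A \<subseteq> I" "B \<subseteq> A" "C \<subseteq> I - A"
  shows "(\<Sum>i\<in>I. if i \<in> A then (if i \<in> B then w else x) else (if i \<in> C then y else z)) =
    card B * w + card (A - B) * x + card C * y + card (I - A - C) * z"
proof -
  have e: "I \<inter> {i. i \<in> A} = A" "I \<inter> - {i. i \<in> A} = I - A" "A \<inter> {i. i \<in> B} = B" "A \<inter> - {i. i \<in> B} = A - B"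
    "(I - A) \<inter> {i. i \<in> C} = C" "(I - A) \<inter> - {i. i \<in> C} = I - A - C" using assms by auto
  have f: "finite A" "finite (I - A)" using assms finite_subset by auto
  show ?thesis
    by (subst sum.If_cases[OF assms(1)], unfold e, subst sum.If_cases[OF f(1)], subst sum.If_cases[OF f(2)], unfold e) simp
qed

lemma prod_if4:
  fixes w x y z :: real
  assumes "finite I" "A \<subseteq> I" "B \<subseteq> A" "C \<subseteq> I - A"
  shows "(\<Prod>i\<in>I. if i \<in> A then (if i \<in> B then w else x) else (if i \<in> C then y else z)) =
    w ^ card B * x ^ card (A - B) * y ^ card C * z ^ card (I - A - C)"
proof -
  have e: "I \<inter> {i. i \<in> A} = A" "I \<inter> - {i. i \<in> A} = I - A" "A \<inter> {i. i \<in> B} = B" "A \<inter> - {i. i \<in> B} = A - B"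
    "(I - A) \<inter> {i. i \<in> C} = C" "(I - A) \<inter> - {i. i \<in> C} = I - A - C" using assms by auto
  have f: "finite A" "finite (I - A)" using assms finite_subset by auto
  show ?thesis
    by (subst prod.If_cases[OF assms(1)], unfold e, subst prod.If_cases[OF f(1)], subst prod.If_cases[OF f(2)], unfold e) simp
qed

text \<open>All outcomes in which \<open>m1\<close>, \<open>m2\<close>, \<open>m3\<close>,
  \<open>m4\<close> coordinates equal (1,1), (1,-1), (-1,1), (-1,-1) are equally likely and lie in
  the event; the three binomial coefficients count them.\<close>

lemma DSBS_type_prob:
  fixes I :: "nat set"
  assumes \<rho>: "-1 \<le> \<rho>" "\<rho> \<le> 1" and I: "finite I" "card I = (m1 + m2) + (m3 + m4)"
    and s: "s \<le> real (m1 + m2) - real (m3 + m4)" and u: "u \<le> real (m1 + m3) - real (m2 + m4)" and M: "1 \<le> M"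
  shows "real (card I choose (m1 + m2)) * real ((m1 + m2) choose m1) * real ((m3 + m4) choose m3) *
      (((1 + \<rho>) / 4) ^ (m1 + m4) * ((1 - \<rho>) / 4) ^ (m2 + m3)) \<le>
    \<P>(\<omega> in iid (DSBS \<rho>) I. joint_tail_event s u M I \<omega>)"
proof -
  define \<mu> where "\<mu> = DSBS \<rho>"
  have \<mu>: "prob_space \<mu>" "sets \<mu> = sets borel" using DSBS_source[OF \<rho>] by (auto simp: \<mu>_def)
  have sp: "space \<mu> = UNIV" using sets_eq_imp_space_eq[OF \<mu>(2)] by simp
  let ?P = "iid \<mu> I"
  interpret P: prob_space ?P by (intro prob_space_PiM \<mu>)
  define q1 q2 where "q1 = (1 + \<rho>) / 4" and "q2 = (1 - \<rho>) / 4"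
  \<comment> \<open>\<open>A\<close> holds the positions where Alice sees 1; \<open>B\<close> inside
    \<open>A\<close> and \<open>C\<close> outside it hold those where Bob sees 1.\<close>
  define Z where "Z = (SIGMA A : {A. A \<subseteq> I \<and> card A = m1 + m2}.
      {B. B \<subseteq> A \<and> card B = m1} \<times> {C. C \<subseteq> I - A \<and> card C = m3})"
  define v :: "nat set \<times> nat set \<times> nat set \<Rightarrow> nat \<Rightarrow> real \<times> real" where
    "v = (\<lambda>(A, B, C). \<lambda>i\<in>I. (if i \<in> A then (if i \<in> B then (1, 1) else (1, -1))
        else (if i \<in> C then (-1, 1) else (-1, -1))))"
  have fin: "finite {B. B \<subseteq> A \<and> card B = m}" if "finite A" for A :: "nat set" and m
    using finite_subset[of _ "Pow A"] that by (auto intro: finite_subset[of _ "Pow A"])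
  have finZ: "finite Z" unfolding Z_def
    using I(1) by (intro finite_SigmaI finite_cartesian_product fin) (auto intro: finite_subset)
  have cards: "card B = m1 \<and> card (A - B) = m2 \<and> card C = m3 \<and> card (I - A - C) = m4 \<and> A \<subseteq> I \<and> B \<subseteq> A \<and> C \<subseteq> I - A"
    if "(A, B, C) \<in> Z" for A B C
  proof -
    have z: "A \<subseteq> I" "card A = m1 + m2" "B \<subseteq> A" "card B = m1" "C \<subseteq> I - A" "card C = m3"
      using that by (auto simp: Z_def)
    have f: "finite A" "finite B" "finite C" using z I(1) by (auto intro: finite_subset)
    have "card (A - B) = m2" using z f by (simp add: card_Diff_subset)
    moreover have "card (I - A) = m3 + m4" using z f I by (simp add: card_Diff_subset)
    then have "card (I - A - C) = m4" using z f by (simp add: card_Diff_subset)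
    ultimately show ?thesis using z by simp
  qed
  have cardZ: "card Z = (card I choose (m1 + m2)) * (((m1 + m2) choose m1) * ((m3 + m4) choose m3))"
  proof -
    have "card Z = (\<Sum>A\<in>{A. A \<subseteq> I \<and> card A = m1 + m2}. ((m1 + m2) choose m1) * ((m3 + m4) choose m3))"
      unfolding Z_def
    proof (subst card_SigmaI)
      show "\<forall>A\<in>{A. A \<subseteq> I \<and> card A = m1 + m2}. finite ({B. B \<subseteq> A \<and> card B = m1} \<times> {C. C \<subseteq> I - A \<and> card C = m3})"
        using I(1) by (auto intro!: finite_cartesian_product fin intro: finite_subset)
      show "(\<Sum>A\<in>{A. A \<subseteq> I \<and> card A = m1 + m2}. card ({B. B \<subseteq> A \<and> card B = m1} \<times> {C. C \<subseteq> I - A \<and> card C = m3})) =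
          (\<Sum>A\<in>{A. A \<subseteq> I \<and> card A = m1 + m2}. ((m1 + m2) choose m1) * ((m3 + m4) choose m3))"
      proof (rule sum.cong[OF refl])
        fix A assume "A \<in> {A. A \<subseteq> I \<and> card A = m1 + m2}"
        then have A: "A \<subseteq> I" "card A = m1 + m2" "finite A" using I(1) by (auto intro: finite_subset)
        then have "card (I - A) = m3 + m4" using I by (simp add: card_Diff_subset)
        then show "card ({B. B \<subseteq> A \<and> card B = m1} \<times> {C. C \<subseteq> I - A \<and> card C = m3}) =
            ((m1 + m2) choose m1) * ((m3 + m4) choose m3)"
          using n_subsets[OF A(3), of m1] n_subsets[of "I - A" m3] A I(1) by (simp add: card_cartesian_product)
      qed
    qed (use I(1) fin in auto)
    then show ?thesis using n_subsets[OF I(1), of "m1 + m2"] by simp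
  qed
  have inj: "inj_on v Z"
  proof (rule inj_onI)
    fix z z' assume zz: "z \<in> Z" "z' \<in> Z" and vv: "v z = v z'"
    obtain A B C A' B' C' where ABC: "z = (A, B, C)" "z' = (A', B', C')" by (cases z, cases z') blast
    have z: "(A, B, C) \<in> Z" "(A', B', C') \<in> Z" and e: "v (A, B, C) = v (A', B', C')"
      using zz vv ABC by simp_all
    have e': "(if i \<in> A then (if i \<in> B then (1, 1) else (1, -1)) else (if i \<in> C then (-1, 1) else (-1, -1 :: real))) =
      (if i \<in> A' then (if i \<in> B' then (1, 1) else (1, -1)) else (if i \<in> C' then (-1, 1) else (-1 :: real, -1)))" if "i \<in> I" for i
      using fun_cong[OF e, of i] that by (simp add: v_def)
    have m: "(i \<in> A \<longleftrightarrow> i \<in> A') \<and> (i \<in> A \<longrightarrow> (i \<in> B \<longleftrightarrow> i \<in> B')) \<and> (i \<notin> A \<longrightarrow> (i \<in> C \<longleftrightarrow> i \<in> C'))"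
      if "i \<in> I" for i
      using e'[OF that] by (auto split: if_splits)
    have sub: "A \<subseteq> I" "A' \<subseteq> I" "B \<subseteq> A" "B' \<subseteq> A'" "C \<subseteq> I - A" "C' \<subseteq> I - A'"
      using cards[OF z(1)] cards[OF z(2)] by auto
    have A: "A = A'" using m sub(1,2) by blast
    have "B = B'" using m sub A by blast
    moreover have "C = C'" using m sub A by blast
    ultimately show "z = z'" using A ABC by blast
  qed
  have one: "measure \<mu> {(a, b)} = (if a = b then q1 else q2)"
    if "a = -1 \<or> a = 1" "b = -1 \<or> b = 1" for a b
    using measure_DSBS_point[OF \<rho> that] by (simp add: \<mu>_def q1_def q2_def)
  have pt: "{v z} \<in> sets ?P \<and> measure ?P {v z} = q1 ^ (m1 + m4) * q2 ^ (m2 + m3)" if "z \<in> Z" for z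
  proof -
    obtain A B C where z: "z = (A, B, C)" by (cases z)
    note c = cards[OF that[unfolded z]]
    have "{v z} = {\<omega> \<in> space ?P. \<forall>i\<in>I. \<omega> i = v z i}"
      by (auto simp: space_PiM sp PiE_iff z v_def extensional_def fun_eq_iff)
    moreover have "{\<omega> \<in> space ?P. \<forall>i\<in>I. \<omega> i = v z i} \<in> sets ?P"
    proof -
      have "{x \<in> space \<mu>. x = w} \<in> sets \<mu>" for w using \<mu>(2) sp by simp
      then show ?thesis using I(1)
        by measurable
    qed
    moreover have "\<P>(\<omega> in ?P. \<forall>i\<in>I. \<omega> i = v z i) = (\<Prod>i\<in>I. \<P>(x in \<mu>. x = v z i))"
      by (rule measure_PiM_all[OF \<mu>(1) I(1)]) (simp add: sp \<mu>(2))
    moreover have "\<dots> = (\<Prod>i\<in>I. if i \<in> A then (if i \<in> B then q1 else q2) else (if i \<in> C then q2 else q1))"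
      by (rule prod.cong[OF refl])
        (simp add: sp v_def z one)
    moreover have "\<dots> = q1 ^ (m1 + m4) * q2 ^ (m2 + m3)"
      using c by (subst prod_if4[OF I(1)]) (simp_all add: power_add mult_ac)
    ultimately show ?thesis by metis
  qed
  have ev: "joint_tail_event s u M I (v z) \<and> v z \<in> space ?P" if "z \<in> Z" for z
  proof -
    obtain A B C where z: "z = (A, B, C)" by (cases z)
    note c = cards[OF that[unfolded z]]
    have "(\<Sum>i\<in>I. fst (v z i)) = (\<Sum>i\<in>I. if i \<in> A then (if i \<in> B then 1 else 1) else (if i \<in> C then -1 else -1))"
      by (rule sum.cong) (auto simp: v_def z)
    also have "\<dots> = real (m1 + m2) - real (m3 + m4)" using c by (subst sum_if4[OF I(1)]) auto
    finally have 1: "(\<Sum>i\<in>I. fst (v z i)) = real (m1 + m2) - real (m3 + m4)" .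
    have "(\<Sum>i\<in>I. snd (v z i)) = (\<Sum>i\<in>I. if i \<in> A then (if i \<in> B then 1 else -1) else (if i \<in> C then 1 else -1))"
      by (rule sum.cong) (auto simp: v_def z)
    also have "\<dots> = real (m1 + m3) - real (m2 + m4)" using c by (subst sum_if4[OF I(1)]) auto
    finally have 2: "(\<Sum>i\<in>I. snd (v z i)) = real (m1 + m3) - real (m2 + m4)" .
    show ?thesis using 1 2 s u M
      by (auto simp: joint_tail_event_def v_def z space_PiM sp)
  qed
  have "real (card Z) * (q1 ^ (m1 + m4) * q2 ^ (m2 + m3)) = (\<Sum>w\<in>v ` Z. measure ?P {w})"
    using pt by (simp add: sum.reindex[OF inj])
  also have "\<dots> = measure ?P (v ` Z)"
    by (rule P.finite_measure_eq_sum_singleton[symmetric]) (use finZ pt in auto)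
  also have "\<dots> \<le> \<P>(\<omega> in ?P. joint_tail_event s u M I \<omega>)"
  proof (rule P.finite_measure_mono)
    show "v ` Z \<subseteq> {\<omega> \<in> space ?P. joint_tail_event s u M I \<omega>}" using ev by auto
    show "{\<omega> \<in> space ?P. joint_tail_event s u M I \<omega>} \<in> sets ?P"
      using sets_joint_tail_event[OF \<mu>(2) I(1) subset_refl] .
  qed
  finally show ?thesis
    by (simp add: cardZ q1_def q2_def \<mu>_def mult.assoc)
qed

text \<open>For \<open>H = ln 2 \<cdot> (k + c)\<close> the threshold \<open>sqrt (2 * H * card I)\<close> is the one that a sum of
  variance \<open>card I\<close> passes with probability about \<open>2 powr (- k - c)\<close>.\<close>

abbreviation joint_tail_prob :: "(real \<times> real) measure \<Rightarrow> real \<Rightarrow> real \<Rightarrow> nat set \<Rightarrow> real" where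
  "joint_tail_prob \<mu> \<phi> H I \<equiv> \<P>(\<omega> in iid \<mu> I. joint_tail_event (sqrt (2 * H * card I)) (\<phi> * sqrt (2 * H * card I))
    (sqrt (sqrt (card I))) I \<omega>)"

text \<open>The lower bound that has to be proved for each source in its own way. \<open>B\<close>,
  \<open>b\<close> and \<open>e\<close> may depend on the source, \<delta> and \<phi>, but not on
  \<open>H\<close> and \<open>I\<close>, so the loss is polynomial in the number of
  positions.\<close>

definition joint_tail_bound :: "(real \<times> real) measure \<Rightarrow> real \<Rightarrow> real \<Rightarrow> bool" where
  "joint_tail_bound \<mu> \<delta> \<phi> \<longleftrightarrow> (\<exists>B b e :: nat. 0 < b \<and> (\<forall>H\<ge>1. \<forall>I :: nat set. finite I \<longrightarrow>
     real B * H ^ 6 \<le> real (card I) \<longrightarrow> I \<noteq> {} \<longrightarrow>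
     exp (- ((1 + \<delta>\<^sup>2) * H)) / (real b * real (card I) ^ e) \<le>
     joint_tail_prob \<mu> \<phi> H I))"

text \<open>Since sqrt ((1 - \<rho>) / (1 + \<rho>)) = sqrt (1 - \<rho>^2) / (1 + \<rho>), the
  hypothesis on \<delta> amounts to \<rho> + \<delta> sqrt (1 - \<rho>^2) \<le> 1.\<close>

lemma correlation_gap_bounds:
  fixes \<rho> \<delta> :: real
  assumes \<rho>: "0 < \<rho>" "\<rho> < 1" and \<delta>: "0 \<le> \<delta>" "\<delta> \<le> sqrt ((1 - \<rho>) / (1 + \<rho>))"
  shows "0 < sqrt (1 - \<rho>\<^sup>2)" "\<delta> \<le> sqrt (1 - \<rho>\<^sup>2)" "\<delta> \<le> 1" "\<rho> + \<delta> * sqrt (1 - \<rho>\<^sup>2) \<le> 1"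
proof -
  define r where "r = sqrt (1 - \<rho>\<^sup>2)"
  have pos: "0 < 1 - \<rho>\<^sup>2" using \<rho> by (simp add: power_less_one_iff)
  show "0 < sqrt (1 - \<rho>\<^sup>2)" using pos by simp
  then have r: "0 < r" "r\<^sup>2 = 1 - \<rho>\<^sup>2" using pos by (auto simp: r_def)
  have "sqrt ((1 - \<rho>) / (1 + \<rho>)) = sqrt ((1 - \<rho>\<^sup>2) / (1 + \<rho>)\<^sup>2)"
  proof (rule arg_cong[of _ _ sqrt])
    have "(1 - \<rho>\<^sup>2) / (1 + \<rho>)\<^sup>2 = ((1 - \<rho>) * (1 + \<rho>)) / ((1 + \<rho>) * (1 + \<rho>))"
      by (simp add: power2_eq_square algebra_simps)
    then show "(1 - \<rho>) / (1 + \<rho>) = (1 - \<rho>\<^sup>2) / (1 + \<rho>)\<^sup>2" using \<rho> by simp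
  qed
  also have "\<dots> = r / (1 + \<rho>)" using \<rho> by (simp add: r_def real_sqrt_divide)
  finally have d: "\<delta> \<le> r / (1 + \<rho>)" using \<delta> by simp
  also have "r / (1 + \<rho>) \<le> r" using \<rho> r by (simp add: divide_le_eq)
  finally show dr: "\<delta> \<le> sqrt (1 - \<rho>\<^sup>2)" by (simp add: r_def)
  have "r \<le> 1" using \<rho> by (simp add: r_def)
  then show "\<delta> \<le> 1" using dr unfolding r_def by linarith
  have "\<delta> * r \<le> r / (1 + \<rho>) * r" using d r by (intro mult_right_mono) auto
  also have "\<dots> = (1 - \<rho>\<^sup>2) / (1 + \<rho>)" using r(2) by (simp add: power2_eq_square)
  also have "\<dots> = 1 - \<rho>" using \<rho> by (simp add: field_simps power2_eq_square)
  finally show "\<rho> + \<delta> * sqrt (1 - \<rho>\<^sup>2) \<le> 1" by (simp add: r_def)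
qed

text \<open>Allows for rounding the class sizes of a type: three classes are rounded up by at most 1
  each and the fourth takes the difference, hence the error 3. The linear term
  \<open>m - \<nu> * q\<close> is kept exact because over the four classes these terms
  cancel.\<close>

lemma rounded_type_weight_ge:
  fixes q \<nu> y \<tau> :: real and m :: nat
  assumes q: "0 < q" "0 < \<nu>" and m: "\<bar>real m - \<nu> * q * (1 + y)\<bar> \<le> 3" and \<tau>: "\<bar>y\<bar> + 3 / (\<nu> * q) \<le> \<tau>" "\<tau> \<le> 1 / 2"
  shows "exp (- ((real m - \<nu> * q) + \<nu> * q * y\<^sup>2 / 2 + 3 + \<nu> * q * \<tau> ^ 3)) * real m ^ m \<le> \<nu> ^ m * q ^ m"
proof -
  define w where "w = \<nu> * q"
  have w: "0 < w" using q by (simp add: w_def)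
  define c where "c = real m - w * (1 + y)"
  have c: "\<bar>c\<bar> \<le> 3" using m by (simp add: c_def w_def)
  define x where "x = y + c / w"
  have mx: "real m = w * (1 + x)" using w by (simp add: x_def c_def field_simps)
  have "\<bar>c / w\<bar> \<le> 3 / w" using c w by (simp add: divide_right_mono)
  then have x: "\<bar>x\<bar> \<le> \<tau>" using \<tau>(1) unfolding x_def w_def by linarith
  have y: "\<bar>y\<bar> \<le> 1 / 2" and w3: "3 / w \<le> 1 / 2"
  proof -
    have "0 \<le> 3 / w" using w by simp
    then show "\<bar>y\<bar> \<le> 1 / 2" "3 / w \<le> 1 / 2" using \<tau> unfolding w_def by linarith+
  qed
  have "w * x\<^sup>2 = w * y\<^sup>2 + 2 * (y * c) + c\<^sup>2 / w"
    using w by (simp add: x_def power2_eq_square field_simps)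
  moreover have "y * c \<le> 3 / 2"
  proof -
    have "y * c \<le> \<bar>y\<bar> * \<bar>c\<bar>" by (metis abs_ge_self abs_mult)
    also have "\<dots> \<le> 1 / 2 * 3" using y c by (intro mult_mono) auto
    finally show ?thesis by simp
  qed
  moreover have "c\<^sup>2 / w \<le> 3 / 2"
  proof -
    have "c\<^sup>2 \<le> 9" using c abs_le_square_iff[of c 3] by simp
    then have "c\<^sup>2 / w \<le> 9 / w" using w by (simp add: divide_right_mono)
    moreover have "9 / w = 3 * (3 / w)" by simp
    ultimately show ?thesis using w3 by linarith
  qed
  ultimately have sq: "w * x\<^sup>2 / 2 \<le> w * y\<^sup>2 / 2 + 3" by linarith
  have "w * \<bar>x\<bar> ^ 3 \<le> w * \<tau> ^ 3" using w x by (intro mult_left_mono power_mono) auto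
  then have "w * (x + x\<^sup>2 / 2 + \<bar>x\<bar> ^ 3) \<le> (real m - w) + w * y\<^sup>2 / 2 + 3 + w * \<tau> ^ 3"
    using sq mx by (simp add: algebra_simps)
  then have "exp (- ((real m - w) + w * y\<^sup>2 / 2 + 3 + w * \<tau> ^ 3)) * real m ^ m \<le>
      exp (- (w * (x + x\<^sup>2 / 2 + \<bar>x\<bar> ^ 3))) * real m ^ m"
    by (intro mult_right_mono) auto
  also have "\<dots> \<le> \<nu> ^ m * q ^ m"
    unfolding w_def by (rule type_weight_ge[OF q]) (use mx x \<tau> in \<open>auto simp: w_def\<close>)
  finally show ?thesis by (simp add: w_def)
qed

text \<open>sqrt (H / \<nu>) is the order of the relative deviation of the class sizes. The bounds
  say that rounding by one sample is no larger, that the deviations stay below 1/2, and that the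
  cubic error of the entropy expansion is bounded by a constant.\<close>

lemma sqrt_ratio_bounds:
  fixes H \<nu> K :: real
  assumes H: "1 \<le> H" and K: "0 < K" and \<nu>: "(4 * K\<^sup>2 + 1) * H ^ 6 \<le> \<nu>"
  shows "1 / \<nu> \<le> sqrt (H / \<nu>)" "K * sqrt (H / \<nu>) \<le> 1 / 2" "\<nu> * (K * sqrt (H / \<nu>)) ^ 3 \<le> K ^ 3" "1 \<le> \<nu>"
proof -
  have H6: "H \<le> H ^ 6" "H ^ 3 \<le> H ^ 6" "1 \<le> H ^ 6"
    using H power_increasing[of 1 6 H] power_increasing[of 3 6 H] one_le_power[of H 6] by auto
  have "4 * K\<^sup>2 * H ^ 6 + H ^ 6 \<le> \<nu>" using \<nu> by (simp add: algebra_simps)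
  moreover have "0 \<le> 4 * K\<^sup>2 * H ^ 6" using H by simp
  ultimately have n6: "H ^ 6 \<le> \<nu>" and n4: "4 * K\<^sup>2 * H ^ 6 \<le> \<nu>" using H6 by linarith+
  show n1: "1 \<le> \<nu>" using n6 H6 by linarith
  have h0: "0 \<le> H / \<nu>" using H n1 by simp
  show "1 / \<nu> \<le> sqrt (H / \<nu>)"
  proof (rule real_le_rsqrt)
    have "(1 / \<nu>)\<^sup>2 = 1 / \<nu> * (1 / \<nu>)" by (simp add: power2_eq_square)
    also have "\<dots> \<le> H * (1 / \<nu>)"
    proof (rule mult_right_mono)
      have "1 / \<nu> \<le> 1" using n1 by simp
      then show "1 / \<nu> \<le> H" using H by linarith
    qed (use n1 in simp)
    finally show "(1 / \<nu>)\<^sup>2 \<le> H / \<nu>" by simp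
  qed
  have "sqrt (H / \<nu>) \<le> 1 / (2 * K)"
  proof (rule real_le_lsqrt)
    have "4 * K\<^sup>2 * H \<le> 4 * K\<^sup>2 * H ^ 6" using H6 by (intro mult_left_mono) auto
    then have "4 * K\<^sup>2 * H \<le> \<nu>" using n4 by linarith
    then show "H / \<nu> \<le> (1 / (2 * K))\<^sup>2" using n1 K by (simp add: field_simps power2_eq_square)
  qed (use h0 K in auto)
  then show "K * sqrt (H / \<nu>) \<le> 1 / 2" using K by (simp add: field_simps)
  have "sqrt (H / \<nu>) \<le> 1 / H"
  proof (rule real_le_lsqrt)
    have "H ^ 3 \<le> \<nu>" using n6 H6 by linarith
    then show "H / \<nu> \<le> (1 / H)\<^sup>2" using H n1 by (simp add: field_simps power2_eq_square power3_eq_cube)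
  qed (use h0 H in auto)
  then have "H * sqrt (H / \<nu>) \<le> 1" using H by (simp add: field_simps)
  moreover have "\<nu> * sqrt (H / \<nu>) ^ 3 = H * sqrt (H / \<nu>)"
  proof -
    have "sqrt (H / \<nu>) ^ 3 = H / \<nu> * sqrt (H / \<nu>)" using real_sqrt_pow2[OF h0]
      by (simp only: power3_eq_cube power2_eq_square)
    then show ?thesis using n1 by simp
  qed
  ultimately have "K ^ 3 * (\<nu> * sqrt (H / \<nu>) ^ 3) \<le> K ^ 3 * 1" using K by (intro mult_left_mono) auto
  then show "\<nu> * (K * sqrt (H / \<nu>)) ^ 3 \<le> K ^ 3" by (simp add: power_mult_distrib mult_ac)
qed

text \<open>The dominant type is the point probability of (x, y) multiplied by 1 + \<alpha> x +
  \<beta> y, the first-order form of an exponential tilt. Its relative entropy is to second order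
  half the mean square of \<alpha> x + \<beta> y; over all samples this is exactly (1 + \<delta>^2)
  H.\<close>

lemma DSBS_joint_tail_prob_ge:
  fixes \<rho> \<delta> \<phi> H K :: real and I :: "nat set"
  assumes \<rho>: "0 < \<rho>" "\<rho> < 1" and \<delta>: "0 \<le> \<delta>" "\<delta> \<le> sqrt ((1 - \<rho>) / (1 + \<rho>))"
    and \<phi>: "\<phi> = \<rho> + \<delta> * sqrt (1 - \<rho>\<^sup>2)" and K: "K = 3 + 3 / ((1 - \<rho>) / 4)"
    and H: "1 \<le> H" and I: "finite I" "(4 * K\<^sup>2 + 1) * H ^ 6 \<le> real (card I)"
  shows "exp (- ((1 + \<delta>\<^sup>2) * H + 12 + K ^ 3)) / real (Suc (card I)) ^ 3 \<le>
    joint_tail_prob (DSBS \<rho>) \<phi> H I"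
proof -
  define n where "n = card I"
  define \<nu> where "\<nu> = real n"
  define r where "r = sqrt (1 - \<rho>\<^sup>2)"
  note gap = correlation_gap_bounds[OF \<rho> \<delta>, folded r_def]
  define g where "g = \<delta> / r"
  have g: "0 \<le> g" "g \<le> 1" "\<delta> = g * r" using gap \<delta> by (auto simp: g_def)
  have r2: "r\<^sup>2 = 1 - \<rho>\<^sup>2" unfolding r_def using \<rho> by (simp add: power_le_one)
  define q1 q2 where "q1 = (1 + \<rho>) / 4" and "q2 = (1 - \<rho>) / 4"
  have q: "0 < q1" "0 < q2" "q2 \<le> q1" using \<rho> by (auto simp: q1_def q2_def)
  have K0: "0 < K" using \<rho> by (simp add: K add_pos_pos)
  note sb = sqrt_ratio_bounds[OF H K0 I(2), folded n_def, folded \<nu>_def]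
  define \<sigma> where "\<sigma> = sqrt (2 * H / \<nu>)"
  have s0: "0 \<le> \<sigma>" using H sb(4) by (simp add: \<sigma>_def)
  have s2: "\<nu> * \<sigma>\<^sup>2 = 2 * H" using H sb(4) by (simp add: \<sigma>_def)
  define s where "s = sqrt (2 * H * \<nu>)"
  have s: "s = \<nu> * \<sigma>"
  proof -
    have "\<nu> * \<sigma> = sqrt (\<nu>\<^sup>2) * sqrt (2 * H / \<nu>)" using sb(4) by (simp add: \<sigma>_def)
    also have "\<dots> = sqrt (\<nu>\<^sup>2 * (2 * H / \<nu>))" by (simp only: real_sqrt_mult)
    also have "\<nu>\<^sup>2 * (2 * H / \<nu>) = 2 * H * \<nu>" using sb(4) by (simp add: power2_eq_square)
    finally show ?thesis by (simp add: s_def)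
  qed
  define \<tau> where "\<tau> = K * sqrt (H / \<nu>)"
  have tau: "\<tau> \<le> 1 / 2" "\<nu> * \<tau> ^ 3 \<le> K ^ 3" using sb by (auto simp: \<tau>_def)
  have sig: "2 * \<sigma> \<le> 3 * sqrt (H / \<nu>)"
  proof -
    have "\<sigma> = sqrt 2 * sqrt (H / \<nu>)" by (simp add: \<sigma>_def real_sqrt_mult[symmetric])
    moreover have "sqrt 2 \<le> 3 / 2" by (rule real_le_lsqrt) (auto simp: power2_eq_square)
    moreover have "0 \<le> sqrt (H / \<nu>)" using H sb(4) by simp
    ultimately have "\<sigma> \<le> 3 / 2 * sqrt (H / \<nu>)" by (metis mult_right_mono)
    then show ?thesis by simp
  qed
  \<comment> \<open>Origin of \<open>K\<close>: the deviation 2 \<sigma> is at most 3 sqrt (H /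
    \<nu>), and the rounding error adds at most 3 / \<open>q2\<close> times sqrt (H /
    \<nu>).\<close>
  have tq: "\<bar>y\<bar> + 3 / (\<nu> * q) \<le> \<tau>" if "\<bar>y\<bar> \<le> 2 * \<sigma>" "q2 \<le> q" for y q
  proof -
    have "3 / (\<nu> * q) \<le> 3 / (\<nu> * q2)" using that q sb(4) by (intro divide_left_mono mult_left_mono mult_pos_pos) auto
    also have "\<dots> = 3 / q2 * (1 / \<nu>)" by simp
    also have "\<dots> \<le> 3 / q2 * sqrt (H / \<nu>)" using sb(1) q by (intro mult_left_mono) auto
    finally have "\<bar>y\<bar> + 3 / (\<nu> * q) \<le> 3 * sqrt (H / \<nu>) + 3 / q2 * sqrt (H / \<nu>)" using that sig by linarith
    then show ?thesis by (simp add: \<tau>_def K q2_def algebra_simps)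
  qed
  \<comment> \<open>The solution of \<alpha> + \<rho> \<beta> = \<sigma> and \<rho> \<alpha> +
    \<beta> = \<phi> \<sigma>: under the tilted distribution the means of the two sums are exactly
    the two thresholds.\<close>
  define \<alpha> \<beta> where "\<alpha> = \<sigma> * (1 - \<rho> * g)" and "\<beta> = \<sigma> * g"
  have ab: "0 \<le> \<alpha>" "\<alpha> \<le> \<sigma>" "0 \<le> \<beta>" "\<beta> \<le> \<sigma>"
  proof -
    have "\<rho> * g \<le> 1" "0 \<le> \<rho> * g" using \<rho> g mult_le_one[of \<rho> g] by auto
    then show "0 \<le> \<alpha>" "\<alpha> \<le> \<sigma>" "0 \<le> \<beta>" "\<beta> \<le> \<sigma>"
      using s0 g by (auto simp: \<alpha>_def \<beta>_def intro: mult_left_le)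
  qed
  have y: "\<bar>\<alpha> + \<beta>\<bar> \<le> 2 * \<sigma>" "\<bar>\<alpha> - \<beta>\<bar> \<le> 2 * \<sigma>" "\<bar>\<beta> - \<alpha>\<bar> \<le> 2 * \<sigma>" "\<bar>- \<alpha> - \<beta>\<bar> \<le> 2 * \<sigma>" using ab by auto
  \<comment> \<open>Alice's sum is 2 (m1 + m2) - \<nu> and Bob's is 2 (m1 + m3) - \<nu>, so rounding
    these three classes up keeps both thresholds passed.\<close>
  define m1 m2 m3 where "m1 = nat \<lceil>\<nu> * q1 * (1 + (\<alpha> + \<beta>))\<rceil>" and "m2 = nat \<lceil>\<nu> * q2 * (1 + (\<alpha> - \<beta>))\<rceil>"
    and "m3 = nat \<lceil>\<nu> * q2 * (1 + (\<beta> - \<alpha>))\<rceil>"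
  have rnd: "\<nu> * q * (1 + y) \<le> real (nat \<lceil>\<nu> * q * (1 + y)\<rceil>) \<and> real (nat \<lceil>\<nu> * q * (1 + y)\<rceil>) \<le> \<nu> * q * (1 + y) + 1"
    if "\<bar>y\<bar> \<le> 2 * \<sigma>" "q2 \<le> q" for y q
  proof -
    have "0 \<le> 3 / (\<nu> * q)" using that q sb(4) by simp
    then have "\<bar>y\<bar> \<le> 1 / 2" using tq[OF that] tau by linarith
    then have "0 \<le> \<nu> * q * (1 + y)" using that q sb(4) by (intro mult_nonneg_nonneg) auto
    then show ?thesis by linarith
  qed
  note r1 = rnd[OF y(1) q(3), folded m1_def] and r2' = rnd[OF y(2) order_refl, folded m2_def]
    and r3 = rnd[OF y(3) order_refl, folded m3_def]
  have tot: "\<nu> * q1 * (1 + (\<alpha> + \<beta>)) + \<nu> * q2 * (1 + (\<alpha> - \<beta>)) + \<nu> * q2 * (1 + (\<beta> - \<alpha>)) + \<nu> * q1 * (1 + (- \<alpha> - \<beta>)) = \<nu>"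
    by (simp add: q1_def q2_def field_simps)
  \<comment> \<open>The fourth class is large enough to absorb the three roundings, so the truncated
    subtraction in \<open>m4\<close> is a true one.\<close>
  have "3 \<le> \<nu> * q1 * (1 + (- \<alpha> - \<beta>))"
  proof -
    have "\<bar>- \<alpha> - \<beta>\<bar> + 3 / (\<nu> * q1) \<le> 1 / 2" using tq[OF y(4) q(3)] tau by linarith
    then have "3 / (\<nu> * q1) \<le> 1 + (- \<alpha> - \<beta>)" by linarith
    then show ?thesis using q sb(4) by (simp add: field_simps)
  qed
  then have "real m1 + real m2 + real m3 \<le> real n" using r1 r2' r3 tot unfolding \<nu>_def by linarith
  then have le: "m1 + m2 + m3 \<le> n" by linarith
  define m4 where "m4 = n - (m1 + m2 + m3)"
  have n: "n = (m1 + m2) + (m3 + m4)" using le by (simp add: m4_def)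
  have nr: "\<nu> = real m1 + real m2 + real m3 + real m4" by (simp add: \<nu>_def n)
  have w1: "exp (- ((real m1 - \<nu> * q1) + \<nu> * q1 * (\<alpha> + \<beta>)\<^sup>2 / 2 + 3 + \<nu> * q1 * \<tau> ^ 3)) * real m1 ^ m1 \<le> \<nu> ^ m1 * q1 ^ m1"
    by (rule rounded_type_weight_ge[OF q(1) _ _ tq[OF y(1) q(3)] tau(1)]) (use sb(4) r1 in \<open>auto simp: abs_le_iff\<close>)
  have w2: "exp (- ((real m2 - \<nu> * q2) + \<nu> * q2 * (\<alpha> - \<beta>)\<^sup>2 / 2 + 3 + \<nu> * q2 * \<tau> ^ 3)) * real m2 ^ m2 \<le> \<nu> ^ m2 * q2 ^ m2"
    by (rule rounded_type_weight_ge[OF q(2) _ _ tq[OF y(2) order_refl] tau(1)]) (use sb(4) r2' in \<open>auto simp: abs_le_iff\<close>)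
  have w3: "exp (- ((real m3 - \<nu> * q2) + \<nu> * q2 * (\<beta> - \<alpha>)\<^sup>2 / 2 + 3 + \<nu> * q2 * \<tau> ^ 3)) * real m3 ^ m3 \<le> \<nu> ^ m3 * q2 ^ m3"
    by (rule rounded_type_weight_ge[OF q(2) _ _ tq[OF y(3) order_refl] tau(1)]) (use sb(4) r3 in \<open>auto simp: abs_le_iff\<close>)
  have w4: "exp (- ((real m4 - \<nu> * q1) + \<nu> * q1 * (- \<alpha> - \<beta>)\<^sup>2 / 2 + 3 + \<nu> * q1 * \<tau> ^ 3)) * real m4 ^ m4 \<le> \<nu> ^ m4 * q1 ^ m4"
  proof (rule rounded_type_weight_ge[OF q(1) _ _ tq[OF y(4) q(3)] tau(1)])
    show "\<bar>real m4 - \<nu> * q1 * (1 + (- \<alpha> - \<beta>))\<bar> \<le> 3" using r1 r2' r3 tot nr unfolding abs_le_iff by linarith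
  qed (use sb(4) in auto)
  \<comment> \<open>12 is the rounding loss 3 of each of the four classes; K^3 bounds their cubic
    terms together.\<close>
  define L where "L = (1 + \<delta>\<^sup>2) * H + 12 + K ^ 3"
  define mm where "mm = real m1 ^ m1 * real m2 ^ m2 * real m3 ^ m3 * real m4 ^ m4"
  \<comment> \<open>Empty classes do no harm, since 0 ^ 0 = 1.\<close>
  have mm: "0 < mm"
  proof -
    have "0 < real m ^ m" for m by (cases m) auto
    then show ?thesis by (simp add: mm_def)
  qed
  have quad: "\<nu> * q1 * (\<alpha> + \<beta>)\<^sup>2 / 2 + \<nu> * q2 * (\<alpha> - \<beta>)\<^sup>2 / 2 + \<nu> * q2 * (\<beta> - \<alpha>)\<^sup>2 / 2 + \<nu> * q1 * (- \<alpha> - \<beta>)\<^sup>2 / 2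
      = (1 + \<delta>\<^sup>2) * H"
  proof -
    have "\<nu> * q1 * (\<alpha> + \<beta>)\<^sup>2 / 2 + \<nu> * q2 * (\<alpha> - \<beta>)\<^sup>2 / 2 + \<nu> * q2 * (\<beta> - \<alpha>)\<^sup>2 / 2 + \<nu> * q1 * (- \<alpha> - \<beta>)\<^sup>2 / 2
        = \<nu> * \<sigma>\<^sup>2 / 2 * (1 + g\<^sup>2 * (1 - \<rho>\<^sup>2))"
      by (simp add: q1_def q2_def \<alpha>_def \<beta>_def power2_eq_square field_simps)
    also have "\<dots> = H * (1 + \<delta>\<^sup>2)" unfolding s2 g(3) power_mult_distrib r2 by simp
    finally show ?thesis by simp
  qed
  have cub: "\<nu> * q1 * \<tau> ^ 3 + \<nu> * q2 * \<tau> ^ 3 + \<nu> * q2 * \<tau> ^ 3 + \<nu> * q1 * \<tau> ^ 3 = \<nu> * \<tau> ^ 3"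
    by (simp add: q1_def q2_def field_simps)
  have lin: "(real m1 - \<nu> * q1) + (real m2 - \<nu> * q2) + (real m3 - \<nu> * q2) + (real m4 - \<nu> * q1) = 0"
    by (simp add: nr q1_def q2_def field_simps)
  let ?e1 = "(real m1 - \<nu> * q1) + \<nu> * q1 * (\<alpha> + \<beta>)\<^sup>2 / 2 + 3 + \<nu> * q1 * \<tau> ^ 3"
  let ?e2 = "(real m2 - \<nu> * q2) + \<nu> * q2 * (\<alpha> - \<beta>)\<^sup>2 / 2 + 3 + \<nu> * q2 * \<tau> ^ 3"
  let ?e3 = "(real m3 - \<nu> * q2) + \<nu> * q2 * (\<beta> - \<alpha>)\<^sup>2 / 2 + 3 + \<nu> * q2 * \<tau> ^ 3"
  let ?e4 = "(real m4 - \<nu> * q1) + \<nu> * q1 * (- \<alpha> - \<beta>)\<^sup>2 / 2 + 3 + \<nu> * q1 * \<tau> ^ 3"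
  have Lge: "?e1 + ?e2 + ?e3 + ?e4 \<le> L" using quad cub lin tau(2) unfolding L_def by linarith
  have "exp (- L) * mm \<le> exp (- (?e1 + ?e2 + ?e3 + ?e4)) * mm"
    using Lge mm by (intro mult_right_mono) auto
  also have "\<dots> = (exp (- ?e1) * real m1 ^ m1) * (exp (- ?e2) * real m2 ^ m2) * (exp (- ?e3) * real m3 ^ m3) * (exp (- ?e4) * real m4 ^ m4)"
    unfolding mm_def by (simp only: minus_add_distrib exp_add ac_simps)
  also have "\<dots> \<le> (\<nu> ^ m1 * q1 ^ m1) * (\<nu> ^ m2 * q2 ^ m2) * (\<nu> ^ m3 * q2 ^ m3) * (\<nu> ^ m4 * q1 ^ m4)"
    using q sb(4) by (intro mult_mono w1 w2 w3 w4) auto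
  also have "\<dots> = \<nu> ^ n * (q1 ^ (m1 + m4) * q2 ^ (m2 + m3))"
    unfolding n by (simp only: power_add ac_simps)
  finally have A: "exp (- L) * mm \<le> \<nu> ^ n * (q1 ^ (m1 + m4) * q2 ^ (m2 + m3))" .
  define Cb where "Cb = real (n choose (m1 + m2)) * real ((m1 + m2) choose m1) * real ((m3 + m4) choose m3)"
  have "real (n ^ n) \<le> real (Suc n ^ 3 * ((n choose (m1 + m2)) * ((m1 + m2) choose m1) * ((m3 + m4) choose m3) *
    (m1 ^ m1 * m2 ^ m2 * m3 ^ m3 * m4 ^ m4)))"
    unfolding of_nat_le_iff using multinomial_mode[of m1 m2 m3 m4] unfolding n by simp
  then have "\<nu> ^ n \<le> real (Suc n) ^ 3 * (Cb * mm)"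
    by (simp only: of_nat_mult of_nat_power \<nu>_def Cb_def mm_def mult.assoc)
  then have "\<nu> ^ n * (q1 ^ (m1 + m4) * q2 ^ (m2 + m3)) \<le> real (Suc n) ^ 3 * (Cb * mm) * (q1 ^ (m1 + m4) * q2 ^ (m2 + m3))"
    using q by (intro mult_right_mono) auto
  with A have "exp (- L) * mm \<le> (real (Suc n) ^ 3 * (Cb * (q1 ^ (m1 + m4) * q2 ^ (m2 + m3)))) * mm"
    by (simp only: ac_simps)
  then have "exp (- L) \<le> real (Suc n) ^ 3 * (Cb * (q1 ^ (m1 + m4) * q2 ^ (m2 + m3)))"
    using mm by (simp only: mult_le_cancel_right_pos)
  then have "exp (- L) / real (Suc n) ^ 3 \<le> Cb * (q1 ^ (m1 + m4) * q2 ^ (m2 + m3))"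
    by (simp add: divide_le_eq mult.commute)
  also have "\<dots> \<le> \<P>(\<omega> in iid (DSBS \<rho>) I. joint_tail_event s (\<phi> * s) (sqrt (sqrt \<nu>)) I \<omega>)"
    unfolding Cb_def q1_def q2_def n_def
  proof (rule DSBS_type_prob)
    have "\<nu> * (\<alpha> + \<rho> * \<beta>) = 2 * (\<nu> * q1 * (1 + (\<alpha> + \<beta>)) + \<nu> * q2 * (1 + (\<alpha> - \<beta>))) - \<nu>"
      by (simp add: q1_def q2_def field_simps)
    also have "\<dots> \<le> real (m1 + m2) - real (m3 + m4)" using r1 r2' nr by simp
    finally show "s \<le> real (m1 + m2) - real (m3 + m4)"
      by (simp add: s \<alpha>_def \<beta>_def algebra_simps)
    have "\<nu> * (\<rho> * \<alpha> + \<beta>) = 2 * (\<nu> * q1 * (1 + (\<alpha> + \<beta>)) + \<nu> * q2 * (1 + (\<beta> - \<alpha>))) - \<nu>"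
      by (simp add: q1_def q2_def field_simps)
    also have "\<dots> \<le> real (m1 + m3) - real (m2 + m4)" using r1 r3 nr by simp
    also have "\<nu> * (\<rho> * \<alpha> + \<beta>) = \<nu> * \<sigma> * (\<rho> + g * (1 - \<rho>\<^sup>2))"
      by (simp add: \<alpha>_def \<beta>_def algebra_simps power2_eq_square)
    also have "g * (1 - \<rho>\<^sup>2) = \<delta> * r" unfolding r2[symmetric] g(3) by (simp add: power2_eq_square)
    finally show "\<phi> * s \<le> real (m1 + m3) - real (m2 + m4)"
      by (simp add: s \<phi> r_def mult_ac)
    show "1 \<le> sqrt (sqrt \<nu>)" using sb(4) by simp
  qed (use \<rho> I(1) n in \<open>auto simp: n_def\<close>)
  finally show ?thesis by (simp add: L_def n_def s_def \<nu>_def)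
qed

lemma DSBS_joint_tail:
  fixes \<rho> \<delta> \<phi> :: real
  assumes "0 < \<rho>" "\<rho> < 1" "0 \<le> \<delta>" "\<delta> \<le> sqrt ((1 - \<rho>) / (1 + \<rho>))" "\<phi> = \<rho> + \<delta> * sqrt (1 - \<rho>\<^sup>2)"
  shows "joint_tail_bound (DSBS \<rho>) \<delta> \<phi>"
proof -
  define K where "K = 3 + 3 / ((1 - \<rho>) / 4)"
  define B where "B = nat \<lceil>4 * K\<^sup>2 + 1\<rceil>"
  define b where "b = nat \<lceil>8 * exp (12 + K ^ 3)\<rceil>"
  have B: "4 * K\<^sup>2 + 1 \<le> real B" unfolding B_def by linarith
  have b: "8 * exp (12 + K ^ 3) \<le> real b" unfolding b_def by linarith
  have b0: "0 < real b" using b exp_gt_zero[of "12 + K ^ 3"] by linarith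
  have "exp (- ((1 + \<delta>\<^sup>2) * H)) / (real b * real (card I) ^ 3) \<le>
     joint_tail_prob (DSBS \<rho>) \<phi> H I"
    if H: "1 \<le> H" and I: "finite I" "real B * H ^ 6 \<le> real (card I)" "I \<noteq> {}" for H and I :: "nat set"
  proof -
    have "(4 * K\<^sup>2 + 1) * H ^ 6 \<le> real B * H ^ 6" using B H by (intro mult_right_mono) auto
    then have I2: "(4 * K\<^sup>2 + 1) * H ^ 6 \<le> real (card I)" using I(2) by linarith
    have n1: "1 \<le> card I" using I by (simp add: Suc_le_eq card_gt_0_iff)
    have "real (Suc (card I)) ^ 3 \<le> (2 * real (card I)) ^ 3" using n1 by (intro power_mono) auto
    also have "\<dots> = 8 * real (card I) ^ 3" by (simp add: power_mult_distrib)
    finally have S: "real (Suc (card I)) ^ 3 \<le> 8 * real (card I) ^ 3" .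
    have "exp (12 + K ^ 3) * real (Suc (card I)) ^ 3 \<le> exp (12 + K ^ 3) * (8 * real (card I) ^ 3)"
      using S by (intro mult_left_mono) auto
    also have "\<dots> = (8 * exp (12 + K ^ 3)) * real (card I) ^ 3" by simp
    also have "\<dots> \<le> real b * real (card I) ^ 3" using b by (intro mult_right_mono) auto
    finally have "exp (12 + K ^ 3) * real (Suc (card I)) ^ 3 \<le> real b * real (card I) ^ 3" .
    then have "exp (- ((1 + \<delta>\<^sup>2) * H)) / (real b * real (card I) ^ 3) \<le>
        exp (- ((1 + \<delta>\<^sup>2) * H)) / (exp (12 + K ^ 3) * real (Suc (card I)) ^ 3)"
      using b0 n1 by (intro divide_left_mono mult_pos_pos) auto
    also have "\<dots> = exp (- ((1 + \<delta>\<^sup>2) * H + 12 + K ^ 3)) / real (Suc (card I)) ^ 3"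
    proof -
      have "exp (- ((1 + \<delta>\<^sup>2) * H + 12 + K ^ 3)) = exp (- ((1 + \<delta>\<^sup>2) * H)) / exp (12 + K ^ 3)"
        by (simp only: exp_diff[symmetric]) simp
      then show ?thesis by simp
    qed
    also have "\<dots> \<le> joint_tail_prob (DSBS \<rho>) \<phi> H I"
      by (rule DSBS_joint_tail_prob_ge[OF assms K_def H I(1) I2])
    finally show ?thesis .
  qed
  then show ?thesis unfolding joint_tail_bound_def using b0
    by (intro exI[of _ B] exI[of _ b] exI[of _ 3]) auto
qed

section \<open>Subgaussian coordinates\<close>

text \<open>The moment generating function is bounded by that of the standard normal distribution,
  so binary and Gaussian samples obey the same Chernoff bounds.\<close>

definition subgaussian :: "'a measure \<Rightarrow> ('a \<Rightarrow> real) \<Rightarrow> bool" where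
  "subgaussian \<mu> f \<longleftrightarrow> f \<in> borel_measurable \<mu> \<and>
     (\<forall>t. (\<integral>\<^sup>+x. ennreal (exp (t * f x)) \<partial>\<mu>) \<le> ennreal (exp (t\<^sup>2 / 2)))"

lemma subgaussian_uminus: "subgaussian \<mu> f \<Longrightarrow> subgaussian \<mu> (\<lambda>x. - f x)"
proof -
  assume f: "subgaussian \<mu> f"
  have "(\<integral>\<^sup>+x. ennreal (exp (t * - f x)) \<partial>\<mu>) \<le> ennreal (exp (t\<^sup>2 / 2))" for t
    using f[unfolded subgaussian_def, THEN conjunct2, rule_format, of "- t"] by simp
  then show ?thesis using f by (auto simp: subgaussian_def)
qed

lemma subgaussian_sum_tail:
  fixes f :: "'a \<Rightarrow> real"
  assumes \<mu>: "prob_space \<mu>" and f: "subgaussian \<mu> f" and J: "finite K" "J \<subseteq> K" and t: "0 \<le> t"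
  shows "\<P>(\<omega> in iid \<mu> K. u \<le> (\<Sum>j\<in>J. f (\<omega> j)))
    \<le> exp (real (card J) * (t\<^sup>2 / 2) - t * u)"
proof -
  have fJ: "finite J" using J finite_subset by blast
  have [measurable]: "f \<in> borel_measurable \<mu>" using f by (simp add: subgaussian_def)
  define A where "A = {\<omega> \<in> space (iid \<mu> J). u \<le> (\<Sum>j\<in>J. f (\<omega> j))}"
  have A: "A \<in> sets (iid \<mu> J)" unfolding A_def by measurable
  have "{\<omega> \<in> space (iid \<mu> K). u \<le> (\<Sum>j\<in>J. f (\<omega> j))} =
      {\<omega> \<in> space (iid \<mu> K). restrict \<omega> J \<in> A}"
  proof -
    have "restrict \<omega> J \<in> space (iid \<mu> J)" if "\<omega> \<in> space (iid \<mu> K)" for \<omega>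
      by (rule measurable_space[OF measurable_restrict_subset[OF J(2)] that])
    then show ?thesis by (auto simp: A_def)
  qed
  then have "\<P>(\<omega> in iid \<mu> K. u \<le> (\<Sum>j\<in>J. f (\<omega> j))) =
      measure (iid \<mu> J) A"
    using measure_PiM_restrict[OF \<mu> J A] by simp
  also have "\<dots> \<le> exp (real (card J) * (t\<^sup>2 / 2) - t * u)"
    unfolding A_def by (rule chernoff_PiM[OF \<mu> fJ]) (use f t in \<open>auto simp: subgaussian_def\<close>)
  finally show ?thesis .
qed

lemma subgaussian_coordinate_tail:
  fixes f :: "'a \<Rightarrow> real"
  assumes \<mu>: "prob_space \<mu>" and f: "subgaussian \<mu> f" and K: "finite K" "i \<in> K" and M: "0 \<le> M"
  shows "\<P>(\<omega> in iid \<mu> K. M < \<bar>f (\<omega> i)\<bar>) \<le> 2 * exp (- (M\<^sup>2 / 2))"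
proof -
  let ?P = "iid \<mu> K"
  interpret P: prob_space ?P by (intro prob_space_PiM \<mu>)
  have [measurable]: "(\<lambda>\<omega>. f (\<omega> i)) \<in> borel_measurable ?P"
    by (rule measurable_compose[OF measurable_component_singleton[OF K(2)]]) (use f in \<open>simp add: subgaussian_def\<close>)
  have tail: "\<P>(\<omega> in ?P. M \<le> g (\<omega> i)) \<le> exp (- (M\<^sup>2 / 2))" if "subgaussian \<mu> g" for g
    using subgaussian_sum_tail[OF \<mu> that K(1), of "{i}" M M] K M by (simp add: power2_eq_square)
  have "\<P>(\<omega> in ?P. M < \<bar>f (\<omega> i)\<bar>) \<le>
      measure ?P ({\<omega> \<in> space ?P. M \<le> f (\<omega> i)} \<union> {\<omega> \<in> space ?P. M \<le> - f (\<omega> i)})"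
    by (rule P.finite_measure_mono) auto
  also have "\<dots> \<le> \<P>(\<omega> in ?P. M \<le> f (\<omega> i)) + \<P>(\<omega> in ?P. M \<le> - f (\<omega> i))"
    by (rule measure_Un_le) auto
  finally show ?thesis using tail[OF f] tail[OF subgaussian_uminus[OF f]] by linarith
qed

lemma cosh_le_exp_half_square: "(exp t + exp (- t)) / 2 \<le> exp (t\<^sup>2 / 2)" for t :: real
proof -
  have *: "(exp t + exp (- t)) / 2 \<le> exp (t\<^sup>2 / 2)" if t: "0 \<le> t" for t :: real
  proof -
    have p: "0 < 1 + 1 / 2 * (exp (2 * t) - 1)" using exp_gt_zero[of "2 * t"] by (simp add: field_simps add_pos_pos)
    \<comment> \<open>The estimate behind Hoeffding's lemma for a fair variable with values 0 and 2
      t, which is a fair sign times t, shifted by t; the factor exp (- t) below undoes the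
      shift.\<close>
    have "- (2 * t) * (1 / 2) + ln (1 + 1 / 2 * (exp (2 * t) - 1)) \<le> (2 * t)\<^sup>2 / 8"
      by (rule Hoeffdings_lemma_aux) (use t in auto)
    then have "ln (1 + 1 / 2 * (exp (2 * t) - 1)) \<le> t + t\<^sup>2 / 2" by (simp add: power2_eq_square)
    then have "1 + 1 / 2 * (exp (2 * t) - 1) \<le> exp (t + t\<^sup>2 / 2)"
      using p by (metis exp_le_cancel_iff exp_ln)
    then have "exp (- t) * (1 + 1 / 2 * (exp (2 * t) - 1)) \<le> exp (- t) * exp (t + t\<^sup>2 / 2)"
      by (intro mult_left_mono) auto
    also have "exp (- t) * exp (t + t\<^sup>2 / 2) = exp (t\<^sup>2 / 2)" by (simp add: exp_add[symmetric])
    also have "exp (- t) * (1 + 1 / 2 * (exp (2 * t) - 1)) = (exp t + exp (- t)) / 2"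
    proof -
      have "exp (- t) * exp (2 * t) = exp t" by (simp add: exp_add[symmetric])
      then show ?thesis by (simp add: field_simps)
    qed
    finally show ?thesis .
  qed
  show ?thesis using *[of t] *[of "- t"] by (cases "0 \<le> t") (auto simp: add.commute)
qed

lemma DSBS_subgaussian:
  assumes "-1 \<le> \<rho>" "\<rho> \<le> 1"
  shows "subgaussian (DSBS \<rho>) fst" "subgaussian (DSBS \<rho>) snd"
proof -
  note D = DSBS_source[OF assms]
  have "subgaussian (DSBS \<rho>) f"
    if f [measurable]: "f \<in> borel_measurable (DSBS \<rho>)"
      and d: "distr (DSBS \<rho>) borel f = distr (measure_pmf (pmf_of_set {-1, 1})) borel id" for f
  proof -
    have "(\<integral>\<^sup>+x. ennreal (exp (t * f x)) \<partial>DSBS \<rho>) \<le> ennreal (exp (t\<^sup>2 / 2))" for t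
    proof -
      have "(\<integral>\<^sup>+x. ennreal (exp (t * f x)) \<partial>DSBS \<rho>) = (\<integral>\<^sup>+x. ennreal (exp (t * x)) \<partial>distr (DSBS \<rho>) borel f)"
        by (subst nn_integral_distr) auto
      also have "\<dots> = (\<integral>\<^sup>+x. ennreal (exp (t * x)) \<partial>measure_pmf (pmf_of_set {-1, 1}))"
        unfolding d by (subst nn_integral_distr) auto
      also have "\<dots> = ennreal ((exp t + exp (- t)) / 2)"
        by (subst nn_integral_pmf_of_set) (auto simp: ennreal_plus[symmetric] divide_ennreal[symmetric] add.commute simp del: ennreal_plus)
      also have "\<dots> \<le> ennreal (exp (t\<^sup>2 / 2))" by (intro ennreal_leI cosh_le_exp_half_square)
      finally show ?thesis .
    qed
    then show ?thesis by (simp add: subgaussian_def)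
  qed
  then show "subgaussian (DSBS \<rho>) fst" "subgaussian (DSBS \<rho>) snd"
    using D borel_measurable_plane_fst_snd[OF D(2)] by auto
qed

lemma DSBS_fst_nonneg:
  assumes "-1 \<le> \<rho>" "\<rho> \<le> 1"
  shows "\<P>(x in DSBS \<rho>. 0 \<le> fst x) = 1 / 2"
proof -
  note D = DSBS_source[OF assms]
  have "\<P>(x in DSBS \<rho>. 0 \<le> fst x) = measure (distr (DSBS \<rho>) borel fst) {0..}"
    by (subst measure_distr[OF borel_measurable_plane_fst_snd(1)[OF D(2)]])
      (auto intro!: arg_cong[of _ _ "measure (DSBS \<rho>)"])
  also have "\<dots> = measure (measure_pmf (pmf_of_set {-1, 1 :: real})) {0..}"
    unfolding D(3) by (subst measure_distr) auto
  also have "\<dots> = 1 / 2" by (subst measure_pmf_of_set) auto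
  finally show ?thesis .
qed

lemma distributed_std_normal_subgaussian:
  assumes d: "distributed \<mu> lborel f std_normal_density"
  shows "subgaussian \<mu> f"
proof -
  have [measurable]: "f \<in> borel_measurable \<mu>" using distributed_measurable[OF d] by simp
  have "(\<integral>\<^sup>+x. ennreal (exp (t * f x)) \<partial>\<mu>) \<le> ennreal (exp (t\<^sup>2 / 2))" for t
  proof -
    have "(\<integral>\<^sup>+x. ennreal (exp (t * f x)) \<partial>\<mu>) = (\<integral>\<^sup>+x. ennreal (std_normal_density x) * ennreal (exp (t * x)) \<partial>lborel)"
      by (rule distributed_nn_integral[OF d, symmetric]) simp
    also have "\<dots> = (\<integral>\<^sup>+x. ennreal (exp (t\<^sup>2 / 2)) * ennreal (normal_density t 1 x) \<partial>lborel)"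
    proof (rule nn_integral_cong)
      fix x :: real
      have "std_normal_density x * exp (t * x) = exp (t\<^sup>2 / 2) * normal_density t 1 x"
        by (simp add: normal_density_def exp_add[symmetric] power2_eq_square field_simps)
      then show "ennreal (std_normal_density x) * ennreal (exp (t * x)) = ennreal (exp (t\<^sup>2 / 2)) * ennreal (normal_density t 1 x)"
        by (simp add: ennreal_mult[symmetric])
    qed
    also have "\<dots> = ennreal (exp (t\<^sup>2 / 2)) * (\<integral>\<^sup>+x. ennreal (normal_density t 1 x) \<partial>lborel)"
      by (rule nn_integral_cmult) simp
    also have "(\<integral>\<^sup>+x. ennreal (normal_density t 1 x) \<partial>lborel) = 1"
    proof -
      interpret prob_space "density lborel (\<lambda>x. ennreal (normal_density t 1 x))"
        by (rule prob_space_normal_density) simp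
      show ?thesis using emeasure_space_1 by (simp add: emeasure_density)
    qed
    finally show ?thesis by simp
  qed
  then show ?thesis by (simp add: subgaussian_def)
qed

text \<open>By the symmetry between \<open>f\<close> and its negative, and because the value 0 has
  probability 0.\<close>

lemma distributed_std_normal_nonneg:
  assumes "prob_space \<mu>" and d: "distributed \<mu> lborel f std_normal_density"
  shows "\<P>(x in \<mu>. 0 \<le> f x) = 1 / 2"
proof -
  interpret prob_space \<mu> by fact
  have [measurable]: "f \<in> borel_measurable \<mu>" using distributed_measurable[OF d] by simp
  have d': "distributed \<mu> lborel (\<lambda>x. - f x) std_normal_density"
    using normal_density_affine[OF d, of "-1" 0] by simp
  have e: "emeasure \<mu> {x \<in> space \<mu>. g x \<in> A} = (\<integral>\<^sup>+x. ennreal (std_normal_density x) * indicator A x \<partial>lborel)"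
    if "distributed \<mu> lborel g std_normal_density" "A \<in> sets lborel" for g A
    using distributed_emeasure[OF that] by (simp add: vimage_def Int_def conj_commute)
  have "emeasure \<mu> {x \<in> space \<mu>. f x \<in> {0}} = 0"
    by (subst e[OF d]) (auto simp: nn_integral_0_iff_AE intro!: AE_lborel_singleton[THEN AE_mp] AE_I2)
  then have z: "prob {x \<in> space \<mu>. f x = 0} = 0" by (simp add: measure_def)
  have "emeasure \<mu> {x \<in> space \<mu>. f x \<in> {0..}} = emeasure \<mu> {x \<in> space \<mu>. - f x \<in> {0..}}"
    by (simp only: e[OF d] e[OF d'] sets_lborel atLeast_borel)
  then have s: "prob {x \<in> space \<mu>. 0 \<le> f x} = prob {x \<in> space \<mu>. f x \<le> 0}" by (simp add: measure_def)
  have "{x \<in> space \<mu>. f x \<le> 0} = {x \<in> space \<mu>. f x = 0} \<union> {x \<in> space \<mu>. f x < 0}" by auto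
  then have "prob {x \<in> space \<mu>. f x \<le> 0} = prob {x \<in> space \<mu>. f x = 0} + prob {x \<in> space \<mu>. f x < 0}"
    by (simp only:) (rule finite_measure_Union, auto)
  moreover have "{x \<in> space \<mu>. f x < 0} = space \<mu> - {x \<in> space \<mu>. 0 \<le> f x}" by auto
  then have "prob {x \<in> space \<mu>. f x < 0} = 1 - prob {x \<in> space \<mu>. 0 \<le> f x}"
    by (simp only:) (rule prob_compl, simp)
  ultimately show ?thesis using s z by simp
qed

text \<open>Only the interval of length \<sigma> / (\<theta> + 1) right of the threshold is used:
  there x / \<sigma> is at most \<theta> + 1 / (\<theta> + 1), whose square exceeds \<theta>^2 by at
  most 3, so the density is constant up to a factor. The 3 in the denominator bounds sqrt (2
  pi).\<close>

lemma distributed_normal_tail: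
  assumes "prob_space \<mu>" and d: "distributed \<mu> lborel W (normal_density 0 \<sigma>)" and \<sigma>: "0 < \<sigma>" and \<theta>: "0 \<le> \<theta>"
  shows "exp (- (\<theta>\<^sup>2 / 2) - 3 / 2) / (3 * (\<theta> + 1)) \<le> \<P>(x in \<mu>. \<theta> * \<sigma> \<le> W x)"
proof -
  interpret prob_space \<mu> by fact
  define w where "w = \<sigma> / (\<theta> + 1)"
  have w: "0 < w" using \<sigma> \<theta> by (simp add: w_def)
  define D where "D = exp (- (\<theta>\<^sup>2 / 2) - 3 / 2) / (3 * \<sigma>)"
  have D0: "0 \<le> D" using \<sigma> by (simp add: D_def)
  have dens: "D \<le> normal_density 0 \<sigma> x" if x: "\<theta> * \<sigma> \<le> x" "x \<le> \<theta> * \<sigma> + w" for x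
  proof -
    have "x / \<sigma> \<le> \<theta> + 1 / (\<theta> + 1)" using x \<sigma> \<theta> by (simp add: w_def field_simps)
    moreover have "0 \<le> x / \<sigma>" using x \<sigma> \<theta> by (meson divide_nonneg_pos mult_nonneg_nonneg less_imp_le order_trans)
    ultimately have "(x / \<sigma>)\<^sup>2 \<le> (\<theta> + 1 / (\<theta> + 1))\<^sup>2" by (intro power_mono)
    also have "\<dots> = \<theta>\<^sup>2 + 2 * (\<theta> / (\<theta> + 1)) + (1 / (\<theta> + 1))\<^sup>2"
      by (simp add: power2_sum)
    also have "\<dots> \<le> \<theta>\<^sup>2 + 2 * 1 + 1"
      using \<theta> by (intro add_mono mult_left_mono) (auto simp: power_le_one)
    finally have "(x / \<sigma>)\<^sup>2 / 2 \<le> \<theta>\<^sup>2 / 2 + 3 / 2" by simp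
    then have "exp (- (\<theta>\<^sup>2 / 2) - 3 / 2) \<le> exp (- ((x / \<sigma>)\<^sup>2 / 2))" by simp
    moreover have "sqrt (2 * pi * \<sigma>\<^sup>2) \<le> 3 * \<sigma>"
    proof (rule real_le_lsqrt)
      have "2 * pi * \<sigma>\<^sup>2 \<le> 9 * \<sigma>\<^sup>2" using pi_less_4 by (intro mult_right_mono) auto
      then show "2 * pi * \<sigma>\<^sup>2 \<le> (3 * \<sigma>)\<^sup>2" by (simp add: power_mult_distrib)
    qed (use \<sigma> in auto)
    ultimately have "D \<le> exp (- ((x / \<sigma>)\<^sup>2 / 2)) / sqrt (2 * pi * \<sigma>\<^sup>2)"
      unfolding D_def using \<sigma> by (intro frac_le) auto
    also have "\<dots> = normal_density 0 \<sigma> x"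
      by (simp add: normal_density_def power_divide)
    finally show ?thesis .
  qed
  have "ennreal (D * w) = (\<integral>\<^sup>+x. ennreal D * indicator {\<theta> * \<sigma>..\<theta> * \<sigma> + w} x \<partial>lborel)"
    using w D0 by (simp add: nn_integral_cmult_indicator ennreal_mult)
  also have "\<dots> \<le> (\<integral>\<^sup>+x. ennreal (normal_density 0 \<sigma> x) * indicator {\<theta> * \<sigma>..} x \<partial>lborel)"
    by (intro nn_integral_mono) (auto simp: indicator_def intro!: ennreal_leI dens)
  also have "\<dots> = emeasure \<mu> (W -` {\<theta> * \<sigma>..} \<inter> space \<mu>)"
    by (rule distributed_emeasure[OF d, symmetric]) simp
  also have "W -` {\<theta> * \<sigma>..} \<inter> space \<mu> = {x \<in> space \<mu>. \<theta> * \<sigma> \<le> W x}" by auto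
  finally have "D * w \<le> \<P>(x in \<mu>. \<theta> * \<sigma> \<le> W x)"
    by (simp add: emeasure_eq_measure)
  moreover have "D * w = exp (- (\<theta>\<^sup>2 / 2) - 3 / 2) / (3 * (\<theta> + 1))"
    using \<sigma> by (simp add: D_def w_def)
  ultimately show ?thesis by simp
qed

section \<open>The joint tail of the Gaussian source\<close>

lemma indep_vars_PiM_coordinates:
  assumes N: "prob_space N" and K: "finite K" "K \<noteq> {}"
  shows "prob_space.indep_vars (iid N K) (\<lambda>_. N) (\<lambda>i \<omega>. \<omega> i) K"
proof -
  interpret P: prob_space "iid N K" by (intro prob_space_PiM N)
  have "distr (iid N K) (iid N K) (\<lambda>\<omega>. \<lambda>i\<in>K. \<omega> i) = distr (iid N K) (iid N K) (\<lambda>\<omega>. \<omega>)"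
    by (rule distr_cong) (auto simp: space_PiM PiE_iff intro: extensional_restrict)
  also have "\<dots> = iid N K" by (rule distr_id)
  also have "\<dots> = (\<Pi>\<^sub>M i\<in>K. distr (iid N K) N (\<lambda>\<omega>. \<omega> i))"
    using distr_PiM_component[of K "\<lambda>_. N"] N by (intro PiM_cong) auto
  finally show ?thesis
    by (subst P.indep_vars_iff_distr_eq_PiM'[OF K(2)]) auto
qed

text \<open>Bob's sum is \<rho> U + sqrt (1 - \<rho>^2) V with independent normal sums U and V. His
  condition is stated relative to Alice's actual sum rather than to her threshold, so that it is a
  condition on V alone and the probability factors.\<close>

lemma BGS_sum_tail:
  fixes I :: "nat set"
  assumes \<rho>: "-1 < \<rho>" "\<rho> < 1" and I: "finite I" "I \<noteq> {}" and \<theta>: "0 \<le> \<theta>" "0 \<le> \<eta>"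
  defines "n \<equiv> real (card I)"
  shows "exp (- (\<theta>\<^sup>2 / 2) - 3 / 2) / (3 * (\<theta> + 1)) * (exp (- (\<eta>\<^sup>2 / 2) - 3 / 2) / (3 * (\<eta> + 1))) \<le>
    \<P>(\<omega> in iid (BGS \<rho>) I. \<theta> * sqrt n \<le> (\<Sum>i\<in>I. fst (\<omega> i)) \<and> \<rho> * (\<Sum>i\<in>I. fst (\<omega> i)) + sqrt (1 - \<rho>\<^sup>2) * (\<eta> * sqrt n) \<le> (\<Sum>i\<in>I. snd (\<omega> i)))"
proof -
  define r where "r = sqrt (1 - \<rho>\<^sup>2)"
  have "\<rho>\<^sup>2 < 1" using \<rho> by (simp add: abs_square_less_1)
  then have r: "0 < r" by (simp add: r_def)
  define N where "N = density lborel (\<lambda>x. ennreal (std_normal_density x))"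
  have N: "prob_space N" unfolding N_def by (rule prob_space_normal_density) simp
  have sN [measurable_cong]: "sets N = sets borel" by (simp add: N_def)
  \<comment> \<open>Two standard normals per position: \<open>True\<close> indexes Alice's sample,
    \<open>False\<close> the independent noise in Bob's.\<close>
  define K where "K = I \<times> (UNIV :: bool set)"
  have K: "finite K" "K \<noteq> {}" using I by (auto simp: K_def)
  define P where "P = iid N K"
  interpret P: prob_space P unfolding P_def by (intro prob_space_PiM N)
  have ind: "P.indep_vars (\<lambda>_. N) (\<lambda>i \<omega>. \<omega> i) K"
    unfolding P_def by (rule indep_vars_PiM_coordinates[OF N K])
  have comp [measurable]: "(\<lambda>\<omega>. \<omega> j) \<in> P \<rightarrow>\<^sub>M N" if "j \<in> K" for j
    unfolding P_def using that by (rule measurable_component_singleton)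
  have marg: "distr P N (\<lambda>\<omega>. \<omega> j) = N" if "j \<in> K" for j
    unfolding P_def using distr_PiM_component[of K "\<lambda>_. N" j] N that by simp
  define g where "g = (\<lambda>z :: real \<times> real. (fst z, \<rho> * fst z + r * snd z))"
  have g [measurable]: "g \<in> N \<Otimes>\<^sub>M N \<rightarrow>\<^sub>M borel" unfolding g_def by measurable
  define Z where "Z = (\<lambda>(i :: nat) \<omega>. g (\<omega> (i, True), \<omega> (i, False)) :: real \<times> real)"
  have cm: "(\<lambda>f. f j) \<in> iid N J \<rightarrow>\<^sub>M N" if "j \<in> J" for j :: "nat \<times> bool" and J
    using that by (rule measurable_component_singleton)
  have indZ: "P.indep_vars (\<lambda>_. borel) Z I"
  proof -
    have "P.indep_vars (\<lambda>j. iid N ({j} \<times> UNIV)) (\<lambda>j \<omega>. restrict (\<lambda>i. \<omega> i) ({j} \<times> UNIV)) I"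
      by (rule P.indep_vars_restrict[OF ind]) (auto simp: K_def disjoint_family_on_def)
    then have "P.indep_vars (\<lambda>_. borel) (\<lambda>j \<omega>. (\<lambda>f. g (f (j, True), f (j, False))) (restrict (\<lambda>i. \<omega> i) ({j} \<times> UNIV))) I"
    proof (rule P.indep_vars_compose2)
      fix j assume "j \<in> I"
      have "(\<lambda>f. (f (j, True), f (j, False))) \<in> iid N ({j} \<times> UNIV) \<rightarrow>\<^sub>M N \<Otimes>\<^sub>M N"
        by (intro measurable_Pair cm) auto
      then show "(\<lambda>f. g (f (j, True), f (j, False))) \<in> iid N ({j} \<times> UNIV) \<rightarrow>\<^sub>M borel"
        by (rule measurable_compose[OF _ g])
    qed
    then show ?thesis by (simp add: Z_def)
  qed
  have distZ: "distr P borel (Z i) = BGS \<rho>" if i: "i \<in> I" for i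
  proof -
    have K2: "(i, True) \<in> K" "(i, False) \<in> K" using i by (auto simp: K_def)
    have "P.indep_var (Pi\<^sub>M {(i, True)} (\<lambda>_. N)) (\<lambda>\<omega>. restrict (\<lambda>i. \<omega> i) {(i, True)})
        (Pi\<^sub>M {(i, False)} (\<lambda>_. N)) (\<lambda>\<omega>. restrict (\<lambda>i. \<omega> i) {(i, False)})"
      by (rule P.indep_var_restrict[OF ind]) (use K2 in auto)
    then have "P.indep_var N ((\<lambda>f. f (i, True)) \<circ> (\<lambda>\<omega>. restrict (\<lambda>i. \<omega> i) {(i, True)}))
        N ((\<lambda>f. f (i, False)) \<circ> (\<lambda>\<omega>. restrict (\<lambda>i. \<omega> i) {(i, False)}))"
      by (rule P.indep_var_compose) (auto intro: cm)
    then have iv: "P.indep_var N (\<lambda>\<omega>. \<omega> (i, True)) N (\<lambda>\<omega>. \<omega> (i, False))"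
      by (simp add: comp_def)
    then have "N \<Otimes>\<^sub>M N = distr P (N \<Otimes>\<^sub>M N) (\<lambda>\<omega>. (\<omega> (i, True), \<omega> (i, False)))"
      using P.indep_var_distribution_eq[of N "\<lambda>\<omega>. \<omega> (i, True)" N "\<lambda>\<omega>. \<omega> (i, False)"] marg[OF K2(1)] marg[OF K2(2)] by simp
    then have "distr (N \<Otimes>\<^sub>M N) borel g = distr (distr P (N \<Otimes>\<^sub>M N) (\<lambda>\<omega>. (\<omega> (i, True), \<omega> (i, False)))) borel g" by simp
    also have "\<dots> = distr P borel (g \<circ> (\<lambda>\<omega>. (\<omega> (i, True), \<omega> (i, False))))"
      by (rule distr_distr[OF g]) (intro measurable_Pair comp K2)
    also have "\<dots> = distr P borel (Z i)" by (simp add: Z_def comp_def)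
    finally show ?thesis by (simp add: BGS_def N_def g_def r_def case_prod_beta')
  qed
  have mZ [measurable]: "Z i \<in> P \<rightarrow>\<^sub>M borel" if "i \<in> I" for i
    using indZ that by (auto simp: P.indep_vars_def)
  have prodZ: "distr P (Pi\<^sub>M I (\<lambda>_. borel)) (\<lambda>\<omega>. \<lambda>i\<in>I. Z i \<omega>) = iid (BGS \<rho>) I"
    using P.indep_vars_iff_distr_eq_PiM'[OF I(2), where M' = "\<lambda>_. borel" and X = Z] indZ mZ distZ
    by (simp cong: PiM_cong)
  have norm: "distributed P lborel (\<lambda>\<omega>. \<Sum>i\<in>I. \<omega> (i, b)) (normal_density 0 (sqrt n))" for b
  proof -
    have "P.indep_vars (\<lambda>j. Pi\<^sub>M {(j, b)} (\<lambda>_. N)) (\<lambda>j \<omega>. restrict (\<lambda>i. \<omega> i) {(j, b)}) I"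
      by (rule P.indep_vars_restrict[OF ind]) (auto simp: K_def disjoint_family_on_def)
    then have "P.indep_vars (\<lambda>_. borel) (\<lambda>j \<omega>. (\<lambda>f. f (j, b)) (restrict (\<lambda>i. \<omega> i) {(j, b)})) I"
    proof (rule P.indep_vars_compose2)
      fix j :: nat show "(\<lambda>f. f (j, b)) \<in> borel_measurable (Pi\<^sub>M {(j, b)} (\<lambda>_. N))"
        using cm[of "(j, b)" "{(j, b)}"] by (simp add: measurable_cong_sets[OF refl sN])
    qed
    then have i: "P.indep_vars (\<lambda>_. borel) (\<lambda>j \<omega>. \<omega> (j, b)) I" by simp
    have "distributed P lborel (\<lambda>\<omega>. \<omega> (j, b)) std_normal_density" if "j \<in> I" for j
    proof -
      have jK: "(j, b) \<in> K" using that by (simp add: K_def)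
      have "distr P lborel (\<lambda>\<omega>. \<omega> (j, b)) = distr P N (\<lambda>\<omega>. \<omega> (j, b))"
        by (rule distr_cong) (auto simp: sN)
      then have "distr P lborel (\<lambda>\<omega>. \<omega> (j, b)) = density lborel (\<lambda>x. ennreal (std_normal_density x))"
        unfolding marg[OF jK] unfolding N_def .
      moreover have "(\<lambda>\<omega>. \<omega> (j, b)) \<in> P \<rightarrow>\<^sub>M lborel"
        using comp[OF jK] by (simp add: measurable_cong_sets[OF refl sN])
      ultimately show ?thesis by (simp add: distributed_def)
    qed
    then have "distributed P lborel (\<lambda>\<omega>. \<Sum>j\<in>I. \<omega> (j, b)) (normal_density (\<Sum>j\<in>I. 0) (sqrt (\<Sum>j\<in>I. 1\<^sup>2)))"
      by (intro P.sum_indep_normal[OF I i]) auto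
    then show ?thesis by (simp add: n_def)
  qed
  define U V where "U = (\<lambda>\<omega> :: nat \<times> bool \<Rightarrow> real. \<Sum>i\<in>I. \<omega> (i, True))" and "V = (\<lambda>\<omega> :: nat \<times> bool \<Rightarrow> real. \<Sum>i\<in>I. \<omega> (i, False))"
  have ms: "(\<lambda>f. \<Sum>i\<in>I. f (i, b)) \<in> borel_measurable (iid N (I \<times> {b}))" for b
    by (rule borel_measurable_sum) (use cm in \<open>auto simp: measurable_cong_sets[OF refl sN, symmetric]\<close>)
  have iUV: "P.indep_var borel U borel V"
  proof -
    have "P.indep_var (iid N (I \<times> {True})) (\<lambda>\<omega>. restrict (\<lambda>i. \<omega> i) (I \<times> {True}))
        (iid N (I \<times> {False})) (\<lambda>\<omega>. restrict (\<lambda>i. \<omega> i) (I \<times> {False}))"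
      by (rule P.indep_var_restrict[OF ind]) (auto simp: K_def)
    then have "P.indep_var borel ((\<lambda>f. \<Sum>i\<in>I. f (i, True)) \<circ> (\<lambda>\<omega>. restrict (\<lambda>i. \<omega> i) (I \<times> {True})))
        borel ((\<lambda>f. \<Sum>i\<in>I. f (i, False)) \<circ> (\<lambda>\<omega>. restrict (\<lambda>i. \<omega> i) (I \<times> {False})))"
      by (rule P.indep_var_compose) (rule ms)+
    then show ?thesis by (simp add: comp_def U_def V_def)
  qed
  have n: "0 < sqrt n" using I by (simp add: n_def card_gt_0_iff)
  have "exp (- (\<theta>\<^sup>2 / 2) - 3 / 2) / (3 * (\<theta> + 1)) * (exp (- (\<eta>\<^sup>2 / 2) - 3 / 2) / (3 * (\<eta> + 1))) \<le>
      \<P>(\<omega> in P. \<theta> * sqrt n \<le> U \<omega>) * \<P>(\<omega> in P. \<eta> * sqrt n \<le> V \<omega>)"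
    unfolding U_def V_def
    by (intro mult_mono distributed_normal_tail[OF P.prob_space_axioms norm n]) (use \<theta> in auto)
  also have "\<dots> = \<P>(\<omega> in P. \<theta> * sqrt n \<le> U \<omega> \<and> \<eta> * sqrt n \<le> V \<omega>)"
  proof -
    have "P.prob ((\<lambda>x. (U x, V x)) -` ({\<theta> * sqrt n..} \<times> {\<eta> * sqrt n..}) \<inter> space P) =
        P.prob (U -` {\<theta> * sqrt n..} \<inter> space P) * P.prob (V -` {\<eta> * sqrt n..} \<inter> space P)"
      by (rule P.indep_varD[OF iUV]) auto
    then show ?thesis by (simp add: vimage_def Int_def conj_commute)
  qed
  also have "\<dots> \<le> \<P>(\<omega> in iid (BGS \<rho>) I. \<theta> * sqrt n \<le> (\<Sum>i\<in>I. fst (\<omega> i)) \<and> \<rho> * (\<Sum>i\<in>I. fst (\<omega> i)) + r * (\<eta> * sqrt n) \<le> (\<Sum>i\<in>I. snd (\<omega> i)))"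
    (is "_ \<le> measure _ ?E")
  proof -
    have sB: "sets (BGS \<rho>) = sets borel" using BGS_source(2) \<rho> by simp
    have mS: "(\<lambda>\<omega>. \<Sum>i\<in>I. fst (\<omega> i)) \<in> borel_measurable (iid (BGS \<rho>) I)"
       "(\<lambda>\<omega>. \<Sum>i\<in>I. snd (\<omega> i)) \<in> borel_measurable (iid (BGS \<rho>) I)"
      by (rule borel_measurable_sum, rule borel_measurable_PiM_fst_snd[OF sB], assumption)+
    have E: "?E \<in> sets (iid (BGS \<rho>) I)"
      by (intro sets.sets_Collect_conj borel_measurable_le borel_measurable_const borel_measurable_add
          borel_measurable_times mS)
    have sP: "sets (iid (BGS \<rho>) I) = sets (Pi\<^sub>M I (\<lambda>_. borel))" using sB by (intro sets_PiM_cong) auto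
    have mm: "(\<lambda>\<omega>. \<lambda>i\<in>I. Z i \<omega>) \<in> P \<rightarrow>\<^sub>M Pi\<^sub>M I (\<lambda>_. borel)"
      by (rule measurable_restrict) (rule mZ)
    have "measure (iid (BGS \<rho>) I) ?E = P.prob ((\<lambda>\<omega>. \<lambda>i\<in>I. Z i \<omega>) -` ?E \<inter> space P)"
      unfolding prodZ[symmetric] by (rule measure_distr[OF mm]) (use E sP prodZ in simp)
    moreover have "{\<omega> \<in> space P. \<theta> * sqrt n \<le> U \<omega> \<and> \<eta> * sqrt n \<le> V \<omega>} \<subseteq> (\<lambda>\<omega>. \<lambda>i\<in>I. Z i \<omega>) -` ?E \<inter> space P"
    proof (rule subsetI)
      fix \<omega> assume "\<omega> \<in> {\<omega> \<in> space P. \<theta> * sqrt n \<le> U \<omega> \<and> \<eta> * sqrt n \<le> V \<omega>}"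
      then have w: "\<omega> \<in> space P" "\<theta> * sqrt n \<le> U \<omega>" "\<eta> * sqrt n \<le> V \<omega>" by auto
      have s: "(\<lambda>i\<in>I. Z i \<omega>) \<in> space (iid (BGS \<rho>) I)"
        using measurable_space[OF mm w(1)] sets_eq_imp_space_eq[OF sP] by simp
      have "(\<Sum>i\<in>I. fst ((\<lambda>i\<in>I. Z i \<omega>) i)) = U \<omega>" by (simp add: Z_def g_def U_def)
      moreover have "(\<Sum>i\<in>I. snd ((\<lambda>i\<in>I. Z i \<omega>) i)) = \<rho> * U \<omega> + r * V \<omega>"
        by (simp add: Z_def g_def U_def V_def sum.distrib sum_distrib_left)
      moreover have "r * (\<eta> * sqrt n) \<le> r * V \<omega>" using r w by (intro mult_left_mono) auto
      ultimately show "\<omega> \<in> (\<lambda>\<omega>. \<lambda>i\<in>I. Z i \<omega>) -` ?E \<inter> space P" using w s by simp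
    qed
    then have "\<P>(\<omega> in P. \<theta> * sqrt n \<le> U \<omega> \<and> \<eta> * sqrt n \<le> V \<omega>) \<le> P.prob ((\<lambda>\<omega>. \<lambda>i\<in>I. Z i \<omega>) -` ?E \<inter> space P)"
      by (rule P.finite_measure_mono) (rule measurable_sets[OF mm], use E sP in simp)
    ultimately show ?thesis by simp
  qed
  finally show ?thesis by (simp add: r_def)
qed

text \<open>Used to show that truncating the samples costs at most half of the main term. With x =
  sqrt n at least 20 H, one half of the exponent x / 2 pays for 2 H + 3; the other half pays for 648
  n^2 = 4 n * 162 n through (x / 24)^6 \<le> exp (x / 4). Here 191102976 = 24^6, and the constant
  200000000000 exceeds 648 * 24^6.\<close>

lemma exp_sqrt_dominates:
  fixes H n :: real
  assumes H: "1 \<le> H" and n: "200000000000 * H ^ 6 \<le> n"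
  shows "4 * n * exp (- (sqrt n / 2)) \<le> exp (- (2 * H) - 3) / (162 * n)" "H\<^sup>2 \<le> n"
proof -
  have H6: "H\<^sup>2 \<le> H ^ 6" "1 \<le> H ^ 6"
    using H power_increasing[of 2 6 H] one_le_power[of H 6] by auto
  have n0: "200000000000 \<le> n" using n H6 by linarith
  show "H\<^sup>2 \<le> n" using n H6 by linarith
  have n400: "400 * H\<^sup>2 \<le> n" using n H6 by linarith
  define x where "x = sqrt n"
  have x: "0 \<le> x" "x\<^sup>2 = n" using n0 by (auto simp: x_def)
  have "20 * H \<le> x" unfolding x_def by (rule real_le_rsqrt) (use n400 in \<open>simp add: power_mult_distrib\<close>)
  then have e1: "exp (2 * H + 3) \<le> exp (x / 4)" using H by simp
  have "x / 24 \<le> exp (x / 24)" using exp_ge_add_one_self[of "x / 24"] by linarith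
  then have "(x / 24) ^ 6 \<le> exp (x / 24) ^ 6" using x by (intro power_mono) auto
  also have "\<dots> = exp (x / 4)" by (simp add: exp_of_nat_mult[symmetric])
  also have "(x / 24) ^ 6 = n ^ 3 / 191102976"
    unfolding x(2)[symmetric] by (simp add: power_divide power_mult[symmetric])
  finally have "n ^ 3 / 191102976 \<le> exp (x / 4)" .
  moreover have "648 * n\<^sup>2 \<le> n ^ 3 / 191102976"
  proof -
    have "n\<^sup>2 * (648 * 191102976) \<le> n\<^sup>2 * n" using n0 by (intro mult_left_mono) auto
    then show ?thesis by (simp add: power2_eq_square power3_eq_cube)
  qed
  ultimately have e2: "648 * n\<^sup>2 \<le> exp (x / 4)" by linarith
  have "exp (2 * H + 3) * (648 * n\<^sup>2) \<le> exp (x / 4) * exp (x / 4)"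
    using n0 by (intro mult_mono e1 e2) auto
  also have "\<dots> = exp (x / 2)" by (simp add: exp_add[symmetric])
  finally have "exp (2 * H + 3) * (648 * n\<^sup>2) \<le> exp (x / 2)" .
  then have "exp (- (2 * H) - 3) * (exp (2 * H + 3) * (648 * n\<^sup>2)) \<le> exp (- (2 * H) - 3) * exp (x / 2)"
    by (intro mult_left_mono) auto
  moreover have "exp (- (2 * H) - 3) * exp (2 * H + 3) = 1" by (simp add: exp_add[symmetric])
  moreover define E where "E = exp (- (2 * H) - 3)"
  moreover define X where "X = exp (x / 2)"
  ultimately have le: "648 * n\<^sup>2 \<le> E * X" by (simp add: mult.assoc[symmetric])
  have eq: "exp (- (x / 2)) = 1 / X" by (simp add: X_def exp_minus inverse_eq_divide)
  have X: "0 < X" by (simp add: X_def)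
  show "4 * n * exp (- (sqrt n / 2)) \<le> exp (- (2 * H) - 3) / (162 * n)"
    unfolding x_def[symmetric] E_def[symmetric] eq using n0 X le by (simp add: field_simps power2_eq_square)
qed

text \<open>The event of \<open>BGS_sum_tail\<close> lies in the joint tail event or has some sample
  above \<open>M\<close>. The former has probability at least exp (- (1 + \<delta>^2) H - 3) / (81
  n); a union bound over the large samples takes away at most half of that, which leaves 162 in the
  denominator.\<close>

lemma BGS_joint_tail_prob_ge:
  fixes \<rho> \<delta> \<phi> H :: real and I :: "nat set"
  assumes \<rho>: "0 < \<rho>" "\<rho> < 1" and \<delta>: "0 \<le> \<delta>" "\<delta> \<le> sqrt ((1 - \<rho>) / (1 + \<rho>))"
    and \<phi>: "\<phi> = \<rho> + \<delta> * sqrt (1 - \<rho>\<^sup>2)"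
    and H: "1 \<le> H" and I: "finite I" "200000000000 * H ^ 6 \<le> real (card I)" "I \<noteq> {}"
  shows "exp (- ((1 + \<delta>\<^sup>2) * H) - 3) / (162 * real (card I)) \<le>
    joint_tail_prob (BGS \<rho>) \<phi> H I"
proof -
  define n where "n = real (card I)"
  define P where "P = iid (BGS \<rho>) I"
  define r where "r = sqrt (1 - \<rho>\<^sup>2)"
  define s where "s = sqrt (2 * H * n)"
  define M where "M = sqrt (sqrt n)"
  define \<theta> where "\<theta> = sqrt (2 * H)"
  have r0: "0 < r" using correlation_gap_bounds(1)[OF \<rho> \<delta>] by (simp add: r_def)
  have d1: "\<delta> \<le> 1" by (rule correlation_gap_bounds(3)[OF \<rho> \<delta>])
  have B: "prob_space (BGS \<rho>)" "sets (BGS \<rho>) = sets borel"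
    and D: "distributed (BGS \<rho>) lborel fst std_normal_density" "distributed (BGS \<rho>) lborel snd std_normal_density"
    using BGS_source[of \<rho>] \<rho> by auto
  interpret P: prob_space P unfolding P_def by (intro prob_space_PiM B)
  have n: "0 < n" using I by (simp add: n_def card_gt_0_iff)
  have s: "s = \<theta> * sqrt n" by (simp add: s_def \<theta>_def real_sqrt_mult)
  have th: "0 \<le> \<theta>" "\<theta>\<^sup>2 = 2 * H" using H by (auto simp: \<theta>_def)
  have M: "0 \<le> M" "M\<^sup>2 = sqrt n" using n by (auto simp: M_def)
  note mf = borel_measurable_PiM_fst_snd[OF B(2), of _ I, folded P_def]
  have mS: "(\<lambda>\<omega>. \<Sum>i\<in>I. fst (\<omega> i)) \<in> borel_measurable P" "(\<lambda>\<omega>. \<Sum>i\<in>I. snd (\<omega> i)) \<in> borel_measurable P"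
    by (rule borel_measurable_sum, rule mf, assumption)+
  define A where "A = {\<omega> \<in> space P. s \<le> (\<Sum>i\<in>I. fst (\<omega> i)) \<and>
      \<rho> * (\<Sum>i\<in>I. fst (\<omega> i)) + r * (\<delta> * s) \<le> (\<Sum>i\<in>I. snd (\<omega> i))}"
  define E where "E = {\<omega> \<in> space P. joint_tail_event s (\<phi> * s) M I \<omega>}"
  define F1 F2 where "F1 = (\<lambda>i. {\<omega> \<in> space P. M < \<bar>fst (\<omega> i)\<bar>})" and "F2 = (\<lambda>i. {\<omega> \<in> space P. M < \<bar>snd (\<omega> i)\<bar>})"
  have F: "F1 i \<in> sets P" "F2 i \<in> sets P" if "i \<in> I" for i
    unfolding F1_def F2_def using mf[OF that] by (auto intro!: borel_measurable_less borel_measurable_abs)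
  have E: "E \<in> sets P" unfolding E_def P_def by (rule sets_joint_tail_event[OF B(2) I(1)]) simp
  have sub: "A \<subseteq> E \<union> (\<Union>i\<in>I. F1 i \<union> F2 i)"
  proof
    fix \<omega> assume w: "\<omega> \<in> A"
    have "\<rho> * s \<le> \<rho> * (\<Sum>i\<in>I. fst (\<omega> i))" using w \<rho> by (intro mult_left_mono) (auto simp: A_def)
    then have "\<phi> * s \<le> (\<Sum>i\<in>I. snd (\<omega> i))" using w by (auto simp: A_def \<phi> r_def algebra_simps)
    then show "\<omega> \<in> E \<union> (\<Union>i\<in>I. F1 i \<union> F2 i)"
      using w by (auto simp: A_def E_def F1_def F2_def joint_tail_event_def not_less)
  qed
  have "P.prob A \<le> P.prob (E \<union> (\<Union>i\<in>I. F1 i \<union> F2 i))"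
    using I(1) F E by (intro P.finite_measure_mono sub) auto
  also have "\<dots> \<le> P.prob E + P.prob (\<Union>i\<in>I. F1 i \<union> F2 i)"
    using I(1) F E by (intro measure_Un_le) auto
  also have "P.prob (\<Union>i\<in>I. F1 i \<union> F2 i) \<le> (\<Sum>i\<in>I. P.prob (F1 i \<union> F2 i))"
    using I(1) F by (intro measure_UNION_le) auto
  also have "\<dots> \<le> (\<Sum>i\<in>I. 4 * exp (- (sqrt n / 2)))"
  proof (rule sum_mono)
    fix i assume i: "i \<in> I"
    have "P.prob (F1 i \<union> F2 i) \<le> P.prob (F1 i) + P.prob (F2 i)" using F[OF i] by (rule measure_Un_le)
    moreover have "P.prob (F1 i) \<le> 2 * exp (- (sqrt n / 2))"
      unfolding F1_def P_def using subgaussian_coordinate_tail[OF B(1) distributed_std_normal_subgaussian[OF D(1)] I(1) i M(1)] M(2) by simp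
    moreover have "P.prob (F2 i) \<le> 2 * exp (- (sqrt n / 2))"
      unfolding F2_def P_def using subgaussian_coordinate_tail[OF B(1) distributed_std_normal_subgaussian[OF D(2)] I(1) i M(1)] M(2) by simp
    ultimately show "P.prob (F1 i \<union> F2 i) \<le> 4 * exp (- (sqrt n / 2))" by linarith
  qed
  also have "\<dots> = 4 * n * exp (- (sqrt n / 2))" by (simp add: n_def)
  also have "\<dots> \<le> exp (- (2 * H) - 3) / (162 * n)"
    by (rule exp_sqrt_dominates[OF H]) (use I in \<open>simp add: n_def\<close>)
  also have "\<dots> \<le> exp (- ((1 + \<delta>\<^sup>2) * H) - 3) / (162 * n)"
  proof -
    have "\<delta>\<^sup>2 * H \<le> 1 * H" using d1 \<delta> H by (intro mult_right_mono) (auto simp: power_le_one)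
    then show ?thesis using n by (intro divide_right_mono) (auto simp: algebra_simps)
  qed
  finally have up: "P.prob A \<le> P.prob E + exp (- ((1 + \<delta>\<^sup>2) * H) - 3) / (162 * n)" by simp
  \<comment> \<open>Bob's surplus (\<phi> - \<rho>) s equals sqrt (1 - \<rho>^2) times \<delta>
    \<theta> sqrt n, so the second parameter is \<delta> \<theta>.\<close>
  have "exp (- (\<theta>\<^sup>2 / 2) - 3 / 2) / (3 * (\<theta> + 1)) * (exp (- ((\<delta> * \<theta>)\<^sup>2 / 2) - 3 / 2) / (3 * (\<delta> * \<theta> + 1))) \<le> P.prob A"
    using BGS_sum_tail[OF _ \<rho>(2) I(1,3) th(1), of "\<delta> * \<theta>"] \<rho> \<delta> th(1)
    unfolding A_def s P_def n_def r_def by (simp add: mult.assoc)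
  moreover have "exp (- ((1 + \<delta>\<^sup>2) * H) - 3) / (81 * n) \<le>
      exp (- (\<theta>\<^sup>2 / 2) - 3 / 2) / (3 * (\<theta> + 1)) * (exp (- ((\<delta> * \<theta>)\<^sup>2 / 2) - 3 / 2) / (3 * (\<delta> * \<theta> + 1)))"
  proof -
    have "\<theta> \<le> 2 * H" unfolding \<theta>_def by (rule real_le_lsqrt) (use H in \<open>auto simp: power2_eq_square\<close>)
    then have 1: "\<theta> + 1 \<le> 3 * H" using H by linarith
    have "\<delta> * \<theta> \<le> 1 * \<theta>" using d1 th by (intro mult_right_mono) auto
    then have 2: "\<delta> * \<theta> + 1 \<le> 3 * H" using 1 by linarith
    have "3 * (\<theta> + 1) * (3 * (\<delta> * \<theta> + 1)) \<le> 3 * (3 * H) * (3 * (3 * H))"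
      using th \<delta> H 1 2 by (intro mult_mono) auto
    also have "\<dots> = 81 * H\<^sup>2" by (simp add: power2_eq_square)
    also have "\<dots> \<le> 81 * n" using exp_sqrt_dominates(2)[OF H, of n] I by (simp add: n_def)
    finally have 3: "3 * (\<theta> + 1) * (3 * (\<delta> * \<theta> + 1)) \<le> 81 * n" .
    have "exp (- ((1 + \<delta>\<^sup>2) * H) - 3) / (81 * n) \<le> exp (- ((1 + \<delta>\<^sup>2) * H) - 3) / (3 * (\<theta> + 1) * (3 * (\<delta> * \<theta> + 1)))"
      using 3 th \<delta> n by (intro divide_left_mono mult_pos_pos) (auto intro: add_nonneg_pos)
    moreover have "exp (- ((1 + \<delta>\<^sup>2) * H) - 3) = exp (- (\<theta>\<^sup>2 / 2) - 3 / 2) * exp (- ((\<delta> * \<theta>)\<^sup>2 / 2) - 3 / 2)"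
      unfolding exp_add[symmetric] power_mult_distrib th(2) by (simp add: algebra_simps)
    ultimately show ?thesis by (simp only: times_divide_times_eq)
  qed
  moreover have "exp (- ((1 + \<delta>\<^sup>2) * H) - 3) / (81 * n) = 2 * (exp (- ((1 + \<delta>\<^sup>2) * H) - 3) / (162 * n))" by simp
  ultimately have "exp (- ((1 + \<delta>\<^sup>2) * H) - 3) / (162 * n) \<le> P.prob E" using up by linarith
  then show ?thesis by (simp add: E_def P_def n_def s_def M_def)
qed

lemma BGS_joint_tail:
  fixes \<rho> \<delta> \<phi> :: real
  assumes "0 < \<rho>" "\<rho> < 1" "0 \<le> \<delta>" "\<delta> \<le> sqrt ((1 - \<rho>) / (1 + \<rho>))" "\<phi> = \<rho> + \<delta> * sqrt (1 - \<rho>\<^sup>2)"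
  shows "joint_tail_bound (BGS \<rho>) \<delta> \<phi>"
proof -
  define b where "b = nat \<lceil>162 * exp (3::real)\<rceil>"
  have b: "162 * exp 3 \<le> real b" unfolding b_def by linarith
  have b0: "0 < real b" using b exp_gt_zero[of "3::real"] by linarith
  have "exp (- ((1 + \<delta>\<^sup>2) * H)) / (real b * real (card I) ^ 1) \<le>
     joint_tail_prob (BGS \<rho>) \<phi> H I"
    if H: "1 \<le> H" and I: "finite I" "real 200000000000 * H ^ 6 \<le> real (card I)" "I \<noteq> {}" for H and I :: "nat set"
  proof -
    have n1: "0 < real (card I)" using I by (simp add: card_gt_0_iff)
    have "162 * exp 3 * real (card I) \<le> real b * real (card I)" using b n1 by (intro mult_right_mono) auto
    then have "exp (- ((1 + \<delta>\<^sup>2) * H)) / (real b * real (card I)) \<le> exp (- ((1 + \<delta>\<^sup>2) * H)) / (162 * exp 3 * real (card I))"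
      using b0 n1 by (intro divide_left_mono mult_pos_pos) auto
    also have "\<dots> = exp (- ((1 + \<delta>\<^sup>2) * H) - 3) / (162 * real (card I))"
      by (simp add: exp_diff)
    also have "\<dots> \<le> joint_tail_prob (BGS \<rho>) \<phi> H I"
      by (rule BGS_joint_tail_prob_ge[OF assms H I(1)]) (use I in auto)
    finally show ?thesis by simp
  qed
  then show ?thesis unfolding joint_tail_bound_def using b0
    by (intro exI[of _ 200000000000] exI[of _ b] exI[of _ 1]) auto
qed

section \<open>The scheme\<close>

definition least_prime_above :: "nat \<Rightarrow> nat" where
  "least_prime_above N = (LEAST p. prime p \<and> N < p)"

lemma least_prime_above:
  assumes "4 \<le> N"
  shows "prime (least_prime_above N)" "N < least_prime_above N" "least_prime_above N \<le> 2 * N ^ 3"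
proof -
  obtain p where p: "prime p" "N < p" "p \<le> 2 * N ^ 3" using prime_between_cube[OF assms] by blast
  show "prime (least_prime_above N)" "N < least_prime_above N"
    using LeastI[of "\<lambda>p. prime p \<and> N < p" p] p unfolding least_prime_above_def by blast+
  show "least_prime_above N \<le> 2 * N ^ 3"
    using Least_le[of "\<lambda>p. prime p \<and> N < p" p] p unfolding least_prime_above_def by linarith
qed

text \<open>Elementary functions know no unbounded search; the cubic bound on the next prime turns
  the search into a bounded sum with a single nonzero term.\<close>

lemma least_prime_above_eq_sum:
  assumes "4 \<le> N"
  shows "(\<Sum>m<2 * N ^ 3 + 1. m * of_bool (prime m \<and> N < m \<and> (\<forall>q<m. \<not> (prime q \<and> N < q)))) = least_prime_above N"
proof -
  let ?p = "least_prime_above N"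
  note p = least_prime_above[OF assms]
  have "(prime m \<and> N < m \<and> (\<forall>q<m. \<not> (prime q \<and> N < q))) \<longleftrightarrow> m = ?p" for m
  proof
    assume m: "prime m \<and> N < m \<and> (\<forall>q<m. \<not> (prime q \<and> N < q))"
    then have "?p \<le> m" unfolding least_prime_above_def by (intro Least_le) blast
    then show "m = ?p" using m p by (cases "?p < m") auto
  next
    assume "m = ?p"
    then show "prime m \<and> N < m \<and> (\<forall>q<m. \<not> (prime q \<and> N < q))"
      using p not_less_Least[of _ "\<lambda>p. prime p \<and> N < p"] unfolding least_prime_above_def by blast
  qed
  then have "(\<Sum>m<2 * N ^ 3 + 1. m * of_bool (prime m \<and> N < m \<and> (\<forall>q<m. \<not> (prime q \<and> N < q)))) =
      (\<Sum>m<2 * N ^ 3 + 1. if m = ?p then m else 0)"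
    by (intro sum.cong) auto
  also have "\<dots> = ?p" using p(3) by (simp add: sum.delta)
  finally show ?thesis .
qed

lemma elem_nat_least_prime_above:
  assumes "elem_nat A N" "\<And>xs. 4 \<le> N xs"
  shows "elem_nat A (\<lambda>xs. least_prime_above (N xs))"
proof -
  note N = assms(1) elementary_tl[OF assms(1)] elementary_tl[OF elementary_tl[OF assms(1)]]
  have "elem_nat A (\<lambda>xs. \<Sum>m<2 * N xs ^ 3 + 1. m * of_bool (prime m \<and> N xs < m \<and> (\<forall>q<m. \<not> (prime q \<and> N xs < q))))"
    by (intro elem_intros elem_nat_of_bool elem_bool_prime N elementary_tl[OF elementary_hdnat])
  then show ?thesis unfolding least_prime_above_eq_sum[OF assms(2)] .
qed

definition score :: "nat \<Rightarrow> nat \<Rightarrow> (nat \<Rightarrow> real) \<Rightarrow> nat \<Rightarrow> real" where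
  "score k p x c = (\<Sum>a<p. x (codeval k p c a))"

text \<open>Uniqueness is tested within every single bit, so no codeword has to be selected and a
  bit is a bounded formula. Positions from p^2 on lie outside all codeword supports. Bits are
  counted from the lowest, so a prefix of the key consists of the low-order bits of the
  codeword.\<close>

definition alice_bit :: "nat \<Rightarrow> nat \<Rightarrow> real \<Rightarrow> (nat \<Rightarrow> real) \<Rightarrow> nat \<Rightarrow> bool" where
  "alice_bit k p s x l \<longleftrightarrow>
     (\<exists>c<2 ^ k. s \<le> score k p x c \<and> (\<forall>d<2 ^ k. s \<le> score k p x d \<longrightarrow> d = c) \<and> c div 2 ^ l mod 2 = 1) \<or>
     (\<not> (\<exists>c<2 ^ k. s \<le> score k p x c \<and> (\<forall>d<2 ^ k. s \<le> score k p x d \<longrightarrow> d = c)) \<and> 0 \<le> x (p ^ 2 + l))"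

text \<open>The disjunction over all candidates, bit by bit, which is the right codeword when only
  one candidate is left. \<open>w\<close> is real-valued because the formulas receive the message as
  real numbers.\<close>

definition bob_bit :: "nat \<Rightarrow> nat \<Rightarrow> real \<Rightarrow> nat \<Rightarrow> (nat \<Rightarrow> real) \<Rightarrow> (nat \<Rightarrow> real) \<Rightarrow> nat \<Rightarrow> bool" where
  "bob_bit k p u m y w l \<longleftrightarrow>
     (\<exists>c<2 ^ k. (\<forall>t<m. real (c div 2 ^ t mod 2) = w t) \<and> u \<le> score k p y c \<and> c div 2 ^ l mod 2 = 1)"

definition threshold_scheme :: "nat \<Rightarrow> nat \<Rightarrow> real \<Rightarrow> real \<Rightarrow> nat \<Rightarrow> cr_scheme" where
  "threshold_scheme k p s u m = \<lparr>num_samples = p ^ 2 + k, msg_len = m,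
     alice_msg = (\<lambda>x. map (alice_bit k p s x) [0..<m]),
     alice_key = (\<lambda>x. map (alice_bit k p s x) [0..<k]),
     bob_key = (\<lambda>y w. map (bob_bit k p u m y (\<lambda>t. of_bool (w ! t))) [0..<k])\<rparr>"

lemma threshold_scheme_simps [simp]:
  "num_samples (threshold_scheme k p s u m) = p ^ 2 + k"
  "msg_len (threshold_scheme k p s u m) = m"
  "alice_msg (threshold_scheme k p s u m) x = map (alice_bit k p s x) [0..<m]"
  "alice_key (threshold_scheme k p s u m) x = map (alice_bit k p s x) [0..<k]"
  "bob_key (threshold_scheme k p s u m) y w = map (bob_bit k p u m y (\<lambda>t. of_bool (w ! t))) [0..<k]"
  by (simp_all add: threshold_scheme_def)

section \<open>Measurability of the scheme\<close>

lemma measurable_map_bits: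
  assumes "\<And>l. l < j \<Longrightarrow> Measurable.pred M (\<lambda>x. P x l)"
  shows "(\<lambda>x. map (P x) [0..<j]) \<in> M \<rightarrow>\<^sub>M count_space {K. length K = j}"
proof -
  have fin: "finite {K :: bool list. length K = j}"
    using finite_lists_length_eq[of "UNIV :: bool set" j] by simp
  show ?thesis
  proof (subst measurable_count_space_eq2[OF fin], intro conjI ballI)
    show "(\<lambda>x. map (P x) [0..<j]) \<in> space M \<rightarrow> {K. length K = j}" by simp
    fix K :: "bool list" assume K: "K \<in> {K. length K = j}"
    have "map (P x) [0..<j] = K \<longleftrightarrow> (\<forall>l\<in>{..<j}. P x l = K ! l)" for x
      using K by (simp add: list_eq_iff_nth_eq[of "map (P x) [0..<j]"] Ball_def)
    then have "(\<lambda>x. map (P x) [0..<j]) -` {K} \<inter> space M = {x \<in> space M. \<forall>l\<in>{..<j}. P x l = K ! l}"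
      by blast
    also have "\<dots> \<in> sets M"
    proof (rule sets.sets_Collect_finite_All)
      fix l assume "l \<in> {..<j}"
      then have [measurable]: "Measurable.pred M (\<lambda>x. P x l)" using assms by simp
      show "{x \<in> space M. P x l = K ! l} \<in> sets M" by (cases "K ! l") simp_all
    qed simp
    finally show "(\<lambda>x. map (P x) [0..<j]) -` {K} \<inter> space M \<in> sets M" .
  qed
qed

lemma borel_measurable_score:
  "(\<lambda>x. score k p x c) \<in> borel_measurable (Pi\<^sub>M {..<p ^ 2 + k} (\<lambda>_. borel))"
  unfolding score_def
proof (rule borel_measurable_sum)
  fix a assume "a \<in> {..<p}"
  then have "codeval k p c a \<in> {..<p ^ 2 + k}" using codeval_less[of a p k c] by simp
  then show "(\<lambda>x. x (codeval k p c a)) \<in> borel_measurable (Pi\<^sub>M {..<p ^ 2 + k} (\<lambda>_. borel))"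
    by (rule measurable_component_singleton)
qed

lemma measurable_alice_bit:
  assumes "l < k"
  shows "Measurable.pred (Pi\<^sub>M {..<p ^ 2 + k} (\<lambda>_. borel)) (\<lambda>x. alice_bit k p s x l)"
proof -
  note [measurable] = borel_measurable_score
  have [measurable]: "(\<lambda>x. x (p ^ 2 + l)) \<in> borel_measurable (Pi\<^sub>M {..<p ^ 2 + k} (\<lambda>_. borel))"
    by (rule measurable_component_singleton) (use assms in simp)
  show ?thesis unfolding alice_bit_def by measurable
qed

lemma measurable_bob_bit:
  "Measurable.pred (Pi\<^sub>M {..<p ^ 2 + k} (\<lambda>_. borel)) (\<lambda>y. bob_bit k p u m y w l)"
proof -
  note [measurable] = borel_measurable_score
  show ?thesis unfolding bob_bit_def by measurable
qed

lemma one_way_threshold_scheme: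
  assumes "m \<le> k"
  shows "one_way_scheme k (threshold_scheme k p s u m)"
  unfolding one_way_scheme_def threshold_scheme_simps
  using assms by (intro conjI allI impI measurable_map_bits measurable_alice_bit measurable_bob_bit) auto

section \<open>The scheme as a family of elementary formulas\<close>

lemma elementary_score:
  assumes "elem_nat A k" "elem_nat A p" "elem_nat A c" "data_env D"
  shows "elementary A (\<lambda>xs. score (k xs) (p xs) (nth0 (D xs)) (c xs))"
proof -
  note t1 = assms(1-3)[THEN elementary_tl] and t2 = assms(1-3)[THEN elementary_tl, THEN elementary_tl]
  show ?thesis unfolding score_def codeval_def
    by (intro elementary_sum elementary_nth0 data_env_tl elem_intros assms t1 t2 elementary_tl[OF elementary_hdnat])
qed

lemma elem_bool_alice_bit:
  assumes "elem_nat A k" "elem_nat A p" "elem_nat A l" "elementary A s" "data_env D"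
  shows "elem_bool A (\<lambda>xs. alice_bit (k xs) (p xs) (s xs) (nth0 (D xs)) (l xs))"
proof -
  note t1 = assms(1-4)[THEN elementary_tl] and t2 = assms(1-4)[THEN elementary_tl, THEN elementary_tl]
  show ?thesis unfolding alice_bit_def
    by (intro elem_intros elementary_score elementary_nth0 data_env_tl assms t1 t2 elementary_tl[OF elementary_hdnat]
        elementary_zero)
qed

lemma elem_bool_bob_bit:
  assumes "elem_nat A k" "elem_nat A p" "elem_nat A l" "elementary A u" "elem_nat A m" "data_env D"
  shows "elem_bool A (\<lambda>xs. bob_bit (k xs) (p xs) (u xs) (m xs) (nth0 (D xs))
    (\<lambda>t. nth0 (D xs) (p xs ^ 2 + k xs + t)) (l xs))"
proof -
  note t1 = assms(1-5)[THEN elementary_tl] and t2 = assms(1-5)[THEN elementary_tl, THEN elementary_tl]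
  show ?thesis unfolding bob_bit_def
    by (intro elem_intros elem_bool_eq elementary_score elementary_nth0 data_env_tl assms t1 t2
        elementary_tl[OF elementary_hdnat])
qed

lemma score_cong:
  assumes "\<And>j. j < p ^ 2 \<Longrightarrow> x j = x' j"
  shows "score k p x c = score k p x' c"
  unfolding score_def using assms codeval_less[of _ p k c] by (intro sum.cong) auto

lemma alice_bit_cong:
  assumes x: "\<And>j. j < p ^ 2 + k \<Longrightarrow> x j = x' j" and l: "l < k"
  shows "alice_bit k p s x l = alice_bit k p s x' l"
proof -
  have "score k p x c = score k p x' c" for c by (rule score_cong) (simp add: x)
  then show ?thesis unfolding alice_bit_def using x[of "p ^ 2 + l"] l by simp
qed

lemma bob_bit_cong:
  assumes x: "\<And>j. j < p ^ 2 + k \<Longrightarrow> y j = y' j" and w: "\<And>t. t < m \<Longrightarrow> w t = w' t"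
  shows "bob_bit k p u m y w l = bob_bit k p u m y' w' l"
proof -
  have "score k p y c = score k p y' c" for c by (rule score_cong) (simp add: x)
  then show ?thesis unfolding bob_bit_def using w by simp
qed

text \<open>The key length is the first argument of the formulas for the sizes, but the second one,
  after the bit index, of those for the bits; hence the two forms of the hypotheses.\<close>

lemma explicit_family_threshold_scheme:
  assumes p: "elem_nat A (\<lambda>xs. p (hdnat xs))" "elem_nat A (\<lambda>xs. p (hdnat (tl xs)))"
    and s: "elementary A (\<lambda>xs. s (hdnat (tl xs)))" and u: "elementary A (\<lambda>xs. u (hdnat (tl xs)))"
    and m: "elem_nat A (\<lambda>xs. m (hdnat xs))" "elem_nat A (\<lambda>xs. m (hdnat (tl xs)))" "\<And>k. m k \<le> k"
  shows "explicit_family A (\<lambda>k. threshold_scheme k (p k) (s k) (u k) (m k))"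
proof -
  have k: "elem_nat A (\<lambda>xs. hdnat (tl xs))" by (rule elementary_tl[OF elementary_hdnat])
  \<comment> \<open>Offset 2 skips the bit index and the key length; the message bits follow the
    samples.\<close>
  have data: "nth0 (drop 2 (real i # real k # map x [0..<n] @ z)) j = x j" if "j < n" for i k x n z j
    using that by (simp add: nth0_def nth_append)
  have msg: "nth0 (drop 2 (real i # real k # map x [0..<n] @ map of_bool w)) (n + t) = of_bool (w ! t)"
    if "t < length w" for i k x n and w :: "bool list" and t
    using that by (simp add: nth0_def nth_append)
  define fA where "fA = (\<lambda>xs. of_bool (alice_bit (hdnat (tl xs)) (p (hdnat (tl xs))) (s (hdnat (tl xs))) (nth0 (drop 2 xs)) (hdnat xs)) :: real)"
  have fA: "elementary A fA" unfolding fA_def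
    by (intro elem_bool_alice_bit k p s elementary_hdnat data_env_drop)
  have fA_eq: "of_bool (alice_bit k (p k) (s k) x i) = fA (real i # real k # map x [0..<p k ^ 2 + k])" if "i < k" for i k x
    using alice_bit_cong[of "p k" k x "nth0 (drop 2 (real i # real k # map x [0..<p k ^ 2 + k]))" i "s k"]
      data[of _ "p k ^ 2 + k" i k x "[]"] that by (simp add: fA_def)
  define fB where "fB = (\<lambda>xs. of_bool (bob_bit (hdnat (tl xs)) (p (hdnat (tl xs))) (u (hdnat (tl xs))) (m (hdnat (tl xs)))
      (nth0 (drop 2 xs)) (\<lambda>t. nth0 (drop 2 xs) (p (hdnat (tl xs)) ^ 2 + hdnat (tl xs) + t)) (hdnat xs)) :: real)"
  have fB: "elementary A fB" unfolding fB_def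
    by (intro elem_bool_bob_bit k p u m elementary_hdnat data_env_drop)
  have fB_eq: "of_bool (bob_bit k (p k) (u k) (m k) y (\<lambda>t. of_bool (w ! t)) i) =
      fB (real i # real k # map y [0..<p k ^ 2 + k] @ map of_bool w)" if "length w = m k" for i k y w
    using bob_bit_cong[of "p k" k y "nth0 (drop 2 (real i # real k # map y [0..<p k ^ 2 + k] @ map of_bool w))" "m k"
        "\<lambda>t. of_bool (w ! t)" "\<lambda>t. nth0 (drop 2 (real i # real k # map y [0..<p k ^ 2 + k] @ map of_bool w)) (p k ^ 2 + k + t)" "u k" i]
      data[of _ "p k ^ 2 + k" i k y "map of_bool w"] msg[of _ w i k y "p k ^ 2 + k"] that
    by (simp add: fB_def)
  show ?thesis unfolding explicit_family_def threshold_scheme_simps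
  proof (intro conjI)
    have "elem_nat A (\<lambda>xs. p (hdnat xs) ^ 2 + hdnat xs)" by (intro elem_intros p)
    then show "\<exists>f. elementary A f \<and> (\<forall>k. real (p k ^ 2 + k) = f [real k])"
      by (intro exI[of _ "\<lambda>xs. real (p (hdnat xs) ^ 2 + hdnat xs)"] conjI) simp_all
    show "\<exists>f. elementary A f \<and> (\<forall>k. real (m k) = f [real k])"
      using m(1) by (intro exI[of _ "\<lambda>xs. real (m (hdnat xs))"] conjI) simp_all
    show "\<exists>f. elementary A f \<and> (\<forall>k x. \<forall>i<m k. of_bool (map (alice_bit k (p k) (s k) x) [0..<m k] ! i) =
        f (real i # real k # map x [0..<p k ^ 2 + k]))"
    proof (intro exI[of _ fA] conjI allI impI fA)
      fix k i :: nat and x assume i: "i < m k"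
      then have "i < k" using m(3)[of k] by linarith
      then show "of_bool (map (alice_bit k (p k) (s k) x) [0..<m k] ! i) = fA (real i # real k # map x [0..<p k ^ 2 + k])"
        using fA_eq[of i k x] i by simp
    qed
    show "\<exists>f. elementary A f \<and> (\<forall>k x. \<forall>i<k. of_bool (map (alice_bit k (p k) (s k) x) [0..<k] ! i) =
        f (real i # real k # map x [0..<p k ^ 2 + k]))"
      by (intro exI[of _ fA] conjI allI impI fA) (simp add: fA_eq[symmetric])
    show "\<exists>f. elementary A f \<and> (\<forall>k y w. length w = m k \<longrightarrow> (\<forall>i<k.
        of_bool (map (bob_bit k (p k) (u k) (m k) y (\<lambda>t. of_bool (w ! t))) [0..<k] ! i) =
        f (real i # real k # map y [0..<p k ^ 2 + k] @ map of_bool w)))"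
      by (intro exI[of _ fB] conjI allI impI fB) (simp add: fB_eq[symmetric])
  qed
qed

section \<open>Min-entropy of the key\<close>

lemma min_entropy_ge:
  fixes h :: real
  assumes M: "prob_space M" and V: "V \<in> M \<rightarrow>\<^sub>M count_space S" and S: "finite S"
    and le: "\<And>v. \<P>(\<omega> in M. V \<omega> = v) \<le> 2 powr (- h)"
  shows "h \<le> min_entropy M V"
proof -
  interpret prob_space M by (rule M)
  let ?q = "\<lambda>v. \<P>(\<omega> in M. V \<omega> = v)"
  have bdd: "bdd_above (range ?q)" by (rule bdd_aboveI[of _ 1]) auto
  have m: "{\<omega> \<in> space M. V \<omega> = v} \<in> sets M" if "v \<in> S" for v
    using measurable_sets[OF V, of "{v}"] that by (simp add: vimage_def Int_def conj_commute)
  have "space M = (\<Union>v\<in>S. {\<omega> \<in> space M. V \<omega> = v})"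
    using measurable_space[OF V] by auto
  then have "1 = prob (\<Union>v\<in>S. {\<omega> \<in> space M. V \<omega> = v})" using prob_space by simp
  also have "\<dots> \<le> (\<Sum>v\<in>S. ?q v)" by (rule measure_UNION_le[OF S m])
  finally have one: "1 \<le> (\<Sum>v\<in>S. ?q v)" .
  \<comment> \<open>The supremum must be positive before the logarithm can be taken, as log 2 0 has
    the default value 0.\<close>
  have "\<exists>v\<in>S. 0 < ?q v"
  proof (rule ccontr)
    assume "\<not> ?thesis"
    then have "(\<Sum>v\<in>S. ?q v) \<le> 0" by (intro sum_nonpos) (auto simp: not_less)
    then show False using one by simp
  qed
  then obtain v where "0 < ?q v" by blast
  then have pos: "0 < (SUP v. ?q v)" using cSUP_upper[OF _ bdd, of v] by (meson UNIV_I less_le_trans)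
  have "(SUP v. ?q v) \<le> 2 powr (- h)" by (rule cSUP_least) (use le in auto)
  then have "log 2 (SUP v. ?q v) \<le> - h"
    using pos by (simp add: log_le_iff powr_minus)
  then show ?thesis by (simp add: min_entropy_def)
qed

text \<open>What the min-entropy and the union bounds require of a source. The fair sign of Alice's
  samples makes the fallback key uniform; the joint tail bound is a separate hypothesis.\<close>

locale key_source =
  fixes \<mu> :: "(real \<times> real) measure"
  assumes prob_space_source: "prob_space \<mu>" and sets_source: "sets \<mu> = sets borel"
    and subgaussian_fst: "subgaussian \<mu> fst" and subgaussian_snd: "subgaussian \<mu> snd"
    and fst_nonneg_half: "\<P>(x in \<mu>. 0 \<le> fst x) = 1 / 2"
begin

lemma space_source: "space \<mu> = UNIV"
  using sets_eq_imp_space_eq[OF sets_source] by simp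

lemma prob_space_iid: "prob_space (iid_samples \<mu> n)"
  unfolding iid_samples_def by (intro prob_space_PiM prob_space_source)

lemma measurable_inputs:
  "alice_input n \<in> iid_samples \<mu> n \<rightarrow>\<^sub>M Pi\<^sub>M {..<n} (\<lambda>_. borel)"
  "bob_input n \<in> iid_samples \<mu> n \<rightarrow>\<^sub>M Pi\<^sub>M {..<n} (\<lambda>_. borel)"
proof -
  show "alice_input n \<in> iid_samples \<mu> n \<rightarrow>\<^sub>M Pi\<^sub>M {..<n} (\<lambda>_. borel)"
    unfolding iid_samples_def alice_input_def
    by (rule measurable_restrict, rule borel_measurable_PiM_fst_snd(1)[OF sets_source])
  show "bob_input n \<in> iid_samples \<mu> n \<rightarrow>\<^sub>M Pi\<^sub>M {..<n} (\<lambda>_. borel)"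
    unfolding iid_samples_def bob_input_def
    by (rule measurable_restrict, rule borel_measurable_PiM_fst_snd(2)[OF sets_source])
qed

lemma sign_half: "\<P>(x in \<mu>. (0 \<le> fst x) = b) = 1 / 2"
proof (cases b)
  case True
  then show ?thesis using fst_nonneg_half by simp
next
  case False
  interpret prob_space \<mu> by (rule prob_space_source)
  have m: "{x \<in> space \<mu>. 0 \<le> fst x} \<in> sets \<mu>"
    using borel_measurable_plane_fst_snd(1)[OF sets_source] by (intro borel_measurable_le) auto
  have "{x \<in> space \<mu>. (0 \<le> fst x) = b} = space \<mu> - {x \<in> space \<mu>. 0 \<le> fst x}" using False by auto
  then show ?thesis using prob_compl[OF m] fst_nonneg_half by simp
qed

lemma signs_prob:
  assumes "finite K" "J \<subseteq> K"
  shows "\<P>(\<omega> in iid \<mu> K. \<forall>j\<in>J. (0 \<le> fst (\<omega> j)) = b j) = (1 / 2) ^ card J"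
proof -
  have fJ: "finite J" using assms finite_subset by blast
  have m: "{x \<in> space \<mu>. (0 \<le> fst x) = c} \<in> sets \<mu>" for c
  proof -
    have [measurable]: "fst \<in> borel_measurable \<mu>" by (rule borel_measurable_plane_fst_snd(1)[OF sets_source])
    have "{x \<in> space \<mu>. 0 \<le> fst x} \<in> sets \<mu>" by (intro borel_measurable_le) auto
    then show ?thesis by (cases c) (auto intro: sets.sets_Collect_neg)
  qed
  define A where "A = {\<omega> \<in> space (iid \<mu> J). \<forall>j\<in>J. (0 \<le> fst (\<omega> j)) = b j}"
  have A: "A \<in> sets (iid \<mu> J)"
    unfolding A_def
  proof (rule sets.sets_Collect_finite_All[OF _ fJ])
    fix j assume j: "j \<in> J"
    have "(\<lambda>\<omega>. \<omega> j) -` {x \<in> space \<mu>. (0 \<le> fst x) = b j} \<inter> space (iid \<mu> J) \<in> sets (iid \<mu> J)"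
      by (rule measurable_sets[OF measurable_component_singleton[OF j] m])
    moreover have "(\<lambda>\<omega>. \<omega> j) -` {x \<in> space \<mu>. (0 \<le> fst x) = b j} \<inter> space (iid \<mu> J) =
        {\<omega> \<in> space (iid \<mu> J). (0 \<le> fst (\<omega> j)) = b j}" by (auto simp: space_source)
    ultimately show "{\<omega> \<in> space (iid \<mu> J). (0 \<le> fst (\<omega> j)) = b j} \<in> sets (iid \<mu> J)" by simp
  qed
  have "{\<omega> \<in> space (iid \<mu> K). \<forall>j\<in>J. (0 \<le> fst (\<omega> j)) = b j} =
      {\<omega> \<in> space (iid \<mu> K). restrict \<omega> J \<in> A}"
    by (auto simp: A_def space_PiM space_source)
  then have "\<P>(\<omega> in iid \<mu> K. \<forall>j\<in>J. (0 \<le> fst (\<omega> j)) = b j) =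
      measure (iid \<mu> J) A"
    using measure_PiM_restrict[OF prob_space_source assms A] by simp
  also have "\<dots> = (\<Prod>j\<in>J. \<P>(x in \<mu>. (0 \<le> fst x) = b j))"
    unfolding A_def by (rule measure_PiM_all[OF prob_space_source fJ m])
  also have "\<dots> = (1 / 2) ^ card J" by (simp add: sign_half)
  finally show ?thesis .
qed

lemma score_inputs:
  assumes "0 < p"
  shows "score k p (alice_input (p ^ 2 + k) \<omega>) c = (\<Sum>i\<in>codesupp k p c. fst (\<omega> i))"
    and "score k p (bob_input (p ^ 2 + k) \<omega>) c = (\<Sum>i\<in>codesupp k p c. snd (\<omega> i))"
proof -
  have l: "codeval k p c a < p ^ 2 + k" if "a < p" for a using codeval_less[OF that, of k c] by simp
  show "score k p (alice_input (p ^ 2 + k) \<omega>) c = (\<Sum>i\<in>codesupp k p c. fst (\<omega> i))"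
    unfolding score_def codesupp_def alice_input_def
    by (subst sum.reindex[OF inj_codeval[OF assms]]) (auto simp: l intro!: sum.cong)
  show "score k p (bob_input (p ^ 2 + k) \<omega>) c = (\<Sum>i\<in>codesupp k p c. snd (\<omega> i))"
    unfolding score_def codesupp_def bob_input_def
    by (subst sum.reindex[OF inj_codeval[OF assms]]) (auto simp: l intro!: sum.cong)
qed

lemma codesupp_subset_samples: "codesupp k p c \<subseteq> {..<p ^ 2 + k}"
  using codesupp_subset[of k p c] by auto

text \<open>Either the codeword with bits \<open>v\<close> passes Alice's threshold, or the fallback
  signs spell \<open>v\<close>. Each has probability at most 2^(-k); adding the two costs the one
  bit.\<close>

lemma key_prob_le:
  assumes p: "0 < p" and s: "s = sqrt (2 * H * real p)" and H: "real k * ln 2 \<le> H"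
  shows "\<P>(\<omega> in iid_samples \<mu> (p ^ 2 + k). map (alice_bit k p s (alice_input (p ^ 2 + k) \<omega>)) [0..<k] = v) \<le> 2 powr (- (real k - 1))"
proof -
  let ?n = "p ^ 2 + k"
  define P where "P = iid_samples \<mu> ?n"
  interpret P: prob_space P unfolding P_def by (rule prob_space_iid)
  have PiM: "P = iid \<mu> {..<?n}" by (simp add: P_def iid_samples_def)
  have H0: "0 \<le> H" using H by (meson ln_ge_zero mult_nonneg_nonneg of_nat_0_le_iff one_le_numeral order_trans)
  \<comment> \<open>Contains at most one codeword, and none if \<open>v\<close> does not have length
    \<open>k\<close>.\<close>
  define C where "C = {c :: nat. c < 2 ^ k \<and> map (\<lambda>l. c div 2 ^ l mod 2 = 1) [0..<k] = v}"
  define X where "X = (\<lambda>c. {\<omega> \<in> space P. s \<le> (\<Sum>i\<in>codesupp k p c. fst (\<omega> i))})"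
  define Y where "Y = {\<omega> \<in> space P. \<forall>j\<in>{p ^ 2..<p ^ 2 + k}. (0 \<le> fst (\<omega> j)) = v ! (j - p ^ 2)}"
  have mf: "(\<lambda>\<omega>. fst (\<omega> i)) \<in> borel_measurable P" if "i < ?n" for i
    unfolding PiM by (rule borel_measurable_PiM_fst_snd(1)[OF sets_source]) (use that in simp)
  have mX: "X c \<in> sets P" for c unfolding X_def
    by (intro borel_measurable_le borel_measurable_const borel_measurable_sum mf)
      (use codesupp_subset_samples in blast)
  have mY: "Y \<in> sets P" unfolding Y_def
  proof (rule sets.sets_Collect_finite_All)
    fix j assume "j \<in> {p ^ 2..<p ^ 2 + k}"
    then have "{\<omega> \<in> space P. 0 \<le> fst (\<omega> j)} \<in> sets P" using mf by (intro borel_measurable_le) auto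
    then show "{\<omega> \<in> space P. (0 \<le> fst (\<omega> j)) = v ! (j - p ^ 2)} \<in> sets P"
      by (cases "v ! (j - p ^ 2)") (auto intro: sets.sets_Collect_neg)
  qed simp
  have pX: "P.prob (X c) \<le> 2 powr (- real k)" for c
  proof -
    have s0: "0 \<le> s" using s H0 by simp
    have s2: "s\<^sup>2 = 2 * H * real p" using s H0 by simp
    \<comment> \<open>The optimal Chernoff parameter s / p turns the bound into exp (- H).\<close>
    have "P.prob (X c) \<le> exp (real (card (codesupp k p c)) * ((s / real p)\<^sup>2 / 2) - s / real p * s)"
      unfolding X_def PiM using codesupp_subset_samples s0
      by (intro subgaussian_sum_tail[OF prob_space_source subgaussian_fst]) auto
    also have "real (card (codesupp k p c)) * ((s / real p)\<^sup>2 / 2) - s / real p * s = - (s\<^sup>2 / (2 * real p))"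
      using p by (simp add: card_codesupp power2_eq_square field_simps)
    also have "\<dots> = - H" using p by (simp add: s2)
    also have "exp (- H) \<le> exp (- (real k * ln 2))" using H by simp
    also have "\<dots> = 2 powr (- real k)" by (simp add: powr_def)
    finally show ?thesis .
  qed
  have uC: "c = d" if "c \<in> C" "d \<in> C" for c d
  proof (rule nat_bits_eqI)
    show "c < 2 ^ k" "d < 2 ^ k" using that by (auto simp: C_def)
    fix t assume t: "t < k"
    have "map (\<lambda>l. c div 2 ^ l mod 2 = 1) [0..<k] = map (\<lambda>l. d div 2 ^ l mod 2 = 1) [0..<k]" using that by (simp add: C_def)
    then have "(c div 2 ^ t mod 2 = 1) = (d div 2 ^ t mod 2 = 1)" using t by (simp add: map_eq_conv)
    moreover have "x mod 2 = y mod 2" if "(x mod 2 = 1) = (y mod 2 = 1)" for x y :: nat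
      using that by presburger
    ultimately show "c div 2 ^ t mod 2 = d div 2 ^ t mod 2" by blast
  qed
  have "C = {} \<or> (\<exists>c. C = {c})" using uC by blast
  then have XC: "(\<Union>c\<in>C. X c) \<in> sets P" "P.prob (\<Union>c\<in>C. X c) \<le> 2 powr (- real k)"
    using mX pX by auto
  have pY: "P.prob Y = 2 powr (- real k)"
  proof -
    have "P.prob Y = (1 / 2) ^ card {p ^ 2..<p ^ 2 + k}"
      unfolding Y_def PiM by (rule signs_prob) auto
    also have "\<dots> = 2 powr (- real k)" by (simp add: powr_minus powr_realpow power_one_over inverse_eq_divide)
    finally show ?thesis .
  qed
  have "{\<omega> \<in> space P. map (alice_bit k p s (alice_input ?n \<omega>)) [0..<k] = v} \<subseteq> (\<Union>c\<in>C. X c) \<union> Y"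
  proof
    fix \<omega> assume "\<omega> \<in> {\<omega> \<in> space P. map (alice_bit k p s (alice_input ?n \<omega>)) [0..<k] = v}"
    then have w: "\<omega> \<in> space P" and v: "map (alice_bit k p s (alice_input ?n \<omega>)) [0..<k] = v" by auto
    have vl: "v ! l = alice_bit k p s (alice_input ?n \<omega>) l" if "l < k" for l using v that by auto
    show "\<omega> \<in> (\<Union>c\<in>C. X c) \<union> Y"
    proof (cases "\<exists>c<2 ^ k. s \<le> score k p (alice_input ?n \<omega>) c \<and> (\<forall>d<2 ^ k. s \<le> score k p (alice_input ?n \<omega>) d \<longrightarrow> d = c)")
      case True
      then obtain c where c: "c < 2 ^ k" "s \<le> score k p (alice_input ?n \<omega>) c"
        "\<And>d. d < 2 ^ k \<Longrightarrow> s \<le> score k p (alice_input ?n \<omega>) d \<Longrightarrow> d = c" by blast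
      have "alice_bit k p s (alice_input ?n \<omega>) l \<longleftrightarrow> c div 2 ^ l mod 2 = 1" for l
        unfolding alice_bit_def using c by blast
      then have eq: "alice_bit k p s (alice_input ?n \<omega>) = (\<lambda>l. c div 2 ^ l mod 2 = 1)" by (rule ext)
      have "c \<in> C" using c(1) v[unfolded eq] by (simp add: C_def)
      moreover have "\<omega> \<in> X c" using c(2) w by (simp add: X_def score_inputs[OF p])
      ultimately show ?thesis by blast
    next
      case False
      have "alice_bit k p s (alice_input ?n \<omega>) l \<longleftrightarrow> 0 \<le> alice_input ?n \<omega> (p ^ 2 + l)" for l
        unfolding alice_bit_def using False by blast
      then have "v ! l \<longleftrightarrow> 0 \<le> fst (\<omega> (p ^ 2 + l))" if "l < k" for l
        using vl[OF that] that by (simp add: alice_input_def)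
      then have "\<omega> \<in> Y" using w unfolding Y_def by (auto simp: le_iff_add)
      then show ?thesis by blast
    qed
  qed
  then have "\<P>(\<omega> in P. map (alice_bit k p s (alice_input ?n \<omega>)) [0..<k] = v) \<le> P.prob ((\<Union>c\<in>C. X c) \<union> Y)"
    using XC(1) mY by (intro P.finite_measure_mono) auto
  also have "\<dots> \<le> P.prob (\<Union>c\<in>C. X c) + P.prob Y" using XC(1) mY by (rule measure_Un_le)
  also have "\<dots> \<le> 2 * 2 powr (- real k)" using XC(2) pY by linarith
  also have "\<dots> = 2 powr (- (real k - 1))" by (simp add: powr_diff powr_minus field_simps)
  finally show ?thesis by (simp add: P_def)
qed

lemma key_min_entropy_ge:
  assumes p: "0 < p" and s: "s = sqrt (2 * H * real p)" and H: "real k * ln 2 \<le> H"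
  shows "real k - 1 \<le> key_min_entropy \<mu> (threshold_scheme k p s u m)"
  unfolding key_min_entropy_def threshold_scheme_simps
proof (rule min_entropy_ge[OF prob_space_iid])
  show "(\<lambda>\<omega>. map (alice_bit k p s (alice_input (p ^ 2 + k) \<omega>)) [0..<k]) \<in>
      iid_samples \<mu> (p ^ 2 + k) \<rightarrow>\<^sub>M count_space {K. length K = k}"
    by (rule measurable_compose[OF measurable_inputs(1) measurable_map_bits[OF measurable_alice_bit]])
  show "finite {K :: bool list. length K = k}"
    using finite_lists_length_eq[of "UNIV :: bool set" k] by simp
  show "\<P>(\<omega> in iid_samples \<mu> (p ^ 2 + k). map (alice_bit k p s (alice_input (p ^ 2 + k) \<omega>)) [0..<k] = v) \<le> 2 powr (- (real k - 1))" for v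
    by (rule key_prob_le[OF assms])
qed

end

section \<open>Agreement of the keys\<close>

text \<open>The prefix fixes the \<open>m\<close> low-order bits, so such a \<open>d\<close> is
  determined by \<open>d div 2 ^ m\<close>, for which 2^(k - m) values remain.\<close>

lemma card_same_prefix_le:
  fixes c :: nat
  assumes "m \<le> k"
  shows "card {d. d < 2 ^ k \<and> (\<forall>t<m. d div 2 ^ t mod 2 = c div 2 ^ t mod 2)} \<le> 2 ^ (k - m)"
proof -
  let ?S = "{d :: nat. d < 2 ^ k \<and> (\<forall>t<m. d div 2 ^ t mod 2 = c div 2 ^ t mod 2)}"
  have "inj_on (\<lambda>d. d div 2 ^ m) ?S"
  proof (rule inj_onI)
    fix d e assume d: "d \<in> ?S" "e \<in> ?S" and eq: "d div 2 ^ m = e div 2 ^ m"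
    show "d = e"
    proof (rule nat_bits_eqI[of d k e])
      fix t assume "t < k"
      show "d div 2 ^ t mod 2 = e div 2 ^ t mod 2"
      proof (cases "t < m")
        case True
        then show ?thesis using d by simp
      next
        case False
        then have "(2::nat) ^ t = 2 ^ m * 2 ^ (t - m)" by (simp add: power_add[symmetric])
        then show ?thesis using eq by (simp add: div_mult2_eq)
      qed
    qed (use d in auto)
  qed
  moreover have "(\<lambda>d. d div 2 ^ m) ` ?S \<subseteq> {..<2 ^ (k - m)}"
  proof -
    have "d div 2 ^ m < 2 ^ (k - m)" if "d < 2 ^ k" for d :: nat
      using that assms by (intro less_mult_imp_div_less) (simp add: power_add[symmetric])
    then show ?thesis by auto
  qed
  ultimately have "card ?S \<le> card {..<2 ^ (k - m) :: nat}" by (intro card_inj_on_le) auto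
  then show ?thesis by simp
qed

text \<open>The deterministic part of the analysis: when \<open>c\<close> is the only codeword above
  Alice's threshold, her message is its prefix, so Bob's comparison with \<open>w\<close> is a
  comparison with the low bits of \<open>c\<close>.\<close>

lemma keys_agree:
  assumes c: "c < 2 ^ k" and m: "m \<le> k"
    and x: "s \<le> score k p x c" "\<And>d. d < 2 ^ k \<Longrightarrow> d \<noteq> c \<Longrightarrow> score k p x d < s"
    and y: "u \<le> score k p y c"
      "\<And>d. d < 2 ^ k \<Longrightarrow> d \<noteq> c \<Longrightarrow> (\<And>t. t < m \<Longrightarrow> d div 2 ^ t mod 2 = c div 2 ^ t mod 2) \<Longrightarrow> score k p y d < u"
  shows "map (alice_bit k p s x) [0..<k] =
    map (bob_bit k p u m y (\<lambda>t. of_bool (map (alice_bit k p s x) [0..<m] ! t))) [0..<k]"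
proof -
  have uni: "d = c" if "d < 2 ^ k" "s \<le> score k p x d" for d using x(2)[of d] that by force
  have a: "alice_bit k p s x l \<longleftrightarrow> c div 2 ^ l mod 2 = 1" for l
    unfolding alice_bit_def using c x(1) uni by blast
  have w: "real (d div 2 ^ t mod 2) = of_bool (map (alice_bit k p s x) [0..<m] ! t) \<longleftrightarrow>
      d div 2 ^ t mod 2 = c div 2 ^ t mod 2" if "t < m" for d t
  proof -
    have "of_bool (i mod 2 = 1) = real (i mod 2)" for i :: nat
      by (cases "even i") (auto simp: odd_iff_mod_2_eq_one)
    then have "of_bool (map (alice_bit k p s x) [0..<m] ! t) = real (c div 2 ^ t mod 2)"
      using that by (simp only: nth_map_upt a) simp
    then show ?thesis by simp
  qed
  have "bob_bit k p u m y (\<lambda>t. of_bool (map (alice_bit k p s x) [0..<m] ! t)) l \<longleftrightarrow> c div 2 ^ l mod 2 = 1" for l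
  proof
    assume "bob_bit k p u m y (\<lambda>t. of_bool (map (alice_bit k p s x) [0..<m] ! t)) l"
    then obtain d where d: "d < 2 ^ k" "u \<le> score k p y d" "d div 2 ^ l mod 2 = 1"
      "\<And>t. t < m \<Longrightarrow> d div 2 ^ t mod 2 = c div 2 ^ t mod 2"
      unfolding bob_bit_def using w by blast
    have "d = c" using y(2)[OF d(1) _ d(4)] d(2) by force
    then show "c div 2 ^ l mod 2 = 1" using d(3) by simp
  next
    assume "c div 2 ^ l mod 2 = 1"
    then show "bob_bit k p u m y (\<lambda>t. of_bool (map (alice_bit k p s x) [0..<m] ! t)) l"
      unfolding bob_bit_def using c y(1) w by blast
  qed
  then show ?thesis using a by (intro map_cong refl) blast
qed

text \<open>The coordinates in the overlap contribute at most \<open>q M\<close> to the sum, and those outside of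
  \<open>I\<close> are independent of the event \<open>E\<close>.\<close>

lemma overlap_tail:
  fixes f :: "'a \<Rightarrow> real" and K I J :: "'i set"
  assumes \<mu>: "prob_space \<mu>" and f: "subgaussian \<mu> f" and K: "finite K" "I \<subseteq> K" "J \<subseteq> K"
    and E: "E \<in> sets (iid \<mu> I)" "\<And>\<omega> i. \<omega> \<in> E \<Longrightarrow> i \<in> I \<Longrightarrow> \<bar>f (\<omega> i)\<bar> \<le> M"
    and c: "real (card (J \<inter> I)) \<le> q" "card J \<le> p" and t: "0 \<le> t" "0 \<le> M"
  shows "\<P>(\<omega> in iid \<mu> K. restrict \<omega> I \<in> E \<and> u \<le> (\<Sum>j\<in>J. f (\<omega> j)))
    \<le> measure (iid \<mu> I) E * exp (real p * (t\<^sup>2 / 2) - t * (u - q * M))"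
proof -
  let ?P = "iid \<mu> K"
  interpret P: prob_space ?P by (intro prob_space_PiM \<mu>)
  have [measurable]: "f \<in> borel_measurable \<mu>" using f by (simp add: subgaussian_def)
  have fin: "finite J" "finite I" using K finite_subset by blast+
  define L where "L = J - I"
  have L: "L \<subseteq> K" "I \<inter> L = {}" "finite L" using K fin by (auto simp: L_def)
  define A where "A = {\<omega> \<in> space (iid \<mu> L). u - q * M \<le> (\<Sum>j\<in>L. f (\<omega> j))}"
  have A: "A \<in> sets (iid \<mu> L)" unfolding A_def by measurable
  have mr: "(\<lambda>\<omega>. restrict \<omega> I) \<in> ?P \<rightarrow>\<^sub>M iid \<mu> I" "(\<lambda>\<omega>. restrict \<omega> L) \<in> ?P \<rightarrow>\<^sub>M iid \<mu> L"
    using K(2) L(1) by (auto intro: measurable_restrict_subset)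
  have "\<P>(\<omega> in ?P. restrict \<omega> I \<in> E \<and> u \<le> (\<Sum>j\<in>J. f (\<omega> j))) \<le>
      \<P>(\<omega> in ?P. restrict \<omega> I \<in> E \<and> restrict \<omega> L \<in> A)"
  proof (rule P.finite_measure_mono)
    have "{\<omega> \<in> space ?P. restrict \<omega> I \<in> E} \<in> sets ?P" "{\<omega> \<in> space ?P. restrict \<omega> L \<in> A} \<in> sets ?P"
      using measurable_sets[OF mr(1) E(1)] measurable_sets[OF mr(2) A] by (simp_all add: vimage_def Int_def conj_commute)
    then show "{\<omega> \<in> space ?P. restrict \<omega> I \<in> E \<and> restrict \<omega> L \<in> A} \<in> sets ?P"
      by (auto intro: sets.sets_Collect_conj)
    show "{\<omega> \<in> space ?P. restrict \<omega> I \<in> E \<and> u \<le> (\<Sum>j\<in>J. f (\<omega> j))} \<subseteq>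
        {\<omega> \<in> space ?P. restrict \<omega> I \<in> E \<and> restrict \<omega> L \<in> A}"
    proof (rule subsetI)
      fix \<omega> assume "\<omega> \<in> {\<omega> \<in> space ?P. restrict \<omega> I \<in> E \<and> u \<le> (\<Sum>j\<in>J. f (\<omega> j))}"
      then have w: "\<omega> \<in> space ?P" "restrict \<omega> I \<in> E" "u \<le> (\<Sum>j\<in>J. f (\<omega> j))" by auto
      have "(\<Sum>j\<in>J. f (\<omega> j)) = (\<Sum>j\<in>J \<inter> I. f (\<omega> j)) + (\<Sum>j\<in>L. f (\<omega> j))"
        unfolding L_def by (rule sum.Int_Diff[OF fin(1)])
      moreover have "(\<Sum>j\<in>J \<inter> I. f (\<omega> j)) \<le> (\<Sum>j\<in>J \<inter> I. M)"
      proof (rule sum_mono)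
        fix j assume "j \<in> J \<inter> I"
        then show "f (\<omega> j) \<le> M" using E(2)[OF w(2), of j] by simp
      qed
      moreover have "(\<Sum>j\<in>J \<inter> I. M) \<le> q * M" using c(1) t(2) by (simp add: mult_right_mono)
      ultimately have "u - q * M \<le> (\<Sum>j\<in>L. f (\<omega> j))" using w(3) by linarith
      then have "restrict \<omega> L \<in> A" using measurable_space[OF mr(2) w(1)] by (simp add: A_def)
      then show "\<omega> \<in> {\<omega> \<in> space ?P. restrict \<omega> I \<in> E \<and> restrict \<omega> L \<in> A}" using w by simp
    qed
  qed
  also have "\<dots> = measure (iid \<mu> I) E * measure (iid \<mu> L) A"
    by (rule measure_PiM_restrict_indep[OF \<mu> K(1,2) L(1,2) E(1) A])
  also have "\<dots> \<le> measure (iid \<mu> I) E * exp (real p * (t\<^sup>2 / 2) - t * (u - q * M))"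
  proof (rule mult_left_mono)
    have "measure (iid \<mu> L) A \<le> exp (real (card L) * (t\<^sup>2 / 2) - t * (u - q * M))"
      unfolding A_def by (rule subgaussian_sum_tail[OF \<mu> f L(3)]) (use t in auto)
    also have "\<dots> \<le> exp (real p * (t\<^sup>2 / 2) - t * (u - q * M))"
    proof -
      have "card L \<le> p" using card_mono[OF fin(1), of L] c(2) by (auto simp: L_def)
      then have "real (card L) * (t\<^sup>2 / 2) \<le> real p * (t\<^sup>2 / 2)" by (intro mult_right_mono) auto
      then show ?thesis by simp
    qed
    finally show "measure (iid \<mu> L) A \<le> exp (real p * (t\<^sup>2 / 2) - t * (u - q * M))" .
  qed simp
  finally show ?thesis .
qed

context key_source
begin

text \<open>Independence off the overlap bounds every interference event by a small multiple of the
  probability \<open>e c\<close> of the joint tail event itself, so the union bounds take away only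
  half of \<open>e c\<close>, however small it is. \<open>\<epsilon>\<close> is a common lower bound
  of all \<open>e c\<close>.\<close>

lemma agreement_prob_ge:
  assumes p: "prime p" and H: "0 \<le> H" and s: "s = sqrt (2 * H * real p)" and \<phi>: "0 \<le> \<phi>" "\<phi> \<le> 1" and m: "m \<le> k"
    and M: "M = sqrt (sqrt (real p))" and ov: "s / real p * (real k * M) \<le> ln 2"
    and dA: "2 ^ k * (2 * exp (- H)) \<le> 1 / 4" and dB: "2 ^ (k - m) * (2 * exp (- (\<phi>\<^sup>2 * H))) \<le> 1 / 4"
    and joint: "\<And>I :: nat set. finite I \<Longrightarrow> card I = p \<Longrightarrow> \<epsilon> \<le> \<P>(\<omega> in iid \<mu> I. joint_tail_event s (\<phi> * s) M I \<omega>)"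
  shows "2 ^ k * (\<epsilon> / 2) \<le> agreement_prob \<mu> (threshold_scheme k p s (\<phi> * s) m)"
proof -
  let ?n = "p ^ 2 + k"
  define P where "P = iid \<mu> {..<?n}"
  interpret P: prob_space P unfolding P_def by (intro prob_space_PiM prob_space_source)
  have p0: "0 < p" using p by (rule prime_gt_0_nat)
  define I where "I = codesupp k p"
  have I: "finite (I c)" "card (I c) = p" "I c \<subseteq> {..<?n}" for c
    using card_codesupp[OF p0] codesupp_subset_samples by (auto simp: I_def)
  have s0: "0 \<le> s" using s H by simp
  have s2: "s\<^sup>2 = 2 * H * real p" using s H by simp
  have M0: "0 \<le> M" using M by simp
  define X where "X = (\<lambda>c \<omega>. \<Sum>i\<in>I c. fst (\<omega> i :: real \<times> real))"
  define Y where "Y = (\<lambda>c \<omega>. \<Sum>i\<in>I c. snd (\<omega> i :: real \<times> real))"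
  have mf: "(\<lambda>\<omega>. fst (\<omega> i)) \<in> borel_measurable P" "(\<lambda>\<omega>. snd (\<omega> i)) \<in> borel_measurable P" if "i < ?n" for i
    unfolding P_def by (rule borel_measurable_PiM_fst_snd[OF sets_source], use that in simp)+
  have mX: "X c \<in> borel_measurable P" and mY: "Y c \<in> borel_measurable P" for c
    unfolding X_def Y_def by (intro borel_measurable_sum mf, use I(3) in blast)+
  define ev where "ev = (\<lambda>c. {\<omega> \<in> space (iid \<mu> (I c)). joint_tail_event s (\<phi> * s) M (I c) \<omega>})"
  have ev: "ev c \<in> sets (iid \<mu> (I c))" for c
    unfolding ev_def by (rule sets_joint_tail_event[OF sets_source I(1)]) simp
  have evD: "\<bar>fst (\<omega> i)\<bar> \<le> M" "\<bar>snd (\<omega> i)\<bar> \<le> M" if "\<omega> \<in> ev c" "i \<in> I c" for \<omega> i c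
    using that by (auto simp: ev_def joint_tail_event_def)
  define e where "e = (\<lambda>c. measure (iid \<mu> (I c)) (ev c))"
  have e0: "0 \<le> e c" for c by (simp add: e_def)
  have e_ge: "\<epsilon> \<le> e c" for c unfolding e_def ev_def by (rule joint[OF I(1,2)])
  define E where "E = (\<lambda>c. {\<omega> \<in> space P. restrict \<omega> (I c) \<in> ev c})"
  have E: "E c \<in> sets P" for c
  proof -
    have "(\<lambda>\<omega>. restrict \<omega> (I c)) \<in> P \<rightarrow>\<^sub>M iid \<mu> (I c)"
      unfolding P_def by (rule measurable_restrict_subset[OF I(3)])
    from measurable_sets[OF this ev] show ?thesis by (simp add: E_def vimage_def Int_def conj_commute)
  qed
  have EP: "P.prob (E c) = e c" for c
    unfolding E_def P_def e_def by (rule measure_PiM_restrict[OF prob_space_source _ I(3) ev]) simp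
  have E_XY: "s \<le> X c \<omega>" "\<phi> * s \<le> Y c \<omega>" if "\<omega> \<in> E c" for c \<omega>
    using that by (auto simp: E_def ev_def joint_tail_event_def X_def Y_def)
  define N where "N = {..<2 ^ k :: nat}"
  define Q where "Q = (\<lambda>c. {d. d < 2 ^ k \<and> (\<forall>t<m. d div 2 ^ t mod 2 = c div 2 ^ t mod 2)} :: nat set)"
  define bA where "bA = (\<lambda>c d. {\<omega> \<in> space P. restrict \<omega> (I c) \<in> ev c \<and> s \<le> X d \<omega>})"
  define bB where "bB = (\<lambda>c d. {\<omega> \<in> space P. restrict \<omega> (I c) \<in> ev c \<and> \<phi> * s \<le> Y d \<omega>})"
  have mb: "bA c d \<in> sets P" "bB c d \<in> sets P" for c d
  proof -
    have "{\<omega> \<in> space P. s \<le> X d \<omega>} \<in> sets P" "{\<omega> \<in> space P. \<phi> * s \<le> Y d \<omega>} \<in> sets P"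
      using mX mY by (auto intro: borel_measurable_le)
    then show "bA c d \<in> sets P" "bB c d \<in> sets P"
      using E[of c] unfolding bA_def bB_def E_def by (auto intro: sets.sets_Collect_conj)
  qed
  \<comment> \<open>The Chernoff parameter \<psi> s / p, with \<psi> = 1 for Alice and \<psi> =
    \<phi> for Bob. By hypothesis \<open>ov\<close> the overlap raises the exponent by at most ln 2,
    a factor 2.\<close>
  have tb: "real p * ((\<psi> * s / real p)\<^sup>2 / 2) - \<psi> * s / real p * (\<psi> * s - real k * M) \<le> ln 2 - \<psi>\<^sup>2 * H"
    if "0 \<le> \<psi>" "\<psi> \<le> 1" for \<psi>
  proof -
    have "real p * ((\<psi> * s / real p)\<^sup>2 / 2) - \<psi> * s / real p * (\<psi> * s - real k * M) =
        - (\<psi>\<^sup>2 * (s\<^sup>2 / (2 * real p))) + \<psi> * (s / real p * (real k * M))"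
      using p0 by (simp add: power2_eq_square field_simps)
    also have "s\<^sup>2 / (2 * real p) = H" using p0 by (simp add: s2)
    also have "\<psi> * (s / real p * (real k * M)) \<le> 1 * (s / real p * (real k * M))"
      using that s0 M0 by (intro mult_right_mono) auto
    finally show ?thesis using ov by simp
  qed
  have ex2: "exp (ln 2 - z) = 2 * exp (- z)" for z :: real by (simp add: exp_diff exp_minus inverse_eq_divide)
  have ovc: "real (card (I d \<inter> I c)) \<le> real k" if "c < 2 ^ k" "d < 2 ^ k" "d \<noteq> c" for c d
    using card_codesupp_Int[OF p that(2,1,3)] by (simp add: I_def)
  have bA: "P.prob (bA c d) \<le> e c * (2 * exp (- H))" if "c < 2 ^ k" "d < 2 ^ k" "d \<noteq> c" for c d
  proof -
    have "P.prob (bA c d) \<le> e c * exp (real p * ((1 * s / real p)\<^sup>2 / 2) - 1 * s / real p * (s - real k * M))"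
      unfolding bA_def P_def X_def e_def
      by (rule overlap_tail[OF prob_space_source subgaussian_fst])
        (use I ev evD ovc[OF that] s0 M0 in auto)
    also have "\<dots> \<le> e c * exp (ln 2 - H)"
      using tb[of 1] e0 by (intro mult_left_mono) auto
    finally show ?thesis unfolding ex2 .
  qed
  have bB: "P.prob (bB c d) \<le> e c * (2 * exp (- (\<phi>\<^sup>2 * H)))" if "c < 2 ^ k" "d < 2 ^ k" "d \<noteq> c" for c d
  proof -
    have "P.prob (bB c d) \<le> e c * exp (real p * ((\<phi> * s / real p)\<^sup>2 / 2) - \<phi> * s / real p * (\<phi> * s - real k * M))"
      unfolding bB_def P_def Y_def e_def
      by (rule overlap_tail[OF prob_space_source subgaussian_snd])
        (use I ev evD ovc[OF that] s0 M0 \<phi> in auto)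
    also have "\<dots> \<le> e c * exp (ln 2 - \<phi>\<^sup>2 * H)"
      using tb[OF \<phi>] e0 by (intro mult_left_mono) auto
    finally show ?thesis unfolding ex2 .
  qed
  define bad where "bad = (\<lambda>c. (\<Union>d\<in>N - {c}. bA c d) \<union> (\<Union>d\<in>Q c - {c}. bB c d))"
  define G where "G = (\<lambda>c. E c - bad c)"
  have fin: "finite N" "finite (Q c)" for c by (auto simp: N_def Q_def)
  have m_bad: "bad c \<in> sets P" for c unfolding bad_def using fin mb by auto
  have mG: "G c \<in> sets P" for c unfolding G_def using E m_bad by auto
  have G_ge: "e c / 2 \<le> P.prob (G c)" if c: "c < 2 ^ k" for c
  proof -
    have "P.prob (\<Union>d\<in>N - {c}. bA c d) \<le> (\<Sum>d\<in>N - {c}. P.prob (bA c d))"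
      using fin mb by (intro measure_UNION_le) auto
    also have "\<dots> \<le> (\<Sum>d\<in>N - {c}. e c * (2 * exp (- H)))"
      using bA[OF c] by (intro sum_mono) (auto simp: N_def)
    also have "\<dots> = real (card (N - {c})) * (e c * (2 * exp (- H)))" by simp
    also have "\<dots> \<le> 2 ^ k * (e c * (2 * exp (- H)))"
    proof (rule mult_right_mono)
      have "card (N - {c}) \<le> 2 ^ k" using card_mono[OF fin(1), of "N - {c}"] by (auto simp: N_def)
      then have "real (card (N - {c})) \<le> real (2 ^ k)" by (rule of_nat_mono)
      then show "real (card (N - {c})) \<le> 2 ^ k" by simp
    qed (use e0 in auto)
    also have "\<dots> = e c * (2 ^ k * (2 * exp (- H)))" by (simp only: ac_simps)
    also have "\<dots> \<le> e c * (1 / 4)" by (rule mult_left_mono[OF dA e0])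
    finally have 1: "P.prob (\<Union>d\<in>N - {c}. bA c d) \<le> e c / 4" by simp
    have "P.prob (\<Union>d\<in>Q c - {c}. bB c d) \<le> (\<Sum>d\<in>Q c - {c}. P.prob (bB c d))"
      using fin mb by (intro measure_UNION_le) auto
    also have "\<dots> \<le> (\<Sum>d\<in>Q c - {c}. e c * (2 * exp (- (\<phi>\<^sup>2 * H))))"
      using bB[OF c] by (intro sum_mono) (auto simp: Q_def)
    also have "\<dots> = real (card (Q c - {c})) * (e c * (2 * exp (- (\<phi>\<^sup>2 * H))))" by simp
    also have "\<dots> \<le> 2 ^ (k - m) * (e c * (2 * exp (- (\<phi>\<^sup>2 * H))))"
    proof (rule mult_right_mono)
      have "card (Q c - {c}) \<le> card (Q c)" by (rule card_mono[OF fin(2)]) auto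
      also have "\<dots> \<le> 2 ^ (k - m)" unfolding Q_def by (rule card_same_prefix_le[OF m])
      finally have "real (card (Q c - {c})) \<le> real (2 ^ (k - m))" by (rule of_nat_mono)
      then show "real (card (Q c - {c})) \<le> 2 ^ (k - m)" by simp
    qed (use e0 in auto)
    also have "\<dots> = e c * (2 ^ (k - m) * (2 * exp (- (\<phi>\<^sup>2 * H))))" by (simp only: ac_simps)
    also have "\<dots> \<le> e c * (1 / 4)" by (rule mult_left_mono[OF dB e0])
    finally have 2: "P.prob (\<Union>d\<in>Q c - {c}. bB c d) \<le> e c / 4" by simp
    have "P.prob (bad c) \<le> P.prob (\<Union>d\<in>N - {c}. bA c d) + P.prob (\<Union>d\<in>Q c - {c}. bB c d)"
      unfolding bad_def using fin mb by (intro measure_Un_le) auto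
    then have b: "P.prob (bad c) \<le> e c / 2" using 1 2 by linarith
    have "P.prob (E c) \<le> P.prob (G c \<union> bad c)"
      by (rule P.finite_measure_mono[OF _ sets.Un[OF mG m_bad]]) (auto simp: G_def)
    also have "\<dots> \<le> P.prob (G c) + P.prob (bad c)" using mG m_bad by (rule measure_Un_le)
    finally show ?thesis using b EP by simp
  qed
  have G_X: "X d \<omega> < s" if w: "\<omega> \<in> G c" "d < 2 ^ k" "d \<noteq> c" for \<omega> c d
  proof (rule ccontr)
    assume "\<not> ?thesis"
    then have "\<omega> \<in> bA c d" using w(1) by (simp add: G_def E_def bA_def)
    then have "\<omega> \<in> bad c" using w(2,3) by (auto simp: bad_def N_def)
    then show False using w(1) by (simp add: G_def)
  qed
  have G_Y: "Y d \<omega> < \<phi> * s" if w: "\<omega> \<in> G c" "d < 2 ^ k" "d \<noteq> c"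
    "\<And>t. t < m \<Longrightarrow> d div 2 ^ t mod 2 = c div 2 ^ t mod 2" for \<omega> c d
  proof (rule ccontr)
    assume "\<not> ?thesis"
    then have "\<omega> \<in> bB c d" using w(1) by (simp add: G_def E_def bB_def)
    moreover have "d \<in> Q c" using w(2,4) by (simp add: Q_def)
    ultimately have "\<omega> \<in> bad c" using w(3) by (auto simp: bad_def)
    then show False using w(1) by (simp add: G_def)
  qed
  \<comment> \<open>On \<open>G c\<close> no other codeword passes Alice's threshold, so the
    contributions of the codewords to the agreement probability add up.\<close>
  have disj: "disjoint_family_on G N"
    unfolding disjoint_family_on_def
  proof (intro ballI impI)
    fix c d assume cd: "c \<in> N" "d \<in> N" "c \<noteq> d"
    show "G c \<inter> G d = {}"
    proof (rule ccontr)
      assume "G c \<inter> G d \<noteq> {}"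
      then obtain \<omega> where w: "\<omega> \<in> G c" "\<omega> \<in> G d" by blast
      have "X c \<omega> < s" using G_X[OF w(2), of c] cd by (simp add: N_def)
      moreover have "s \<le> X c \<omega>" using E_XY(1)[of \<omega> c] w(1) by (simp add: G_def)
      ultimately show False by simp
    qed
  qed
  define A where "A = {\<omega> \<in> space P. map (alice_bit k p s (alice_input ?n \<omega>)) [0..<k] =
      map (bob_bit k p (\<phi> * s) m (bob_input ?n \<omega>) (\<lambda>t. of_bool (map (alice_bit k p s (alice_input ?n \<omega>)) [0..<m] ! t))) [0..<k]}"
  \<comment> \<open>Bob's key is known to be measurable for each fixed message only, so the event is
    split over the finitely many messages and keys.\<close>
  have mA: "A \<in> sets P"
  proof -
    have a: "Measurable.pred P (\<lambda>\<omega>. alice_bit k p s (alice_input ?n \<omega>) l)" if "l < k" for l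
      using measurable_compose[OF measurable_inputs(1) measurable_alice_bit[OF that]]
      unfolding P_def iid_samples_def .
    have mk: "(\<lambda>\<omega>. map (alice_bit k p s (alice_input ?n \<omega>)) [0..<j]) \<in> P \<rightarrow>\<^sub>M count_space {K. length K = j}" if "j \<le> k" for j
      by (rule measurable_map_bits, rule a) (use that in simp)
    have mB: "(\<lambda>\<omega>. map (bob_bit k p (\<phi> * s) m (bob_input ?n \<omega>) w) [0..<k]) \<in> P \<rightarrow>\<^sub>M count_space {K. length K = k}" for w
      using measurable_compose[OF measurable_inputs(2) measurable_map_bits[OF measurable_bob_bit]]
      unfolding P_def iid_samples_def .
    have finl: "finite {K :: bool list. length K = j}" for j
      using finite_lists_length_eq[of "UNIV :: bool set" j] by simp
    define fa where "fa = (\<lambda>\<omega>. map (alice_bit k p s (alice_input ?n \<omega>)) [0..<k])"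
    define fm where "fm = (\<lambda>\<omega>. map (alice_bit k p s (alice_input ?n \<omega>)) [0..<m])"
    define fb where "fb = (\<lambda>w \<omega>. map (bob_bit k p (\<phi> * s) m (bob_input ?n \<omega>) (\<lambda>t. of_bool (w ! t))) [0..<k])"
    have len: "length (fa \<omega>) = k" "length (fm \<omega>) = m" "length (fb w \<omega>) = k" for \<omega> w
      by (simp_all add: fa_def fm_def fb_def)
    have A_eq: "A = {\<omega> \<in> space P. fa \<omega> = fb (fm \<omega>) \<omega>}" by (simp add: A_def fa_def fm_def fb_def)
    define Ka where "Ka = (\<lambda>v. {\<omega> \<in> space P. fa \<omega> = v})"
    define Kb where "Kb = (\<lambda>w v. {\<omega> \<in> space P. fb w \<omega> = v})"
    define Km where "Km = (\<lambda>w. {\<omega> \<in> space P. fm \<omega> = w})"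
    have "Ka v \<in> sets P" if "length v = k" for v
      using measurable_sets[OF mk[OF order_refl], of "{v}"] that by (simp add: Ka_def fa_def vimage_def Int_def conj_commute)
    moreover have "Km w \<in> sets P" if "length w = m" for w
      using measurable_sets[OF mk[OF m], of "{w}"] that by (simp add: Km_def fm_def vimage_def Int_def conj_commute)
    moreover have "Kb w v \<in> sets P" if "length v = k" for w v
      using measurable_sets[OF mB, of "{v}"] that by (simp add: Kb_def fb_def vimage_def Int_def conj_commute)
    ultimately have "(\<Union>w\<in>{w. length w = m}. \<Union>v\<in>{v. length v = k}. Km w \<inter> Ka v \<inter> Kb w v) \<in> sets P"
      using finl by (intro sets.finite_UN sets.Int) auto
    moreover have "A = (\<Union>w\<in>{w. length w = m}. \<Union>v\<in>{v. length v = k}. Km w \<inter> Ka v \<inter> Kb w v)"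
      unfolding A_eq Ka_def Kb_def Km_def using len by auto
    ultimately show ?thesis by simp
  qed
  have GA: "G c \<subseteq> A" if c: "c \<in> N" for c
  proof (rule subsetI)
    fix \<omega> assume w: "\<omega> \<in> G c"
    have sp: "\<omega> \<in> space P" using w by (simp add: G_def E_def)
    have sc: "score k p (alice_input ?n \<omega>) d = X d \<omega>" "score k p (bob_input ?n \<omega>) d = Y d \<omega>" for d
      using score_inputs[OF p0] by (auto simp: X_def Y_def I_def)
    have "map (alice_bit k p s (alice_input ?n \<omega>)) [0..<k] =
      map (bob_bit k p (\<phi> * s) m (bob_input ?n \<omega>) (\<lambda>t. of_bool (map (alice_bit k p s (alice_input ?n \<omega>)) [0..<m] ! t))) [0..<k]"
    proof (rule keys_agree[OF _ m])
      show "c < 2 ^ k" using c by (simp add: N_def)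
      show "s \<le> score k p (alice_input ?n \<omega>) c" "\<phi> * s \<le> score k p (bob_input ?n \<omega>) c"
        unfolding sc using E_XY[of \<omega> c] w by (simp_all add: G_def)
      show "score k p (alice_input ?n \<omega>) d < s" if "d < 2 ^ k" "d \<noteq> c" for d
        unfolding sc by (rule G_X[OF w that])
      show "score k p (bob_input ?n \<omega>) d < \<phi> * s" if "d < 2 ^ k" "d \<noteq> c"
        "\<And>t. t < m \<Longrightarrow> d div 2 ^ t mod 2 = c div 2 ^ t mod 2" for d
        unfolding sc by (rule G_Y[OF w that])
    qed
    then show "\<omega> \<in> A" using sp by (simp add: A_def)
  qed
  have "2 ^ k * (\<epsilon> / 2) = (\<Sum>c\<in>N. \<epsilon> / 2)" by (simp add: N_def)
  also have "\<dots> \<le> (\<Sum>c\<in>N. P.prob (G c))"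
  proof (rule sum_mono)
    fix c assume "c \<in> N"
    then show "\<epsilon> / 2 \<le> P.prob (G c)" using G_ge[of c] e_ge[of c] by (simp add: N_def)
  qed
  also have "\<dots> = P.prob (\<Union>c\<in>N. G c)"
    using mG by (intro P.finite_measure_finite_Union[symmetric] fin disj) auto
  also have "\<dots> \<le> P.prob A" using GA mA by (intro P.finite_measure_mono) auto
  also have "P.prob A = agreement_prob \<mu> (threshold_scheme k p s (\<phi> * s) m)"
    by (simp add: agreement_prob_def Let_def A_def P_def iid_samples_def)
  finally show ?thesis .
qed

end

section \<open>Choice of the parameters and assembly of the result\<close>

lemma elementary_numeral: "elementary A (\<lambda>xs. numeral n)"
  using elementary.nat_const[of A "numeral n"] by simp

lemma key_source_DSBS:
  assumes "0 < \<rho>" "\<rho> < 1"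
  shows "key_source (DSBS \<rho>)"
  using DSBS_source[of \<rho>] DSBS_subgaussian[of \<rho>] DSBS_fst_nonneg[of \<rho>] assms
  by (intro key_source.intro) auto

lemma key_source_BGS:
  assumes "0 < \<rho>" "\<rho> < 1"
  shows "key_source (BGS \<rho>)"
proof -
  have \<rho>: "-1 \<le> \<rho>" "\<rho> \<le> 1" using assms by auto
  note B = BGS_source[OF \<rho>]
  show ?thesis
    by (intro key_source.intro B distributed_std_normal_subgaussian distributed_std_normal_nonneg)
qed

context key_source
begin

lemma common_randomness_schemes:
  fixes \<rho> \<delta> \<phi> :: real
  assumes \<rho>: "0 < \<rho>" "\<rho> < 1" and \<delta>: "0 \<le> \<delta>" "\<delta> \<le> sqrt ((1 - \<rho>) / (1 + \<rho>))"
    and \<phi>: "\<phi> = \<rho> + \<delta> * sqrt (1 - \<rho>\<^sup>2)" and tail: "joint_tail_bound \<mu> \<delta> \<phi>"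
  shows "\<exists>S :: nat \<Rightarrow> cr_scheme.
      explicit_family {\<rho>, \<delta>} S \<and>
      (\<forall>k. one_way_scheme k (S k)) \<and>
      (\<exists>a d :: nat. \<forall>k\<ge>1. num_samples (S k) \<le> a * k ^ d) \<and>
      (\<exists>e \<in> o(\<lambda>k. real k). \<forall>k\<ge>1. key_min_entropy \<mu> (S k) \<ge> real k - e k) \<and>
      (\<exists>b d :: nat. b > 0 \<and>
        (\<forall>k\<ge>1. agreement_prob \<mu> (S k) \<ge> 2 powr (- (\<delta>\<^sup>2 * real k)) / (real b * real k ^ d))) \<and>
      (\<forall>k\<ge>1. real (msg_len (S k)) \<le> (1 - \<phi>\<^sup>2) * real k)"
proof -
  note gap = correlation_gap_bounds[OF \<rho> \<delta>]
  have \<phi>01: "0 < \<phi>" "\<phi> \<le> 1"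
    using \<rho> \<delta> gap(1,4) by (auto simp: \<phi> intro: add_pos_nonneg)
  have \<phi>2: "0 < \<phi>\<^sup>2" "\<phi>\<^sup>2 \<le> 1" using \<phi>01 by (auto simp: power_le_one)
  from tail obtain B0 b0 e0 :: nat where J: "0 < b0 \<and> (\<forall>H\<ge>1. \<forall>I :: nat set. finite I \<longrightarrow>
     real B0 * H ^ 6 \<le> real (card I) \<longrightarrow> I \<noteq> {} \<longrightarrow>
     exp (- ((1 + \<delta>\<^sup>2) * H)) / (real b0 * real (card I) ^ e0) \<le>
     joint_tail_prob \<mu> \<phi> H I)"
    unfolding joint_tail_bound_def by (elim exE)
  note b0 = J[THEN conjunct1] and joint = J[THEN conjunct2, rule_format]
  \<comment> \<open>The summand 4 makes Alice's union bound 2^(1 - c0) at most 1/4. The ceiling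
    gives \<phi>^2 c0 \<ge> 4, which brings Bob's exponent 2 - \<phi>^2 c0 down to -2; one of the
    two bits it offsets comes from rounding the prefix length.\<close>
  define c0 where "c0 = nat \<lceil>4 / \<phi>\<^sup>2\<rceil> + 4"
  have c0: "4 \<le> c0" by (simp add: c0_def)
  have c0\<phi>: "4 \<le> \<phi>\<^sup>2 * real c0"
  proof -
    have "4 / \<phi>\<^sup>2 \<le> real c0" unfolding c0_def by linarith
    then show ?thesis using \<phi>2 by (simp add: field_simps)
  qed
  \<comment> \<open>\<open>B0\<close> serves the joint tail bound and 64 the overlap condition; the
    4 in \<open>N\<close> is what \<open>least_prime_above\<close> asks for.\<close>
  define B where "B = B0 + 64"
  define N where "N = (\<lambda>k. B * (k + c0) ^ 6 + 4)"
  define p where "p = (\<lambda>k. least_prime_above (N k))"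
  define H where "H = (\<lambda>k. ln 2 * real (k + c0))"
  define s where "s = (\<lambda>k. sqrt (2 * H k * real (p k)))"
  define m where "m = (\<lambda>k :: nat. nat \<lfloor>(1 - \<phi>\<^sup>2) * real k\<rfloor>)"
  define S where "S = (\<lambda>k. threshold_scheme k (p k) (s k) (\<phi> * s k) (m k))"
  have N4: "4 \<le> N k" for k by (simp add: N_def)
  have p: "prime (p k)" "N k < p k" "p k \<le> 2 * N k ^ 3" for k
    using least_prime_above[OF N4] by (auto simp: p_def)
  have p0: "0 < p k" for k using p(1)[of k] by (rule prime_gt_0_nat)
  have mr: "real (m k) = of_int \<lfloor>(1 - \<phi>\<^sup>2) * real k\<rfloor>" for k
    using \<phi>2 by (simp add: m_def)
  have m_le: "real (m k) \<le> (1 - \<phi>\<^sup>2) * real k" for k unfolding mr by linarith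
  have m_ge: "(1 - \<phi>\<^sup>2) * real k - 1 \<le> real (m k)" for k unfolding mr by linarith
  have mk: "m k \<le> k" for k
  proof -
    have "(1 - \<phi>\<^sup>2) * real k \<le> 1 * real k" using \<phi>2 by (intro mult_right_mono) auto
    then show ?thesis using m_le[of k] by linarith
  qed
  have ln2: "1 / 2 \<le> ln (2::real)" "ln (2::real) \<le> 1" using ln2_ge_two_thirds ln_le_minus_one[of "2::real"] by auto

  have explicit: "explicit_family {\<rho>, \<delta>} S"
    unfolding S_def
  proof (rule explicit_family_threshold_scheme)
    let ?A = "{\<rho>, \<delta>}"
    \<comment> \<open>\<open>B\<close> and \<open>c0\<close> are natural constants and \<phi> is a
      formula in \<rho> and \<delta>, so the formulas contain no other real parameters.\<close>
    have el_p: "elem_nat ?A (\<lambda>xs. p (f xs))" if "elem_nat ?A f" for f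
      unfolding p_def N_def by (intro elem_nat_least_prime_above elem_intros that) simp
    have el_\<phi>: "elementary ?A (\<lambda>xs. \<phi>)"
      unfolding \<phi> power2_eq_square by (intro elementary.intros elementary_one) auto
    have el_s: "elementary ?A (\<lambda>xs. s (f xs))" if "elem_nat ?A f" for f
      unfolding s_def H_def
      by (intro elementary.sqrt elementary.mult elementary.ln elementary_numeral el_p elem_intros that)
    have el_m: "elem_nat ?A (\<lambda>xs. m (f xs))" if "elem_nat ?A f" for f
      unfolding mr power2_eq_square by (intro elementary.floor elementary.mult elementary.diff elementary_one el_\<phi> that)
    note h = elementary_hdnat[of ?A] elementary_tl[OF elementary_hdnat, of ?A]
    show "elem_nat ?A (\<lambda>xs. p (hdnat xs))" "elem_nat ?A (\<lambda>xs. p (hdnat (tl xs)))"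
      "elem_nat ?A (\<lambda>xs. m (hdnat xs))" "elem_nat ?A (\<lambda>xs. m (hdnat (tl xs)))"
      "elementary ?A (\<lambda>xs. s (hdnat (tl xs)))"
      using h by (auto intro: el_p el_m el_s)
    show "elementary ?A (\<lambda>xs. \<phi> * s (hdnat (tl xs)))"
      by (intro elementary.mult el_\<phi> el_s h)
  qed (rule mk)

  \<comment> \<open>\<open>N\<close> has degree 6 in k and the prime at most degree 18; its square
    gives the exponent 36 of the sample bound.\<close>
  define a1 where "a1 = 2 * ((B + 4) * (1 + c0) ^ 6) ^ 3"
  have p_le: "p k \<le> a1 * k ^ 18" if k: "1 \<le> k" for k
  proof -
    have "1 \<le> (k + c0) ^ 6" using k by simp
    then have "N k \<le> (B + 4) * (k + c0) ^ 6" unfolding N_def add_mult_distrib by linarith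
    also have "\<dots> \<le> (B + 4) * ((1 + c0) * k) ^ 6"
      using k by (intro mult_le_mono power_mono) (auto simp: add_mult_distrib)
    finally have "N k ^ 3 \<le> ((B + 4) * ((1 + c0) * k) ^ 6) ^ 3" by (intro power_mono) auto
    then have "p k \<le> 2 * ((B + 4) * ((1 + c0) * k) ^ 6) ^ 3" using p(3)[of k] by linarith
    also have "\<dots> = a1 * k ^ 18"
    proof -
      have "2 * (x * (y * k) ^ 6) ^ 3 = 2 * (x * y ^ 6) ^ 3 * k ^ 18" for x y :: nat
        by (simp add: power_mult_distrib power_mult[symmetric])
      then show ?thesis unfolding a1_def .
    qed
    finally show ?thesis .
  qed
  have samples: "num_samples (S k) \<le> (a1 ^ 2 + 1) * k ^ 36" if k: "1 \<le> k" for k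
  proof -
    have "p k ^ 2 \<le> (a1 * k ^ 18) ^ 2" using p_le[OF k] by (intro power_mono) auto
    also have "\<dots> = a1 ^ 2 * k ^ 36" by (simp add: power_mult_distrib power_mult[symmetric])
    finally have "p k ^ 2 \<le> a1 ^ 2 * k ^ 36" .
    moreover have "k \<le> k ^ 36" using k power_increasing[of 1 36 k] by simp
    ultimately show ?thesis by (simp add: S_def add_mult_distrib)
  qed

  have entropy: "real k - 1 \<le> key_min_entropy \<mu> (S k)" for k
    unfolding S_def
  proof (rule key_min_entropy_ge[OF p0])
    show "s k = sqrt (2 * H k * real (p k))" by (simp add: s_def)
    have "real k * ln 2 \<le> real (k + c0) * ln 2" using ln2 by (intro mult_right_mono) auto
    then show "real k * ln 2 \<le> H k" by (simp add: H_def mult.commute)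
  qed

  \<comment> \<open>The surplus c0 in \<open>H\<close> costs 2^((1 + \<delta>^2) c0) \<le> 2^(2 c0),
    interference a factor 2, and the joint tail bound the factor b0 p^e0, with \<open>p\<close>
    bounded through \<open>a1\<close>.\<close>
  define b where "b = 2 ^ (2 * c0 + 1) * b0 * a1 ^ e0"
  have a1: "0 < a1" by (simp add: a1_def B_def)
  have agree: "2 powr (- (\<delta>\<^sup>2 * real k)) / (real b * real k ^ (18 * e0)) \<le> agreement_prob \<mu> (S k)"
    if k: "1 \<le> k" for k
  proof -
    define K where "K = real (k + c0)"
    have K: "4 \<le> K" "real k \<le> K" using c0 by (auto simp: K_def)
    have HK: "H k = ln 2 * K" by (simp add: H_def K_def)
    have H1: "1 \<le> H k"
    proof -
      have "1 / 2 * 4 \<le> ln 2 * K" using ln2 K by (intro mult_mono) auto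
      then show ?thesis by (simp add: HK)
    qed
    have H_le: "H k \<le> K" using ln2 K mult_right_mono[of "ln 2" 1 K] by (simp add: HK)
    have pN: "real B * K ^ 6 \<le> real (p k)"
    proof -
      have "B * (k + c0) ^ 6 \<le> p k" using p(2)[of k] by (simp add: N_def)
      then have "real (B * (k + c0) ^ 6) \<le> real (p k)" by (rule of_nat_mono)
      then show ?thesis by (simp add: K_def)
    qed
    have pB: "real B0 * H k ^ 6 \<le> real (p k)" "64 * K ^ 6 \<le> real (p k)"
    proof -
      have K6: "0 \<le> K ^ 6" using K by simp
      have "real B0 * H k ^ 6 \<le> real B0 * K ^ 6" using H_le H1 by (intro mult_left_mono power_mono) auto
      moreover have "real B * K ^ 6 = real B0 * K ^ 6 + 64 * K ^ 6" by (simp add: B_def algebra_simps)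
      moreover have "0 \<le> real B0 * K ^ 6" using K6 by simp
      ultimately show "real B0 * H k ^ 6 \<le> real (p k)" "64 * K ^ 6 \<le> real (p k)" using pN K6 by linarith+
    qed
    define \<epsilon> where "\<epsilon> = exp (- ((1 + \<delta>\<^sup>2) * H k)) / (real b0 * real (p k) ^ e0)"
    have "2 ^ k * (\<epsilon> / 2) \<le> agreement_prob \<mu> (S k)"
      unfolding S_def
    proof (rule agreement_prob_ge[where M = "sqrt (sqrt (real (p k)))" and H = "H k"])
      show "prime (p k)" "m k \<le> k" by (rule p mk)+
      show "0 \<le> H k" "0 \<le> \<phi>" "\<phi> \<le> 1" using H1 \<phi>01 by auto
      show "s k = sqrt (2 * H k * real (p k))" by (simp add: s_def)
      show "s k / real (p k) * (real k * sqrt (sqrt (real (p k)))) \<le> ln 2"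
      proof -
        define q where "q = real (p k)"
        have q: "0 < q" using p0[of k] by (simp add: q_def)
        \<comment> \<open>Here 64 enters: the square of the overlap term is 2 H k^2 / sqrt p, at
          most 2 K^3 / (8 K^3) = 1/4, and 1/2 is below ln 2.\<close>
        have sq: "8 * K ^ 3 \<le> sqrt q"
          by (rule real_le_rsqrt) (use pB(2) in \<open>simp add: q_def power_mult_distrib power_mult[symmetric]\<close>)
        have "s k / q * (real k * sqrt (sqrt q)) \<le> 1 / 2"
        proof (rule power2_le_imp_le)
          have "(s k / q * (real k * sqrt (sqrt q)))\<^sup>2 = (s k)\<^sup>2 / q\<^sup>2 * ((real k)\<^sup>2 * sqrt q)"
            using q by (simp add: power_mult_distrib power_divide)
          also have "(s k)\<^sup>2 = 2 * H k * q" using H1 by (simp add: s_def q_def)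
          also have "2 * H k * q / q\<^sup>2 * ((real k)\<^sup>2 * sqrt q) = 2 * H k * (real k)\<^sup>2 * (sqrt q / q)"
            using q by (simp add: power2_eq_square)
          also have "sqrt q / q = 1 / sqrt q" using q by (simp add: field_simps)
          also have "2 * H k * (real k)\<^sup>2 * (1 / sqrt q) \<le> 2 * K * K\<^sup>2 * (1 / (8 * K ^ 3))"
            using H1 H_le K sq q by (intro mult_mono power_mono divide_left_mono) auto
          also have "\<dots> = (1 / 2)\<^sup>2" using K by (simp add: power2_eq_square power3_eq_cube)
          finally show "(s k / q * (real k * sqrt (sqrt q)))\<^sup>2 \<le> (1 / 2)\<^sup>2" .
        qed simp
        then show ?thesis using ln2(1) unfolding q_def by linarith
      qed
      have exH: "exp (- (\<psi> * H k)) = 2 powr (- (\<psi> * K))" for \<psi> by (simp add: powr_def HK mult_ac)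
      show "2 ^ k * (2 * exp (- H k)) \<le> 1 / 4"
      proof -
        have "2 ^ k * (2 * exp (- H k)) = 2 powr real k * (2 powr 1 * 2 powr (- K))"
          using exH[of 1] by (simp add: powr_realpow)
        also have "\<dots> = 2 powr (1 - real c0)"
          unfolding powr_add[symmetric] by (simp add: K_def)
        also have "\<dots> \<le> 2 powr (- 2)" using c0 by (intro powr_mono) auto
        also have "\<dots> = 1 / 4" by (simp add: powr_minus_divide)
        finally show ?thesis .
      qed
      show "2 ^ (k - m k) * (2 * exp (- (\<phi>\<^sup>2 * H k))) \<le> 1 / 4"
      proof -
        have "2 ^ (k - m k) * (2 * exp (- (\<phi>\<^sup>2 * H k))) = 2 powr real (k - m k) * (2 powr 1 * 2 powr (- (\<phi>\<^sup>2 * K)))"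
          by (simp add: powr_realpow exH)
        also have "\<dots> = 2 powr (real (k - m k) + 1 - \<phi>\<^sup>2 * K)"
          unfolding powr_add[symmetric] by (simp add: algebra_simps)
        also have "\<dots> \<le> 2 powr (- 2)"
        proof (rule powr_mono)
          have "real (k - m k) \<le> \<phi>\<^sup>2 * real k + 1" using m_ge[of k] mk[of k] by (simp add: of_nat_diff algebra_simps)
          then show "real (k - m k) + 1 - \<phi>\<^sup>2 * K \<le> - 2" using c0\<phi> by (simp add: K_def algebra_simps)
        qed simp
        also have "\<dots> = 1 / 4" by (simp add: powr_minus_divide)
        finally show ?thesis .
      qed
      fix I :: "nat set" assume I: "finite I" "card I = p k"
      have "I \<noteq> {}" using I p0[of k] by auto
      then show "\<epsilon> \<le> \<P>(\<omega> in iid \<mu> I. joint_tail_event (s k) (\<phi> * s k) (sqrt (sqrt (real (p k)))) I \<omega>)"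
        using joint[OF H1 I(1)] pB(1) unfolding I(2) \<epsilon>_def s_def by simp
    qed simp
    moreover have "2 powr (- (\<delta>\<^sup>2 * real k)) / (real b * real k ^ (18 * e0)) \<le> 2 ^ k * (\<epsilon> / 2)"
    proof -
      have d2: "\<delta>\<^sup>2 \<le> 1" using \<delta> gap(3) by (simp add: power_le_one)
      have "(1 + \<delta>\<^sup>2) * real c0 \<le> 2 * real c0" using d2 by (intro mult_right_mono) auto
      then have "- (\<delta>\<^sup>2 * real k) - 2 * real c0 \<le> real k - (1 + \<delta>\<^sup>2) * K" by (simp add: K_def algebra_simps)
      then have "2 powr (- (\<delta>\<^sup>2 * real k) - 2 * real c0) \<le> 2 powr (real k - (1 + \<delta>\<^sup>2) * K)" by (intro powr_mono) auto
      also have "\<dots> = 2 ^ k * exp (- ((1 + \<delta>\<^sup>2) * H k))"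
      proof -
        have "exp (- ((1 + \<delta>\<^sup>2) * H k)) = 2 powr (- ((1 + \<delta>\<^sup>2) * K))" by (simp add: powr_def HK mult_ac)
        moreover have "2 powr real k * 2 powr (- ((1 + \<delta>\<^sup>2) * K)) = 2 powr (real k - (1 + \<delta>\<^sup>2) * K)"
          unfolding powr_add[symmetric] by simp
        ultimately show ?thesis by (simp add: powr_realpow)
      qed
      finally have 1: "2 powr (- (\<delta>\<^sup>2 * real k) - 2 * real c0) \<le> 2 ^ k * exp (- ((1 + \<delta>\<^sup>2) * H k))" .
      have "real (p k) \<le> real (a1 * k ^ 18)" using p_le[OF k] by (rule of_nat_mono)
      then have "real (p k) ^ e0 \<le> real (a1 * k ^ 18) ^ e0" by (rule power_mono) simp
      also have "\<dots> = real a1 ^ e0 * real k ^ (18 * e0)" by (simp add: power_mult_distrib power_mult)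
      finally have 2: "real (p k) ^ e0 \<le> real a1 ^ e0 * real k ^ (18 * e0)" .
      have "2 powr (- (\<delta>\<^sup>2 * real k)) / (real b * real k ^ (18 * e0)) =
          2 powr (- (\<delta>\<^sup>2 * real k) - 2 * real c0) / (2 * real b0 * (real a1 ^ e0 * real k ^ (18 * e0)))"
      proof -
        have "2 powr (2 * real c0) = (2::real) ^ (2 * c0)" using powr_realpow[of 2 "2 * c0"] by simp
        then show ?thesis by (simp add: b_def powr_diff field_simps)
      qed
      also have "\<dots> \<le> 2 ^ k * exp (- ((1 + \<delta>\<^sup>2) * H k)) / (2 * real b0 * real (p k) ^ e0)"
        using 1 2 b0 p0[of k] by (intro frac_le mult_left_mono) auto
      also have "\<dots> = 2 ^ k * (\<epsilon> / 2)" by (simp add: \<epsilon>_def)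
      finally show ?thesis .
    qed
    ultimately show ?thesis by linarith
  qed

  have one: "(\<lambda>_. 1) \<in> o(\<lambda>k. real k)"
    by (rule smalloI_tendsto) (use lim_1_over_n in \<open>auto simp: eventually_at_top_linorder intro!: exI[of _ 1]\<close>)
  show ?thesis
  proof (rule exI[of _ S], intro conjI)
    show "explicit_family {\<rho>, \<delta>} S" by (rule explicit)
    show "\<forall>k. one_way_scheme k (S k)" unfolding S_def by (intro allI one_way_threshold_scheme mk)
    show "\<exists>a d :: nat. \<forall>k\<ge>1. num_samples (S k) \<le> a * k ^ d"
      by (rule exI[of _ "a1 ^ 2 + 1"], rule exI[of _ 36]) (use samples in simp)
    show "\<exists>e \<in> o(\<lambda>k. real k). \<forall>k\<ge>1. key_min_entropy \<mu> (S k) \<ge> real k - e k"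
      by (rule bexI[OF _ one]) (use entropy in auto)
    have b: "0 < b" using b0 a1 by (simp add: b_def)
    show "\<exists>b d :: nat. b > 0 \<and>
        (\<forall>k\<ge>1. agreement_prob \<mu> (S k) \<ge> 2 powr (- (\<delta>\<^sup>2 * real k)) / (real b * real k ^ d))"
      by (rule exI[of _ b], rule exI[of _ "18 * e0"]) (use agree b in simp)
    show "\<forall>k\<ge>1. real (msg_len (S k)) \<le> (1 - \<phi>\<^sup>2) * real k"
      using m_le by (simp add: S_def)
  qed
qed

end

theorem theorem1p2:
  shows "\<exists>C>0. \<forall>\<rho> \<delta> \<phi> :: real.
    0 < \<rho> \<longrightarrow> \<rho> < 1 \<longrightarrow> 0 \<le> \<delta> \<longrightarrow> \<delta> \<le> sqrt ((1 - \<rho>) / (1 + \<rho>)) \<longrightarrow>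
    \<phi> = \<rho> + \<delta> * sqrt (1 - \<rho>\<^sup>2) \<longrightarrow>
    (\<forall>\<mu> \<in> {DSBS \<rho>, BGS \<rho>}. \<exists>S :: nat \<Rightarrow> cr_scheme.
      explicit_family {\<rho>, \<delta>} S \<and>
      (\<forall>k. one_way_scheme k (S k)) \<and>
      (\<exists>a d :: nat. \<forall>k\<ge>1. num_samples (S k) \<le> a * k ^ d) \<and>
      (\<exists>e \<in> o(\<lambda>k. real k). \<forall>k\<ge>1. key_min_entropy \<mu> (S k) \<ge> real k - e k) \<and>
      (\<exists>b d :: nat. b > 0 \<and>
        (\<forall>k\<ge>1. agreement_prob \<mu> (S k) \<ge> 2 powr (- (\<delta>\<^sup>2 * real k)) / (real b * real k ^ d))) \<and>
      (\<forall>k\<ge>1. real (msg_len (S k)) \<le> C * (1 - \<phi>\<^sup>2) * real k))"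
\<comment> \<open>The constant is 1 for all \<rho> and \<delta>, since the prefix length is (1 -
  \<phi>^2) k rounded down.\<close>
proof (rule exI[of _ 1], intro conjI allI impI ballI)
  fix \<rho> \<delta> \<phi> :: real and \<mu>
  assume A: "0 < \<rho>" "\<rho> < 1" "0 \<le> \<delta>" "\<delta> \<le> sqrt ((1 - \<rho>) / (1 + \<rho>))"
    "\<phi> = \<rho> + \<delta> * sqrt (1 - \<rho>\<^sup>2)" and \<mu>: "\<mu> \<in> {DSBS \<rho>, BGS \<rho>}"
  interpret key_source \<mu>
    using \<mu> key_source_DSBS[OF A(1,2)] key_source_BGS[OF A(1,2)] by auto
  have "joint_tail_bound \<mu> \<delta> \<phi>"
    using \<mu> DSBS_joint_tail[OF A] BGS_joint_tail[OF A] by auto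
  from common_randomness_schemes[OF A this]
  show "\<exists>S :: nat \<Rightarrow> cr_scheme.
      explicit_family {\<rho>, \<delta>} S \<and>
      (\<forall>k. one_way_scheme k (S k)) \<and>
      (\<exists>a d :: nat. \<forall>k\<ge>1. num_samples (S k) \<le> a * k ^ d) \<and>
      (\<exists>e \<in> o(\<lambda>k. real k). \<forall>k\<ge>1. key_min_entropy \<mu> (S k) \<ge> real k - e k) \<and>
      (\<exists>b d :: nat. b > 0 \<and>
        (\<forall>k\<ge>1. agreement_prob \<mu> (S k) \<ge> 2 powr (- (\<delta>\<^sup>2 * real k)) / (real b * real k ^ d))) \<and>
      (\<forall>k\<ge>1. real (msg_len (S k)) \<le> 1 * (1 - \<phi>\<^sup>2) * real k)"
    by simp
qed simp

end
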